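(* For $n=1,2$ or $3$ and $\omega$ a complex number with $\omega^{2n}=1$, the category $\mathcal{AT}_{n,\omega}$ exists only if $\omega=1$.
   Context: Let $\tau=\frac{1+\sqrt5}{2}$. $A_2$ denotes the unitary pivotal fusion category with simple objects $1,\theta$, where $\theta$ is symmetrically self-dual of dimension $1$ and $\theta\otimes\theta\cong 1$ (diagrammatically: unoriented $\theta$-strands, closed loop equal to $1$, and $\mathrm{id}_{\theta\otimes\theta}=\mathrm{coev}_\theta\,\mathrm{ev}_\theta$). $T_2$ denotes the unitary Fibonacci category (the even half of the Temperley–Lieb category $A_4$ with loop parameter $\tau$): simple objects $1,\rho$, with $\rho$ symmetrically self-dual of dimension $\tau$ and $\rho\otimes\rho\cong1\oplus\rho$. The free product $A_2*T_2$ is the pivotal category whose objects are words in objects of $A_2$ and $T_2$ and whose morphisms are linear combinations of planar disjoint unions of diagrams from $A_2$ and diagrams from $T_2$ (strands of different types may not cross), modulo the local relations of $A_2$ and of $T_2$. A quotient of a pivotal category $\mathcal C$ is a pivotal category $\mathcal D$ with a faithful, dominant tensor functor $\mathcal C\to\mathcal D$ preserving the pivotal structure (dominant: every simple object of $\mathcal D$ is a summand of the image of an object of $\mathcal C$); it is a unitary quotient if $\mathcal D$ is unitary and the functor preserves $*$. Categories are considered up to direct-sum and idempotent completion; tensor signs are omitted and images of $\theta,\rho$ keep their names. For $n\ge1$ and $\omega^{2n}=1$, $\mathcal{AT}_{n,\omega}$ denotes the unitary quotient of $A_2*T_2$ (provided it exists) such that $n$ is the least positive integer with $(\rho\theta)^n\cong(\theta\rho)^n$,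 and which is generated over $A_2*T_2$ by a unitary isomorphism $U:(\rho\theta)^n\to(\theta\rho)^n$ satisfying $\mathcal F^{-1}(U)=U^*=\omega^{-1}\mathcal F(U)$. Here, with $\zeta=(\theta\rho)^{n-1}\theta$ (so $U:\rho\zeta\to\zeta\rho$) and $\xi=\rho(\theta\rho)^{n-1}$ (so $U:\xi\theta\to\theta\xi$), $\mathcal F(U)=(\mathrm{id}_{\rho\zeta}\otimes \mathrm{ev}_\rho)(\mathrm{id}_\rho\otimes U\otimes \mathrm{id}_\rho)(\mathrm{coev}_\rho\otimes \mathrm{id}_{\zeta\rho})$ and $\mathcal F^{-1}(U)=(\mathrm{ev}_\theta\otimes \mathrm{id}_{\xi\theta})(\mathrm{id}_\theta\otimes U\otimes \mathrm{id}_\theta)(\mathrm{id}_{\theta\xi}\otimes \mathrm{coev}_\theta)$, where $\mathrm{ev}_x:xx\to1$ and $\mathrm{coev}_x:1\to xx$ are the caps and cups. *)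

theory Defs
  imports Complex_Main
begin

section \<open>Strict pivotal *-categories\<close>

text \<open>
  All categories are strict: objects form a monoid under tensor product, duality is a strict
  involution reversing tensor products, and coherence isomorphisms are identities (the usual
  setting of the graphical calculus).  \<open>comp\<close> is in the usual order, \<open>g \<cdot> f\<close> being
  \<open>g\<close> after \<open>f\<close>.  The cap \<open>ev x\<close> goes from \<open>dual x \<odot> x\<close> to the unit;
  cups are adjoints of caps, see \<open>coev\<close> below.
\<close>

record ('o, 'm) pivotal_data =
  ob :: "'o set"
  hom :: "'o \<Rightarrow> 'o \<Rightarrow> 'm set"
  ident :: "'o \<Rightarrow> 'm"
  comp :: "'m \<Rightarrow> 'm \<Rightarrow> 'm"  (infixr \<open>\<cdot>\<index>\<close> 65)
  unt :: "'o"
  tensor_ob :: "'o \<Rightarrow> 'o \<Rightarrow> 'o"  (infixr \<open>\<odot>\<index>\<close> 70)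
  tensor :: "'m \<Rightarrow> 'm \<Rightarrow> 'm"  (infixr \<open>\<otimes>\<index>\<close> 70)
  add :: "'m \<Rightarrow> 'm \<Rightarrow> 'm"
  scale :: "complex \<Rightarrow> 'm \<Rightarrow> 'm"
  zero :: "'o \<Rightarrow> 'o \<Rightarrow> 'm"
  star :: "'m \<Rightarrow> 'm"
  dual :: "'o \<Rightarrow> 'o"
  ev :: "'o \<Rightarrow> 'm"

text \<open>The cup from the unit to \<open>x \<odot> dual x\<close>; recall that \<open>dual (dual x) = x\<close>.\<close>

definition coev :: "('o, 'm, 'z) pivotal_data_scheme \<Rightarrow> 'o \<Rightarrow> 'm" where
  "coev C x = star C (ev C (dual C x))"

locale strict_monoidal_star_category =
  fixes C :: "('o, 'm, 'z) pivotal_data_scheme" (structure)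
  assumes ident_hom: "x \<in> ob C \<Longrightarrow> ident C x \<in> hom C x x"
    and comp_hom: "\<lbrakk>x \<in> ob C; y \<in> ob C; z \<in> ob C; f \<in> hom C x y; g \<in> hom C y z\<rbrakk>
      \<Longrightarrow> g \<cdot> f \<in> hom C x z"
    and comp_ident: "\<lbrakk>x \<in> ob C; y \<in> ob C; f \<in> hom C x y\<rbrakk>
      \<Longrightarrow> f \<cdot> ident C x = f \<and> ident C y \<cdot> f = f"
    and comp_assoc: "\<lbrakk>w \<in> ob C; x \<in> ob C; y \<in> ob C; z \<in> ob C;
        f \<in> hom C w x; g \<in> hom C x y; h \<in> hom C y z\<rbrakk>
      \<Longrightarrow> (h \<cdot> g) \<cdot> f = h \<cdot> (g \<cdot> f)"
    and zero_hom: "\<lbrakk>x \<in> ob C; y \<in> ob C\<rbrakk> \<Longrightarrow> zero C x y \<in> hom C x y"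
    and add_hom: "\<lbrakk>x \<in> ob C; y \<in> ob C; f \<in> hom C x y; g \<in> hom C x y\<rbrakk>
      \<Longrightarrow> add C f g \<in> hom C x y"
    and scale_hom: "\<lbrakk>x \<in> ob C; y \<in> ob C; f \<in> hom C x y\<rbrakk> \<Longrightarrow> scale C a f \<in> hom C x y"
    and add_commute: "\<lbrakk>x \<in> ob C; y \<in> ob C; f \<in> hom C x y; g \<in> hom C x y\<rbrakk>
      \<Longrightarrow> add C f g = add C g f"
    and add_assoc: "\<lbrakk>x \<in> ob C; y \<in> ob C; f \<in> hom C x y; g \<in> hom C x y; h \<in> hom C x y\<rbrakk>
      \<Longrightarrow> add C (add C f g) h = add C f (add C g h)"
    and add_zero: "\<lbrakk>x \<in> ob C; y \<in> ob C; f \<in> hom C x y\<rbrakk> \<Longrightarrow> add C (zero C x y) f = f"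
    and scale_zero: "\<lbrakk>x \<in> ob C; y \<in> ob C; f \<in> hom C x y\<rbrakk> \<Longrightarrow> scale C 0 f = zero C x y"
    and scale_one: "\<lbrakk>x \<in> ob C; y \<in> ob C; f \<in> hom C x y\<rbrakk> \<Longrightarrow> scale C 1 f = f"
    and scale_scale: "\<lbrakk>x \<in> ob C; y \<in> ob C; f \<in> hom C x y\<rbrakk>
      \<Longrightarrow> scale C a (scale C b f) = scale C (a * b) f"
    and scale_add_left: "\<lbrakk>x \<in> ob C; y \<in> ob C; f \<in> hom C x y\<rbrakk>
      \<Longrightarrow> scale C (a + b) f = add C (scale C a f) (scale C b f)"
    and scale_add_right: "\<lbrakk>x \<in> ob C; y \<in> ob C; f \<in> hom C x y; g \<in> hom C x y\<rbrakk>
      \<Longrightarrow> scale C a (add C f g) = add C (scale C a f) (scale C a g)"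
    and comp_add: "\<lbrakk>x \<in> ob C; y \<in> ob C; z \<in> ob C;
        f \<in> hom C x y; f' \<in> hom C x y; g \<in> hom C y z; g' \<in> hom C y z\<rbrakk>
      \<Longrightarrow> g \<cdot> add C f f' = add C (g \<cdot> f) (g \<cdot> f') \<and> add C g g' \<cdot> f = add C (g \<cdot> f) (g' \<cdot> f)"
    and comp_scale: "\<lbrakk>x \<in> ob C; y \<in> ob C; z \<in> ob C; f \<in> hom C x y; g \<in> hom C y z\<rbrakk>
      \<Longrightarrow> g \<cdot> scale C a f = scale C a (g \<cdot> f) \<and> scale C a g \<cdot> f = scale C a (g \<cdot> f)"
    and unt_ob: "unt C \<in> ob C"
    and tensor_ob_closed: "\<lbrakk>x \<in> ob C; y \<in> ob C\<rbrakk> \<Longrightarrow> x \<odot> y \<in> ob C"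
    and tensor_ob_assoc: "\<lbrakk>x \<in> ob C; y \<in> ob C; z \<in> ob C\<rbrakk> \<Longrightarrow> (x \<odot> y) \<odot> z = x \<odot> (y \<odot> z)"
    and tensor_ob_unt: "x \<in> ob C \<Longrightarrow> unt C \<odot> x = x \<and> x \<odot> unt C = x"
    and tensor_hom: "\<lbrakk>w \<in> ob C; x \<in> ob C; y \<in> ob C; z \<in> ob C; f \<in> hom C w x; g \<in> hom C y z\<rbrakk>
      \<Longrightarrow> f \<otimes> g \<in> hom C (w \<odot> y) (x \<odot> z)"
    and tensor_assoc: "\<lbrakk>u \<in> ob C; v \<in> ob C; w \<in> ob C; x \<in> ob C; y \<in> ob C; z \<in> ob C;
        f \<in> hom C u v; g \<in> hom C w x; h \<in> hom C y z\<rbrakk>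
      \<Longrightarrow> (f \<otimes> g) \<otimes> h = f \<otimes> (g \<otimes> h)"
    and tensor_unt: "\<lbrakk>x \<in> ob C; y \<in> ob C; f \<in> hom C x y\<rbrakk>
      \<Longrightarrow> ident C (unt C) \<otimes> f = f \<and> f \<otimes> ident C (unt C) = f"
    and tensor_ident: "\<lbrakk>x \<in> ob C; y \<in> ob C\<rbrakk> \<Longrightarrow> ident C x \<otimes> ident C y = ident C (x \<odot> y)"
    and interchange: "\<lbrakk>x \<in> ob C; y \<in> ob C; z \<in> ob C; x' \<in> ob C; y' \<in> ob C; z' \<in> ob C;
        f \<in> hom C x y; g \<in> hom C y z; f' \<in> hom C x' y'; g' \<in> hom C y' z'\<rbrakk>
      \<Longrightarrow> (g \<cdot> f) \<otimes> (g' \<cdot> f') = (g \<otimes> g') \<cdot> (f \<otimes> f')"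
    and tensor_add: "\<lbrakk>w \<in> ob C; x \<in> ob C; y \<in> ob C; z \<in> ob C;
        f \<in> hom C w x; f' \<in> hom C w x; g \<in> hom C y z; g' \<in> hom C y z\<rbrakk>
      \<Longrightarrow> add C f f' \<otimes> g = add C (f \<otimes> g) (f' \<otimes> g) \<and> f \<otimes> add C g g' = add C (f \<otimes> g) (f \<otimes> g')"
    and tensor_scale: "\<lbrakk>w \<in> ob C; x \<in> ob C; y \<in> ob C; z \<in> ob C; f \<in> hom C w x; g \<in> hom C y z\<rbrakk>
      \<Longrightarrow> scale C a f \<otimes> g = scale C a (f \<otimes> g) \<and> f \<otimes> scale C a g = scale C a (f \<otimes> g)"
    and star_hom: "\<lbrakk>x \<in> ob C; y \<in> ob C; f \<in> hom C x y\<rbrakk> \<Longrightarrow> star C f \<in> hom C y x"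
    and star_star: "\<lbrakk>x \<in> ob C; y \<in> ob C; f \<in> hom C x y\<rbrakk> \<Longrightarrow> star C (star C f) = f"
    and star_ident: "x \<in> ob C \<Longrightarrow> star C (ident C x) = ident C x"
    and star_comp: "\<lbrakk>x \<in> ob C; y \<in> ob C; z \<in> ob C; f \<in> hom C x y; g \<in> hom C y z\<rbrakk>
      \<Longrightarrow> star C (g \<cdot> f) = star C f \<cdot> star C g"
    and star_add: "\<lbrakk>x \<in> ob C; y \<in> ob C; f \<in> hom C x y; g \<in> hom C x y\<rbrakk>
      \<Longrightarrow> star C (add C f g) = add C (star C f) (star C g)"
    and star_scale: "\<lbrakk>x \<in> ob C; y \<in> ob C; f \<in> hom C x y\<rbrakk>
      \<Longrightarrow> star C (scale C a f) = scale C (cnj a) (star C f)"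
    and star_tensor: "\<lbrakk>w \<in> ob C; x \<in> ob C; y \<in> ob C; z \<in> ob C; f \<in> hom C w x; g \<in> hom C y z\<rbrakk>
      \<Longrightarrow> star C (f \<otimes> g) = star C f \<otimes> star C g"

text \<open>
  The axiom \<open>pivotal\<close> says that the two ways of rotating a morphism \<open>f\<close> by half a turn
  agree, so that planar isotopic diagrams have the same value.
\<close>

locale pivotal_star_category = strict_monoidal_star_category +
  assumes dual_ob: "x \<in> ob C \<Longrightarrow> dual C x \<in> ob C"
    and dual_dual: "x \<in> ob C \<Longrightarrow> dual C (dual C x) = x"
    and dual_unt: "dual C (unt C) = unt C"
    and dual_tensor: "\<lbrakk>x \<in> ob C; y \<in> ob C\<rbrakk> \<Longrightarrow> dual C (x \<odot> y) = dual C y \<odot> dual C x"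
    and ev_hom: "x \<in> ob C \<Longrightarrow> ev C x \<in> hom C (dual C x \<odot> x) (unt C)"
    and ev_unt: "ev C (unt C) = ident C (unt C)"
    and ev_tensor: "\<lbrakk>x \<in> ob C; y \<in> ob C\<rbrakk>
      \<Longrightarrow> ev C (x \<odot> y) = ev C y \<cdot> (ident C (dual C y) \<otimes> ev C x \<otimes> ident C y)"
    and zigzag: "x \<in> ob C \<Longrightarrow>
        (ident C x \<otimes> ev C x) \<cdot> (coev C x \<otimes> ident C x) = ident C x \<and>
        (ev C x \<otimes> ident C (dual C x)) \<cdot> (ident C (dual C x) \<otimes> coev C x) = ident C (dual C x)"
    and pivotal: "\<lbrakk>x \<in> ob C; y \<in> ob C; f \<in> hom C x y\<rbrakk> \<Longrightarrow>
        (ev C y \<otimes> ident C (dual C x)) \<cdot> (ident C (dual C y) \<otimes> f \<otimes> ident C (dual C x))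
          \<cdot> (ident C (dual C y) \<otimes> coev C x) =
        (ident C (dual C x) \<otimes> ev C (dual C y)) \<cdot> (ident C (dual C x) \<otimes> f \<otimes> ident C (dual C y))
          \<cdot> (coev C (dual C x) \<otimes> ident C (dual C y))"

fun lincomb :: "('o, 'm, 'z) pivotal_data_scheme \<Rightarrow> 'o \<Rightarrow> 'o \<Rightarrow> (complex \<times> 'm) list \<Rightarrow> 'm" where
  "lincomb C x y [] = zero C x y"
| "lincomb C x y ((a, f) # afs) = add C (scale C a f) (lincomb C x y afs)"

text \<open>
  Unitarity: the unit is simple, morphism spaces are finite-dimensional, and the sesquilinear
  form given by the trace of \<open>star f \<cdot> f\<close> is positive definite.  Neither direct sums nor
  splittings of idempotents are required, so that a category and its completion are treated alike.
\<close>

locale unitary_pivotal_category = pivotal_star_category +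
  assumes ident_unt_nonzero: "ident C (unt C) \<noteq> zero C (unt C) (unt C)"
    and unt_simple: "f \<in> hom C (unt C) (unt C) \<Longrightarrow> \<exists>a. f = scale C a (ident C (unt C))"
    and hom_finite_dim: "\<lbrakk>x \<in> ob C; y \<in> ob C\<rbrakk> \<Longrightarrow>
        \<exists>fs. set fs \<subseteq> hom C x y \<and>
          (\<forall>f \<in> hom C x y. \<exists>as. length as = length fs \<and> f = lincomb C x y (zip as fs))"
    and trace_positive: "\<lbrakk>x \<in> ob C; y \<in> ob C; f \<in> hom C x y; f \<noteq> zero C x y\<rbrakk> \<Longrightarrow>
        \<exists>r>0. ev C x \<cdot> (ident C (dual C x) \<otimes> (star C f \<cdot> f)) \<cdot> coev C (dual C x)
                = scale C (complex_of_real r) (ident C (unt C))"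

definition iso_objects :: "('o, 'm, 'z) pivotal_data_scheme \<Rightarrow> 'o \<Rightarrow> 'o \<Rightarrow> bool" where
  "iso_objects C x y \<longleftrightarrow>
    (\<exists>f \<in> hom C x y. \<exists>g \<in> hom C y x. comp C g f = ident C x \<and> comp C f g = ident C y)"

definition unitary_iso :: "('o, 'm, 'z) pivotal_data_scheme \<Rightarrow> 'o \<Rightarrow> 'o \<Rightarrow> 'm \<Rightarrow> bool" where
  "unitary_iso C x y u \<longleftrightarrow> u \<in> hom C x y \<and>
    comp C (star C u) u = ident C x \<and> comp C u (star C u) = ident C y"


section \<open>Unitary quotients\<close>

text \<open>
  A simple object of the idempotent completion of \<open>D\<close>, as a pair \<open>(y, p)\<close>: an object with a
  nonzero idempotent endomorphism such that \<open>p \<cdot> End y \<cdot> p\<close> consists of the multiples of \<open>p\<close>.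
\<close>

definition simple_in_completion :: "('o, 'm, 'z) pivotal_data_scheme \<Rightarrow> 'o \<Rightarrow> 'm \<Rightarrow> bool" where
  "simple_in_completion D y p \<longleftrightarrow>
    y \<in> ob D \<and> p \<in> hom D y y \<and> comp D p p = p \<and> p \<noteq> zero D y y \<and>
    (\<forall>f \<in> hom D y y. \<exists>a. comp D p (comp D f p) = scale D a p)"

locale unitary_quotient =
  fixes C :: "('a, 'b) pivotal_data"
    and D :: "('o, 'm) pivotal_data"
    and F0 :: "'a \<Rightarrow> 'o" and F1 :: "'b \<Rightarrow> 'm"
  assumes target: "unitary_pivotal_category D"
    and F0_ob: "x \<in> ob C \<Longrightarrow> F0 x \<in> ob D"
    and F1_hom: "\<lbrakk>x \<in> ob C; y \<in> ob C; f \<in> hom C x y\<rbrakk> \<Longrightarrow> F1 f \<in> hom D (F0 x) (F0 y)"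
    and F1_ident: "x \<in> ob C \<Longrightarrow> F1 (ident C x) = ident D (F0 x)"
    and F1_comp: "\<lbrakk>x \<in> ob C; y \<in> ob C; z \<in> ob C; f \<in> hom C x y; g \<in> hom C y z\<rbrakk>
      \<Longrightarrow> F1 (comp C g f) = comp D (F1 g) (F1 f)"
    and F1_add: "\<lbrakk>x \<in> ob C; y \<in> ob C; f \<in> hom C x y; g \<in> hom C x y\<rbrakk>
      \<Longrightarrow> F1 (add C f g) = add D (F1 f) (F1 g)"
    and F1_scale: "\<lbrakk>x \<in> ob C; y \<in> ob C; f \<in> hom C x y\<rbrakk> \<Longrightarrow> F1 (scale C a f) = scale D a (F1 f)"
    and F0_unt: "F0 (unt C) = unt D"
    and F0_tensor: "\<lbrakk>x \<in> ob C; y \<in> ob C\<rbrakk> \<Longrightarrow> F0 (tensor_ob C x y) = tensor_ob D (F0 x) (F0 y)"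
    and F1_tensor: "\<lbrakk>w \<in> ob C; x \<in> ob C; y \<in> ob C; z \<in> ob C; f \<in> hom C w x; g \<in> hom C y z\<rbrakk>
      \<Longrightarrow> F1 (tensor C f g) = tensor D (F1 f) (F1 g)"
    and F0_dual: "x \<in> ob C \<Longrightarrow> F0 (dual C x) = dual D (F0 x)"
    and F1_ev: "x \<in> ob C \<Longrightarrow> F1 (ev C x) = ev D (F0 x)"
    and F1_star: "\<lbrakk>x \<in> ob C; y \<in> ob C; f \<in> hom C x y\<rbrakk> \<Longrightarrow> F1 (star C f) = star D (F1 f)"
    and faithful: "\<lbrakk>x \<in> ob C; y \<in> ob C\<rbrakk> \<Longrightarrow> inj_on F1 (hom C x y)"
    and dominant: "\<And>s p. simple_in_completion D s p \<Longrightarrow>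
      \<exists>x \<in> ob C. \<exists>i \<in> hom D s (F0 x). \<exists>r \<in> hom D (F0 x) s. comp D r i = p"

text \<open>
  The morphisms between images of objects of \<open>C\<close> that are generated over \<open>C\<close> by one further
  morphism \<open>u\<close> from the image of \<open>a\<close> to the image of \<open>b\<close>.
\<close>

inductive generated_over ::
    "('a, 'b) pivotal_data \<Rightarrow> ('o, 'm) pivotal_data \<Rightarrow> ('b \<Rightarrow> 'm) \<Rightarrow> 'a \<Rightarrow> 'a \<Rightarrow> 'm
      \<Rightarrow> 'a \<Rightarrow> 'a \<Rightarrow> 'm \<Rightarrow> bool"
  for C D F1 a b u where
  image: "\<lbrakk>x \<in> ob C; y \<in> ob C; f \<in> hom C x y\<rbrakk> \<Longrightarrow> generated_over C D F1 a b u x y (F1 f)"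
| new: "generated_over C D F1 a b u a b u"
| comp: "\<lbrakk>generated_over C D F1 a b u x y f; generated_over C D F1 a b u y z g\<rbrakk>
    \<Longrightarrow> generated_over C D F1 a b u x z (comp D g f)"
| tensor: "\<lbrakk>generated_over C D F1 a b u w x f; generated_over C D F1 a b u y z g\<rbrakk>
    \<Longrightarrow> generated_over C D F1 a b u (tensor_ob C w y) (tensor_ob C x z) (tensor D f g)"
| add: "\<lbrakk>generated_over C D F1 a b u x y f; generated_over C D F1 a b u x y g\<rbrakk>
    \<Longrightarrow> generated_over C D F1 a b u x y (add D f g)"
| scale: "generated_over C D F1 a b u x y f \<Longrightarrow> generated_over C D F1 a b u x y (scale D c f)"
| star: "generated_over C D F1 a b u x y f \<Longrightarrow> generated_over C D F1 a b u y x (star D f)"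


section \<open>Categories of diagrams modulo local relations\<close>

text \<open>
  Formal diagrams with strands labelled by letters \<open>'a\<close> and vertices labelled by generators
  \<open>'g\<close>, together with their formal linear combinations.
\<close>

datatype ('a, 'g) diagram =
    DId "'a list"
  | DGen 'g
  | DComp "('a, 'g) diagram" "('a, 'g) diagram"
  | DTensor "('a, 'g) diagram" "('a, 'g) diagram"
  | DZero "'a list" "'a list"
  | DAdd "('a, 'g) diagram" "('a, 'g) diagram"
  | DScale complex "('a, 'g) diagram"

text \<open>
  \<open>lev\<close> gives the caps for single letters, cups being obtained by \<open>gstar\<close>; zigzag relations
  are not built in and have to be imposed by \<open>rels\<close>.
\<close>

record ('a, 'g) presentation =
  letters :: "'a set"
  gens :: "'g set"
  gsrc :: "'g \<Rightarrow> 'a list"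
  gtgt :: "'g \<Rightarrow> 'a list"
  gstar :: "'g \<Rightarrow> 'g"
  ldual :: "'a \<Rightarrow> 'a"
  lev :: "'a \<Rightarrow> ('a, 'g) diagram"
  rels :: "(('a, 'g) diagram \<times> ('a, 'g) diagram) set"

primrec dsrc :: "('a, 'g) presentation \<Rightarrow> ('a, 'g) diagram \<Rightarrow> 'a list" where
  "dsrc P (DId xs) = xs"
| "dsrc P (DGen g) = gsrc P g"
| "dsrc P (DComp s t) = dsrc P t"
| "dsrc P (DTensor s t) = dsrc P s @ dsrc P t"
| "dsrc P (DZero xs ys) = xs"
| "dsrc P (DAdd s t) = dsrc P s"
| "dsrc P (DScale a t) = dsrc P t"

primrec dtgt :: "('a, 'g) presentation \<Rightarrow> ('a, 'g) diagram \<Rightarrow> 'a list" where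
  "dtgt P (DId xs) = xs"
| "dtgt P (DGen g) = gtgt P g"
| "dtgt P (DComp s t) = dtgt P s"
| "dtgt P (DTensor s t) = dtgt P s @ dtgt P t"
| "dtgt P (DZero xs ys) = ys"
| "dtgt P (DAdd s t) = dtgt P s"
| "dtgt P (DScale a t) = dtgt P t"

primrec dwf :: "('a, 'g) presentation \<Rightarrow> ('a, 'g) diagram \<Rightarrow> bool" where
  "dwf P (DId xs) \<longleftrightarrow> set xs \<subseteq> letters P"
| "dwf P (DGen g) \<longleftrightarrow> g \<in> gens P"
| "dwf P (DComp s t) \<longleftrightarrow> dwf P s \<and> dwf P t \<and> dtgt P t = dsrc P s"
| "dwf P (DTensor s t) \<longleftrightarrow> dwf P s \<and> dwf P t"
| "dwf P (DZero xs ys) \<longleftrightarrow> set xs \<subseteq> letters P \<and> set ys \<subseteq> letters P"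
| "dwf P (DAdd s t) \<longleftrightarrow> dwf P s \<and> dwf P t \<and> dsrc P s = dsrc P t \<and> dtgt P s = dtgt P t"
| "dwf P (DScale a t) \<longleftrightarrow> dwf P t"

primrec dstar :: "('a, 'g) presentation \<Rightarrow> ('a, 'g) diagram \<Rightarrow> ('a, 'g) diagram" where
  "dstar P (DId xs) = DId xs"
| "dstar P (DGen g) = DGen (gstar P g)"
| "dstar P (DComp s t) = DComp (dstar P t) (dstar P s)"
| "dstar P (DTensor s t) = DTensor (dstar P s) (dstar P t)"
| "dstar P (DZero xs ys) = DZero ys xs"
| "dstar P (DAdd s t) = DAdd (dstar P s) (dstar P t)"
| "dstar P (DScale a t) = DScale (cnj a) (dstar P t)"

definition dpar :: "('a, 'g) presentation \<Rightarrow> ('a, 'g) diagram \<Rightarrow> ('a, 'g) diagram \<Rightarrow> bool" where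
  "dpar P s t \<longleftrightarrow> dwf P s \<and> dwf P t \<and> dsrc P s = dsrc P t \<and> dtgt P s = dtgt P t"

text \<open>
  The congruence generated by the relations of \<open>P\<close> and the laws of strict monoidal linear
  *-categories, on well-formed diagrams.
\<close>

inductive deq :: "('a, 'g) presentation \<Rightarrow> ('a, 'g) diagram \<Rightarrow> ('a, 'g) diagram \<Rightarrow> bool"
  for P where
  rel: "\<lbrakk>(s, t) \<in> rels P; dpar P s t\<rbrakk> \<Longrightarrow> deq P s t"
| refl: "dwf P t \<Longrightarrow> deq P t t"
| sym: "deq P s t \<Longrightarrow> deq P t s"
| trans: "\<lbrakk>deq P r s; deq P s t\<rbrakk> \<Longrightarrow> deq P r t"
| cong_comp: "\<lbrakk>deq P s s'; deq P t t'; dtgt P t = dsrc P s\<rbrakk> \<Longrightarrow> deq P (DComp s t) (DComp s' t')"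
| cong_tensor: "\<lbrakk>deq P s s'; deq P t t'\<rbrakk> \<Longrightarrow> deq P (DTensor s t) (DTensor s' t')"
| cong_add: "\<lbrakk>deq P s s'; deq P t t'; dpar P s t\<rbrakk> \<Longrightarrow> deq P (DAdd s t) (DAdd s' t')"
| cong_scale: "deq P t t' \<Longrightarrow> deq P (DScale a t) (DScale a t')"
| cong_star: "deq P t t' \<Longrightarrow> deq P (dstar P t) (dstar P t')"
| comp_id_right: "dwf P t \<Longrightarrow> deq P (DComp t (DId (dsrc P t))) t"
| comp_id_left: "dwf P t \<Longrightarrow> deq P (DComp (DId (dtgt P t)) t) t"
| comp_assoc: "dwf P (DComp r (DComp s t))
    \<Longrightarrow> deq P (DComp (DComp r s) t) (DComp r (DComp s t))"
| tensor_unit_left: "dwf P t \<Longrightarrow> deq P (DTensor (DId []) t) t"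
| tensor_unit_right: "dwf P t \<Longrightarrow> deq P (DTensor t (DId [])) t"
| tensor_assoc: "\<lbrakk>dwf P r; dwf P s; dwf P t\<rbrakk>
    \<Longrightarrow> deq P (DTensor (DTensor r s) t) (DTensor r (DTensor s t))"
| tensor_id: "\<lbrakk>set xs \<subseteq> letters P; set ys \<subseteq> letters P\<rbrakk>
    \<Longrightarrow> deq P (DTensor (DId xs) (DId ys)) (DId (xs @ ys))"
| interchange: "\<lbrakk>dwf P (DComp s t); dwf P (DComp s' t')\<rbrakk>
    \<Longrightarrow> deq P (DTensor (DComp s t) (DComp s' t')) (DComp (DTensor s s') (DTensor t t'))"
| add_commute: "dpar P s t \<Longrightarrow> deq P (DAdd s t) (DAdd t s)"
| add_assoc: "\<lbrakk>dpar P r s; dpar P s t\<rbrakk> \<Longrightarrow> deq P (DAdd (DAdd r s) t) (DAdd r (DAdd s t))"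
| scale_zero: "dwf P t \<Longrightarrow> deq P (DScale 0 t) (DZero (dsrc P t) (dtgt P t))"
| scale_one: "dwf P t \<Longrightarrow> deq P (DScale 1 t) t"
| scale_scale: "dwf P t \<Longrightarrow> deq P (DScale a (DScale b t)) (DScale (a * b) t)"
| scale_add_left: "dwf P t \<Longrightarrow> deq P (DScale (a + b) t) (DAdd (DScale a t) (DScale b t))"
| scale_add_right: "dpar P s t \<Longrightarrow> deq P (DScale a (DAdd s t)) (DAdd (DScale a s) (DScale a t))"
| comp_add_right: "\<lbrakk>dpar P t t'; dwf P (DComp s t)\<rbrakk>
    \<Longrightarrow> deq P (DComp s (DAdd t t')) (DAdd (DComp s t) (DComp s t'))"
| comp_add_left: "\<lbrakk>dpar P s s'; dwf P (DComp s t)\<rbrakk>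
    \<Longrightarrow> deq P (DComp (DAdd s s') t) (DAdd (DComp s t) (DComp s' t))"
| comp_scale_right: "dwf P (DComp s t) \<Longrightarrow> deq P (DComp s (DScale a t)) (DScale a (DComp s t))"
| comp_scale_left: "dwf P (DComp s t) \<Longrightarrow> deq P (DComp (DScale a s) t) (DScale a (DComp s t))"
| tensor_add_right: "\<lbrakk>dpar P t t'; dwf P s\<rbrakk>
    \<Longrightarrow> deq P (DTensor s (DAdd t t')) (DAdd (DTensor s t) (DTensor s t'))"
| tensor_add_left: "\<lbrakk>dpar P s s'; dwf P t\<rbrakk>
    \<Longrightarrow> deq P (DTensor (DAdd s s') t) (DAdd (DTensor s t) (DTensor s' t))"
| tensor_scale_right: "\<lbrakk>dwf P s; dwf P t\<rbrakk>
    \<Longrightarrow> deq P (DTensor s (DScale a t)) (DScale a (DTensor s t))"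
| tensor_scale_left: "\<lbrakk>dwf P s; dwf P t\<rbrakk>
    \<Longrightarrow> deq P (DTensor (DScale a s) t) (DScale a (DTensor s t))"

definition dclass :: "('a, 'g) presentation \<Rightarrow> ('a, 'g) diagram \<Rightarrow> ('a, 'g) diagram set" where
  "dclass P t = {s. deq P t s}"

definition word_dual :: "('a, 'g) presentation \<Rightarrow> 'a list \<Rightarrow> 'a list" where
  "word_dual P xs = rev (map (ldual P) xs)"



primrec word_ev :: "('a, 'g) presentation \<Rightarrow> 'a list \<Rightarrow> ('a, 'g) diagram" where
  "word_ev P [] = DId []"
| "word_ev P (x # xs) =
    DComp (word_ev P xs) (DTensor (DId (word_dual P xs)) (DTensor (lev P x) (DId xs)))"

text \<open>Objects are words; morphisms are diagrams modulo \<open>deq\<close>, as equivalence classes.\<close>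

definition presented ::
    "('a, 'g) presentation \<Rightarrow> ('a list, ('a, 'g) diagram set) pivotal_data" where
  "presented P = \<lparr>
    ob = lists (letters P),
    hom = (\<lambda>xs ys. {dclass P t | t. dwf P t \<and> dsrc P t = xs \<and> dtgt P t = ys}),
    ident = (\<lambda>xs. dclass P (DId xs)),
    comp = (\<lambda>X Y. \<Union>s\<in>X. \<Union>t\<in>Y. dclass P (DComp s t)),
    unt = [],
    tensor_ob = (@),
    tensor = (\<lambda>X Y. \<Union>s\<in>X. \<Union>t\<in>Y. dclass P (DTensor s t)),
    add = (\<lambda>X Y. \<Union>s\<in>X. \<Union>t\<in>Y. dclass P (DAdd s t)),
    scale = (\<lambda>a X. \<Union>t\<in>X. dclass P (DScale a t)),
    zero = (\<lambda>xs ys. dclass P (DZero xs ys)),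
    star = (\<lambda>X. \<Union>t\<in>X. dclass P (dstar P t)),
    dual = word_dual P,
    ev = (\<lambda>xs. dclass P (word_ev P xs)) \<rparr>"


section \<open>Temperley--Lieb categories, \<open>A2\<close> and \<open>T2\<close>\<close>

datatype tl_gen = Cup | Cap

type_synonym tl_diagram = "(unit, tl_gen) diagram"

definition strands :: "nat \<Rightarrow> unit list" where
  "strands k = replicate k ()"

definition tl_presentation ::
    "complex \<Rightarrow> (tl_diagram \<times> tl_diagram) set \<Rightarrow> (unit, tl_gen) presentation" where
  "tl_presentation \<delta> R = \<lparr>
    letters = UNIV,
    gens = UNIV,
    gsrc = (\<lambda>g. case g of Cup \<Rightarrow> strands 0 | Cap \<Rightarrow> strands 2),
    gtgt = (\<lambda>g. case g of Cup \<Rightarrow> strands 2 | Cap \<Rightarrow> strands 0),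
    gstar = (\<lambda>g. case g of Cup \<Rightarrow> Cap | Cap \<Rightarrow> Cup),
    ldual = (\<lambda>x. x),
    lev = (\<lambda>x. DGen Cap),
    rels = R \<union>
      {(DComp (DTensor (DGen Cap) (DId (strands 1))) (DTensor (DId (strands 1)) (DGen Cup)),
          DId (strands 1)),
       (DComp (DTensor (DId (strands 1)) (DGen Cap)) (DTensor (DGen Cup) (DId (strands 1))),
          DId (strands 1)),
       (DComp (DGen Cap) (DGen Cup), DScale \<delta> (DId []))} \<rparr>"

text \<open>Strands \<open>\<theta>\<close>, with closed loop 1 and the identity on two strands equal to cup after cap.\<close>

definition A2 :: "(unit list, tl_diagram set) pivotal_data" where
  "A2 = presented (tl_presentation 1 {(DId (strands 2), DComp (DGen Cup) (DGen Cap))})"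

text \<open>Quantum integers, normalised by \<open>[2] = \<delta>\<close>.\<close>

fun qint :: "complex \<Rightarrow> nat \<Rightarrow> complex" where
  "qint \<delta> 0 = 0"
| "qint \<delta> (Suc 0) = 1"
| "qint \<delta> (Suc (Suc k)) = \<delta> * qint \<delta> (Suc k) - qint \<delta> k"

text \<open>Jones--Wenzl projections, by Wenzl's recursion.\<close>

fun jones_wenzl :: "complex \<Rightarrow> nat \<Rightarrow> tl_diagram" where
  "jones_wenzl \<delta> 0 = DId []"
| "jones_wenzl \<delta> (Suc 0) = DId (strands 1)"
| "jones_wenzl \<delta> (Suc (Suc k)) =
    (let f = DTensor (jones_wenzl \<delta> (Suc k)) (DId (strands 1));
         e = DTensor (DId (strands k)) (DComp (DGen Cup) (DGen Cap))
     in DAdd f (DScale (- (qint \<delta> (Suc k) / qint \<delta> (Suc (Suc k)))) (DComp f (DComp e f))))"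

definition golden :: complex where
  "golden = complex_of_real ((1 + sqrt 5) / 2)"

text \<open>
  The Temperley--Lieb category \<open>A\<^sub>4\<close>: loop parameter the golden ratio, and the fourth
  Jones--Wenzl projection, which has trace \<open>[5] = 0\<close>, set to zero.
\<close>

definition TLA4_presentation :: "(unit, tl_gen) presentation" where
  "TLA4_presentation = tl_presentation golden {(jones_wenzl golden 4, DZero (strands 4) (strands 4))}"

text \<open>The identity of the \<open>k\<close>-th tensor power of \<open>\<rho>\<close>, where \<open>\<rho>\<close> is the second Jones--Wenzl projection.\<close>

primrec rho_proj :: "nat \<Rightarrow> tl_diagram" where
  "rho_proj 0 = DId []"
| "rho_proj (Suc k) = DTensor (jones_wenzl golden 2) (rho_proj k)"

text \<open>
  The even half of \<open>A\<^sub>4\<close>, with objects the tensor powers of \<open>\<rho>\<close>: the number \<open>k\<close> stands for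
  the image of \<open>rho_proj k\<close> on \<open>2 * k\<close> strands, and morphisms are the Temperley--Lieb morphisms
  that absorb these projections.  Its idempotent completion contains all even objects.
\<close>

definition T2 :: "(nat, tl_diagram set) pivotal_data" where
  "T2 = (let TL = presented TLA4_presentation; p = (\<lambda>k. dclass TLA4_presentation (rho_proj k)) in \<lparr>
    ob = UNIV,
    hom = (\<lambda>a b. {f \<in> hom TL (strands (2 * a)) (strands (2 * b)).
             comp TL (p b) (comp TL f (p a)) = f}),
    ident = p,
    comp = comp TL,
    unt = 0,
    tensor_ob = (+),
    tensor = tensor TL,
    add = add TL,
    scale = scale TL,
    zero = (\<lambda>a b. zero TL (strands (2 * a)) (strands (2 * b))),
    star = star TL,
    dual = (\<lambda>a. a),
    ev = (\<lambda>a. comp TL (ev TL (strands (2 * a))) (tensor TL (p a) (p a))) \<rparr>)"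


section \<open>Free products\<close>

text \<open>
  Letters are objects of the factors.  A vertex coming from a factor \<open>C\<close> is a morphism of \<open>C\<close>
  between the tensor products of two words in \<open>C\<close>, drawn with these words as its boundary;
  the words are part of the generator.
\<close>

type_synonym ('o, 'm) vertex = "'o list \<times> 'o list \<times> 'm"

definition tensor_word :: "('o, 'm) pivotal_data \<Rightarrow> 'o list \<Rightarrow> 'o" where
  "tensor_word C xs = foldr (tensor_ob C) xs (unt C)"

definition vertices :: "('o, 'm) pivotal_data \<Rightarrow> ('o, 'm) vertex set" where
  "vertices C = {(xs, ys, f). xs \<in> lists (ob C) \<and> ys \<in> lists (ob C) \<and>
                    f \<in> hom C (tensor_word C xs) (tensor_word C ys)}"

definition vertex_star :: "('o, 'm) pivotal_data \<Rightarrow> ('o, 'm) vertex \<Rightarrow> ('o, 'm) vertex" where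
  "vertex_star C = (\<lambda>(xs, ys, f). (ys, xs, star C f))"

text \<open>Local relations of a factor: subdiagrams from \<open>C\<close> may be evaluated in \<open>C\<close>.\<close>

definition local_rels ::
    "('o, 'm) pivotal_data \<Rightarrow> ('o \<Rightarrow> 'a) \<Rightarrow> (('o, 'm) vertex \<Rightarrow> 'g)
      \<Rightarrow> (('a, 'g) diagram \<times> ('a, 'g) diagram) set" where
  "local_rels C emb vtx =
     {(DGen (vtx (xs, xs, ident C (tensor_word C xs))), DId (map emb xs)) | xs. xs \<in> lists (ob C)}
   \<union> {(DComp (DGen (vtx (ys, zs, g))) (DGen (vtx (xs, ys, f))), DGen (vtx (xs, zs, comp C g f)))
       | xs ys zs f g. (xs, ys, f) \<in> vertices C \<and> (ys, zs, g) \<in> vertices C}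
   \<union> {(DTensor (DGen (vtx (xs, ys, f))) (DGen (vtx (xs', ys', f'))),
       DGen (vtx (xs @ xs', ys @ ys', tensor C f f')))
       | xs ys f xs' ys' f'. (xs, ys, f) \<in> vertices C \<and> (xs', ys', f') \<in> vertices C}
   \<union> {(DAdd (DGen (vtx (xs, ys, f))) (DGen (vtx (xs, ys, g))), DGen (vtx (xs, ys, add C f g)))
       | xs ys f g. (xs, ys, f) \<in> vertices C \<and> (xs, ys, g) \<in> vertices C}
   \<union> {(DScale a (DGen (vtx (xs, ys, f))), DGen (vtx (xs, ys, scale C a f)))
       | a xs ys f. (xs, ys, f) \<in> vertices C}"

definition free_product_presentation ::
    "('a, 'm) pivotal_data \<Rightarrow> ('b, 'n) pivotal_data
      \<Rightarrow> ('a + 'b, ('a, 'm) vertex + ('b, 'n) vertex) presentation" where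
  "free_product_presentation A B = \<lparr>
    letters = Inl ` ob A \<union> Inr ` ob B,
    gens = Inl ` vertices A \<union> Inr ` vertices B,
    gsrc = (\<lambda>v. case v of Inl (xs, ys, f) \<Rightarrow> map Inl xs | Inr (xs, ys, f) \<Rightarrow> map Inr xs),
    gtgt = (\<lambda>v. case v of Inl (xs, ys, f) \<Rightarrow> map Inl ys | Inr (xs, ys, f) \<Rightarrow> map Inr ys),
    gstar = map_sum (vertex_star A) (vertex_star B),
    ldual = map_sum (dual A) (dual B),
    lev = (\<lambda>l. case l of Inl x \<Rightarrow> DGen (Inl ([dual A x, x], [], ev A x))
                       | Inr x \<Rightarrow> DGen (Inr ([dual B x, x], [], ev B x))),
    rels = local_rels A Inl Inl \<union> local_rels B Inr Inr \<rparr>"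

definition free_product ::
    "('a, 'm) pivotal_data \<Rightarrow> ('b, 'n) pivotal_data
      \<Rightarrow> (('a + 'b) list, ('a + 'b, ('a, 'm) vertex + ('b, 'n) vertex) diagram set) pivotal_data"
  where "free_product A B = presented (free_product_presentation A B)"


section \<open>The categories \<open>AT\<close>\<close>

type_synonym A2T2_object = "(unit list + nat) list"

text \<open>The generating objects, as one-letter words in \<open>A2 * T2\<close>.\<close>

definition \<theta> :: A2T2_object where "\<theta> = [Inl (strands 1)]"
definition \<rho> :: A2T2_object where "\<rho> = [Inr 1]"

definition word_power :: "'a list \<Rightarrow> nat \<Rightarrow> 'a list" where
  "word_power w n = concat (replicate n w)"

text \<open>
  One-click rotations of \<open>U\<close>, from \<open>r \<odot> z\<close> to \<open>z \<odot> r\<close> respectively from \<open>x \<odot> t\<close>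
  to \<open>t \<odot> x\<close>, for \<open>r\<close> and \<open>t\<close> with \<open>dual r = r\<close> and \<open>dual t = t\<close>.
\<close>

definition fourier :: "('o, 'm) pivotal_data \<Rightarrow> 'o \<Rightarrow> 'o \<Rightarrow> 'm \<Rightarrow> 'm" where
  "fourier D r z U =
    (ident D (r \<odot>\<^bsub>D\<^esub> z) \<otimes>\<^bsub>D\<^esub> ev D r) \<cdot>\<^bsub>D\<^esub> (ident D r \<otimes>\<^bsub>D\<^esub> U \<otimes>\<^bsub>D\<^esub> ident D r)
      \<cdot>\<^bsub>D\<^esub> (coev D r \<otimes>\<^bsub>D\<^esub> ident D (z \<odot>\<^bsub>D\<^esub> r))"

definition inverse_fourier :: "('o, 'm) pivotal_data \<Rightarrow> 'o \<Rightarrow> 'o \<Rightarrow> 'm \<Rightarrow> 'm" where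
  "inverse_fourier D t x U =
    (ev D t \<otimes>\<^bsub>D\<^esub> ident D (x \<odot>\<^bsub>D\<^esub> t)) \<cdot>\<^bsub>D\<^esub> (ident D t \<otimes>\<^bsub>D\<^esub> U \<otimes>\<^bsub>D\<^esub> ident D t)
      \<cdot>\<^bsub>D\<^esub> (ident D (t \<odot>\<^bsub>D\<^esub> x) \<otimes>\<^bsub>D\<^esub> coev D t)"

text \<open>\<open>D\<close>, together with a suitable quotient functor and unitary \<open>U\<close>, realises \<open>AT n \<omega>\<close>.\<close>

definition is_AT :: "nat \<Rightarrow> complex \<Rightarrow> ('o, 'm) pivotal_data \<Rightarrow> bool" where
  "is_AT n \<omega> D \<longleftrightarrow> (\<exists>F0 F1 U.
    unitary_quotient (free_product A2 T2) D F0 F1 \<and>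
    iso_objects D (F0 (word_power (\<rho> @ \<theta>) n)) (F0 (word_power (\<theta> @ \<rho>) n)) \<and>
    (\<forall>m. 0 < m \<and> m < n \<longrightarrow>
      \<not> iso_objects D (F0 (word_power (\<rho> @ \<theta>) m)) (F0 (word_power (\<theta> @ \<rho>) m))) \<and>
    unitary_iso D (F0 (word_power (\<rho> @ \<theta>) n)) (F0 (word_power (\<theta> @ \<rho>) n)) U \<and>
    (\<forall>x \<in> ob (free_product A2 T2). \<forall>y \<in> ob (free_product A2 T2). \<forall>f \<in> hom D (F0 x) (F0 y).
      generated_over (free_product A2 T2) D F1
        (word_power (\<rho> @ \<theta>) n) (word_power (\<theta> @ \<rho>) n) U x y f) \<and>
    inverse_fourier D (F0 \<theta>) (F0 (\<rho> @ word_power (\<theta> @ \<rho>) (n - 1))) U = star D U \<and>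
    star D U = scale D (inverse \<omega>) (fourier D (F0 \<rho>) (F0 (word_power (\<theta> @ \<rho>) (n - 1) @ \<theta>)) U))"

end

theory Submission
  imports Defs
begin

text \<open>
  Write \<open>R\<close>, \<open>T\<close> for \<open>\<rho>\<close>, \<open>\<theta>\<close>, let \<open>x = R (T R)\<^sup>n\<^sup>-\<^sup>1\<close>, and let \<open>V\<close> be the map from \<open>R x\<close> to \<open>x\<close> given by
  the trivalent vertex.  A strand \<open>R\<close> ending on a strand \<open>x\<close> through \<open>V\<close>, and a strand \<open>T\<close> crossing
  \<open>x\<close> by means of \<open>U\<close>, allow us to surround the vertex \<open>U\<close> by a ring labelled \<open>x\<close>.  Minimality of \<open>n\<close>
  makes \<open>x\<close> simple and the space of maps from \<open>R x\<close> to \<open>x\<close> one-dimensional.  Hence the diagram is a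
  scalar \<open>g\<close>, and it is unchanged when \<open>U\<close> is rotated inside the ring.  Rotating by a letter \<open>T\<close>
  turns \<open>U\<close> into \<open>U\<^sup>*\<close> and shows that \<open>g\<close> is real; rotating by a letter \<open>R\<close> turns \<open>U\<close> into
  \<open>\<omega> U\<^sup>*\<close> and gives \<open>g = \<omega> cnj g\<close>.  So \<open>\<omega> = 1\<close> unless \<open>g = 0\<close>.  For \<open>n \<le> 2\<close> the scalar \<open>g\<close> is the
  matrix of an isometry on a line.  For \<open>n = 3\<close> it is a diagonal entry of a unitary matrix of
  size two whose other diagonal entry is, up to rotation, a nonzero multiple of \<open>U\<close>.
\<close>

section \<open>Typed arrows between words\<close>

text \<open>The target may have more morphisms than the free product, so no Hom space can be read
  off from diagrams. Each one is computed by bending letters from one side to the other, cancelling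
  \<open>T T\<close>, splitting \<open>R R\<close> into the unit and \<open>R\<close>, and using
  positivity and the minimality of \<open>n\<close>. The first obstacle is a possible map from the
  unit to \<open>R\<close>; it is excluded by comparing traces involving the golden ratio. Both
  equations for \<open>g\<close> hold for every \<open>n\<close>; the bound on \<open>n\<close>
  enters only in showing that \<open>g\<close> is not zero. If \<open>g\<close> were zero, the
  strand \<open>T\<close> crossing \<open>x x\<close> before the two copies merge would have to
  factor through the cap joining the adjacent letters \<open>R\<close> of \<open>x x\<close>. For
  \<open>n\<close> at most 2 no nonzero map is left on that channel; for \<open>n = 3\<close>
  exactly a line is left, which is the origin of the matrix of size two. The ring is not drawn
  closed. It is cut open, and letters \<open>T\<close> that have crossed \<open>x\<close> pile up on
  its right, so \<open>g\<close> is read off from an endomorphism of \<open>x\<close> followed by a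
  power of \<open>T\<close>.\<close>

datatype ('a, 'm) arrow = Arrow (src: "'a list") (tgt: "'a list") (mor: 'm)

text \<open>The Hom sets of \<open>C\<close> need not be disjoint and \<open>obj\<close> need not be
  injective, so a morphism does not determine its boundary. Arrows record it as a pair of words, and
  typing conditions become equations between lists.\<close>

locale word_category = strict_monoidal_star_category C
  for C :: "('o, 'm, 'z) pivotal_data_scheme" (structure) +
  fixes obj :: "'a list \<Rightarrow> 'o"
  assumes obj_ob [simp, intro]: "obj w \<in> ob C"
    and obj_Nil: "obj [] = unt C"
    and obj_append: "obj (u @ v) = obj u \<odot> obj v"
begin

definition valid :: "('a, 'm) arrow \<Rightarrow> bool" where
  "valid f \<longleftrightarrow> mor f \<in> hom C (obj (src f)) (obj (tgt f))"

definition Hom :: "'a list \<Rightarrow> 'a list \<Rightarrow> ('a, 'm) arrow set" where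
  "Hom u v = {f. valid f \<and> src f = u \<and> tgt f = v}"

definition Id :: "'a list \<Rightarrow> ('a, 'm) arrow" where
  "Id w = Arrow w w (ident C (obj w))"

definition cmp :: "('a, 'm) arrow \<Rightarrow> ('a, 'm) arrow \<Rightarrow> ('a, 'm) arrow"  (infixr \<open>\<bullet>\<close> 65) where
  "g \<bullet> f = Arrow (src f) (tgt g) (mor g \<cdot> mor f)"

definition tns :: "('a, 'm) arrow \<Rightarrow> ('a, 'm) arrow \<Rightarrow> ('a, 'm) arrow"  (infixr \<open>\<boxtimes>\<close> 70) where
  "f \<boxtimes> g = Arrow (src f @ src g) (tgt f @ tgt g) (mor f \<otimes> mor g)"

definition pls :: "('a, 'm) arrow \<Rightarrow> ('a, 'm) arrow \<Rightarrow> ('a, 'm) arrow"  (infixl \<open>\<oplus>\<close> 60) where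
  "f \<oplus> g = Arrow (src f) (tgt f) (add C (mor f) (mor g))"

definition scl :: "complex \<Rightarrow> ('a, 'm) arrow \<Rightarrow> ('a, 'm) arrow"  (infixr \<open>*\<^sub>a\<close> 62) where
  "c *\<^sub>a f = Arrow (src f) (tgt f) (scale C c (mor f))"

definition Zero :: "'a list \<Rightarrow> 'a list \<Rightarrow> ('a, 'm) arrow" where
  "Zero u v = Arrow u v (zero C (obj u) (obj v))"

definition adj :: "('a, 'm) arrow \<Rightarrow> ('a, 'm) arrow"  (\<open>_\<^sup>\<star>\<close> [1000] 1000) where
  "f\<^sup>\<star> = Arrow (tgt f) (src f) (star C (mor f))"

text \<open>One layer of a diagram, containing a single box. Diagrams are kept as composites of such
  layers, so that deforming them comes down to \<open>slide\<close> and the zigzag laws.\<close>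

definition whisk :: "'a list \<Rightarrow> ('a, 'm) arrow \<Rightarrow> 'a list \<Rightarrow> ('a, 'm) arrow" where
  "whisk a f b = Id a \<boxtimes> f \<boxtimes> Id b"

lemmas arrow_defs = Id_def cmp_def tns_def pls_def scl_def Zero_def adj_def

lemma Hom_iff [simp]: "f \<in> Hom u v \<longleftrightarrow> valid f \<and> src f = u \<and> tgt f = v"
  by (simp add: Hom_def)

lemma src_simps [simp]:
  "src (Id w) = w" "src (g \<bullet> f) = src f" "src (f \<boxtimes> g) = src f @ src g" "src (f \<oplus> g) = src f"
  "src (c *\<^sub>a f) = src f" "src (Zero u v) = u" "src (f\<^sup>\<star>) = tgt f" "src (whisk a f b) = a @ src f @ b"
  by (simp_all add: arrow_defs whisk_def)

lemma tgt_simps [simp]: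
  "tgt (Id w) = w" "tgt (g \<bullet> f) = tgt g" "tgt (f \<boxtimes> g) = tgt f @ tgt g" "tgt (f \<oplus> g) = tgt f"
  "tgt (c *\<^sub>a f) = tgt f" "tgt (Zero u v) = v" "tgt (f\<^sup>\<star>) = src f" "tgt (whisk a f b) = a @ tgt f @ b"
  by (simp_all add: arrow_defs whisk_def)

lemma valid_Id [simp]: "valid (Id w)"
  by (simp add: valid_def Id_def ident_hom)

lemma valid_cmp [simp]: "\<lbrakk>valid g; valid f; tgt f = src g\<rbrakk> \<Longrightarrow> valid (g \<bullet> f)"
  by (auto simp: valid_def cmp_def intro!: comp_hom[where y = "obj (src g)"])

lemma valid_tns [simp]: "\<lbrakk>valid f; valid g\<rbrakk> \<Longrightarrow> valid (f \<boxtimes> g)"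
  by (auto simp: valid_def tns_def obj_append intro!: tensor_hom)

lemma valid_pls [simp]: "\<lbrakk>valid f; valid g; src g = src f; tgt g = tgt f\<rbrakk> \<Longrightarrow> valid (f \<oplus> g)"
  by (auto simp: valid_def pls_def intro!: add_hom)

lemma valid_scl [simp]: "valid f \<Longrightarrow> valid (c *\<^sub>a f)"
  by (auto simp: valid_def scl_def intro!: scale_hom)

lemma valid_Zero [simp]: "valid (Zero u v)"
  by (auto simp: valid_def Zero_def intro!: zero_hom)

lemma valid_adj [simp]: "valid f \<Longrightarrow> valid (f\<^sup>\<star>)"
  by (auto simp: valid_def adj_def intro!: star_hom)

lemma valid_whisk [simp]: "valid f \<Longrightarrow> valid (whisk a f b)"
  by (simp add: whisk_def)

lemma cmp_assoc:
  "\<lbrakk>valid f; valid g; valid h; tgt f = src g; tgt g = src h\<rbrakk> \<Longrightarrow> (h \<bullet> g) \<bullet> f = h \<bullet> g \<bullet> f"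
  unfolding cmp_def valid_def
  by (simp, rule comp_assoc[where w = "obj (src f)" and x = "obj (src g)" and y = "obj (src h)" and z = "obj (tgt h)"], auto)

lemma cmp_Id [simp]: "\<lbrakk>valid f; src f = w\<rbrakk> \<Longrightarrow> f \<bullet> Id w = f"
  by (cases f) (use comp_ident in \<open>auto simp: valid_def cmp_def Id_def\<close>)

lemma Id_cmp [simp]: "\<lbrakk>valid f; tgt f = w\<rbrakk> \<Longrightarrow> Id w \<bullet> f = f"
  by (cases f) (use comp_ident in \<open>auto simp: valid_def cmp_def Id_def\<close>)

lemma tns_assoc: "\<lbrakk>valid f; valid g; valid h\<rbrakk> \<Longrightarrow> (f \<boxtimes> g) \<boxtimes> h = f \<boxtimes> g \<boxtimes> h"
  unfolding tns_def valid_def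
  by (simp, rule tensor_assoc[where u = "obj (src f)" and v = "obj (tgt f)" and w = "obj (src g)"
        and x = "obj (tgt g)" and y = "obj (src h)" and z = "obj (tgt h)"], auto)

lemma Id_Nil_tns [simp]: "valid f \<Longrightarrow> Id [] \<boxtimes> f = f"
  by (cases f) (use tensor_unt in \<open>auto simp: valid_def tns_def Id_def obj_Nil\<close>)

lemma tns_Id_Nil [simp]: "valid f \<Longrightarrow> f \<boxtimes> Id [] = f"
  by (cases f) (use tensor_unt in \<open>auto simp: valid_def tns_def Id_def obj_Nil\<close>)

lemma tns_Id_Id [simp]: "Id u \<boxtimes> Id v = Id (u @ v)"
  by (simp add: tns_def Id_def obj_append tensor_ident)

lemma tns_cmp:
  assumes "valid f" "valid g" "valid f'" "valid g'" "tgt f = src g" "tgt f' = src g'"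
  shows "(g \<bullet> f) \<boxtimes> (g' \<bullet> f') = (g \<boxtimes> g') \<bullet> (f \<boxtimes> f')"
  using assms unfolding cmp_def valid_def tns_def
  by (simp, intro interchange[where x = "obj (src f)" and y = "obj (src g)" and z = "obj (tgt g)"
        and x' = "obj (src f')" and y' = "obj (src g')" and z' = "obj (tgt g')"], auto)

lemma adj_adj [simp]: "valid f \<Longrightarrow> f\<^sup>\<star>\<^sup>\<star> = f"
  by (cases f) (use star_star in \<open>auto simp: valid_def adj_def\<close>)

lemma adj_Id [simp]: "(Id w)\<^sup>\<star> = Id w"
  by (simp add: adj_def Id_def star_ident)

lemma adj_cmp [simp]: "\<lbrakk>valid f; valid g; tgt f = src g\<rbrakk> \<Longrightarrow> (g \<bullet> f)\<^sup>\<star> = f\<^sup>\<star> \<bullet> g\<^sup>\<star>"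
  unfolding adj_def cmp_def valid_def
  by (simp, rule star_comp[where x = "obj (src f)" and y = "obj (src g)" and z = "obj (tgt g)"], auto)

lemma adj_tns [simp]: "\<lbrakk>valid f; valid g\<rbrakk> \<Longrightarrow> (f \<boxtimes> g)\<^sup>\<star> = f\<^sup>\<star> \<boxtimes> g\<^sup>\<star>"
  unfolding adj_def tns_def valid_def
  by (simp, rule star_tensor[where w = "obj (src f)" and x = "obj (tgt f)" and y = "obj (src g)"
        and z = "obj (tgt g)"], auto)

lemma adj_whisk [simp]: "valid f \<Longrightarrow> (whisk a f b)\<^sup>\<star> = whisk a (f\<^sup>\<star>) b"
  by (simp add: whisk_def)

lemma adj_pls [simp]:
  "\<lbrakk>valid f; valid g; src g = src f; tgt g = tgt f\<rbrakk> \<Longrightarrow> (f \<oplus> g)\<^sup>\<star> = f\<^sup>\<star> \<oplus> g\<^sup>\<star>"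
  unfolding adj_def pls_def valid_def
  by (simp, rule star_add[where x = "obj (src f)" and y = "obj (tgt f)"], auto)

lemma adj_scl [simp]: "valid f \<Longrightarrow> (c *\<^sub>a f)\<^sup>\<star> = cnj c *\<^sub>a f\<^sup>\<star>"
  unfolding adj_def scl_def valid_def
  by (simp, rule star_scale[where x = "obj (src f)" and y = "obj (tgt f)"], auto)

lemma pls_commute: "\<lbrakk>valid f; valid g; src g = src f; tgt g = tgt f\<rbrakk> \<Longrightarrow> f \<oplus> g = g \<oplus> f"
  unfolding pls_def valid_def
  by (simp, rule add_commute[where x = "obj (src f)" and y = "obj (tgt f)"], auto)

lemma pls_assoc:
  "\<lbrakk>valid f; valid g; valid h; src g = src f; tgt g = tgt f; src h = src f; tgt h = tgt f\<rbrakk>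
    \<Longrightarrow> (f \<oplus> g) \<oplus> h = f \<oplus> (g \<oplus> h)"
  unfolding pls_def valid_def
  by (simp, rule add_assoc[where x = "obj (src f)" and y = "obj (tgt f)"], auto)

lemma Zero_pls [simp]: "\<lbrakk>valid f; src f = u; tgt f = v\<rbrakk> \<Longrightarrow> Zero u v \<oplus> f = f"
  by (cases f) (use add_zero in \<open>auto simp: valid_def pls_def Zero_def\<close>)

lemma pls_Zero [simp]: "\<lbrakk>valid f; src f = u; tgt f = v\<rbrakk> \<Longrightarrow> f \<oplus> Zero u v = f"
  by (subst pls_commute) auto

lemma scl_0: "valid f \<Longrightarrow> 0 *\<^sub>a f = Zero (src f) (tgt f)"
  by (cases f) (use scale_zero in \<open>auto simp: valid_def scl_def Zero_def\<close>)

lemma scl_1 [simp]: "valid f \<Longrightarrow> 1 *\<^sub>a f = f"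
  by (cases f) (use scale_one in \<open>auto simp: valid_def scl_def\<close>)

lemma scl_scl [simp]: "valid f \<Longrightarrow> a *\<^sub>a b *\<^sub>a f = (a * b) *\<^sub>a f"
  unfolding scl_def valid_def
  by (simp, rule scale_scale[where x = "obj (src f)" and y = "obj (tgt f)"], auto)

lemma scl_add_left: "valid f \<Longrightarrow> (a + b) *\<^sub>a f = a *\<^sub>a f \<oplus> b *\<^sub>a f"
  unfolding scl_def valid_def pls_def
  by (simp, rule scale_add_left[where x = "obj (src f)" and y = "obj (tgt f)"], auto)

lemma scl_pls:
  "\<lbrakk>valid f; valid g; src g = src f; tgt g = tgt f\<rbrakk> \<Longrightarrow> a *\<^sub>a (f \<oplus> g) = a *\<^sub>a f \<oplus> a *\<^sub>a g"
  unfolding scl_def valid_def pls_def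
  by (simp, rule scale_add_right[where x = "obj (src f)" and y = "obj (tgt f)"], auto)

lemma cmp_pls:
  "\<lbrakk>valid f; valid f'; valid g; src f' = src f; tgt f' = tgt f; tgt f = src g\<rbrakk>
    \<Longrightarrow> g \<bullet> (f \<oplus> f') = g \<bullet> f \<oplus> g \<bullet> f'"
  unfolding cmp_def valid_def pls_def
  by (simp, rule conjunct1[OF comp_add[where x = "obj (src f)" and y = "obj (src g)" and z = "obj (tgt g)"]], auto)

lemma pls_cmp:
  "\<lbrakk>valid f; valid g; valid g'; src g' = src g; tgt g' = tgt g; tgt f = src g\<rbrakk>
    \<Longrightarrow> (g \<oplus> g') \<bullet> f = g \<bullet> f \<oplus> g' \<bullet> f"
  unfolding cmp_def valid_def pls_def
  by (simp, rule conjunct2[OF comp_add[where x = "obj (src f)" and y = "obj (src g)" and z = "obj (tgt g)"]], auto)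

lemma cmp_scl [simp]: "\<lbrakk>valid f; valid g; tgt f = src g\<rbrakk> \<Longrightarrow> g \<bullet> (a *\<^sub>a f) = a *\<^sub>a (g \<bullet> f)"
  unfolding cmp_def valid_def scl_def
  by (simp, rule conjunct1[OF comp_scale[where x = "obj (src f)" and y = "obj (src g)" and z = "obj (tgt g)"]], auto)

lemma scl_cmp [simp]: "\<lbrakk>valid f; valid g; tgt f = src g\<rbrakk> \<Longrightarrow> (a *\<^sub>a g) \<bullet> f = a *\<^sub>a (g \<bullet> f)"
  unfolding cmp_def valid_def scl_def
  by (simp, rule conjunct2[OF comp_scale[where x = "obj (src f)" and y = "obj (src g)" and z = "obj (tgt g)"]], auto)

lemma tns_pls:
  "\<lbrakk>valid f; valid g; valid g'; src g' = src g; tgt g' = tgt g\<rbrakk> \<Longrightarrow> f \<boxtimes> (g \<oplus> g') = f \<boxtimes> g \<oplus> f \<boxtimes> g'"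
  unfolding tns_def valid_def pls_def
  by (simp, rule conjunct2[OF tensor_add[where w = "obj (src f)" and x = "obj (tgt f)" and y = "obj (src g)" and z = "obj (tgt g)"]], auto)

lemma pls_tns:
  "\<lbrakk>valid f; valid g; valid f'; src f' = src f; tgt f' = tgt f\<rbrakk> \<Longrightarrow> (f \<oplus> f') \<boxtimes> g = f \<boxtimes> g \<oplus> f' \<boxtimes> g"
  unfolding tns_def valid_def pls_def
  by (simp, rule conjunct1[OF tensor_add[where w = "obj (src f)" and x = "obj (tgt f)" and y = "obj (src g)" and z = "obj (tgt g)"]], auto)

lemma tns_scl [simp]: "\<lbrakk>valid f; valid g\<rbrakk> \<Longrightarrow> f \<boxtimes> (a *\<^sub>a g) = a *\<^sub>a (f \<boxtimes> g)"
  unfolding tns_def valid_def scl_def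
  by (simp, rule conjunct2[OF tensor_scale[where w = "obj (src f)" and x = "obj (tgt f)" and y = "obj (src g)" and z = "obj (tgt g)"]], auto)

lemma scl_tns [simp]: "\<lbrakk>valid f; valid g\<rbrakk> \<Longrightarrow> (a *\<^sub>a f) \<boxtimes> g = a *\<^sub>a (f \<boxtimes> g)"
  unfolding tns_def valid_def scl_def
  by (simp, rule conjunct1[OF tensor_scale[where w = "obj (src f)" and x = "obj (tgt f)" and y = "obj (src g)" and z = "obj (tgt g)"]], auto)

lemma whisk_Nil [simp]: "valid f \<Longrightarrow> whisk [] f [] = f"
  by (simp add: whisk_def)

lemma whisk_Id [simp]: "whisk a (Id u) b = Id (a @ u @ b)"
  by (simp add: whisk_def)

lemma whisk_whisk [simp]: "valid f \<Longrightarrow> whisk a (whisk a' f b') b = whisk (a @ a') f (b' @ b)"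
  by (simp add: whisk_def tns_assoc flip: tns_Id_Id)

lemma whisk_cmp: "\<lbrakk>valid f; valid g; tgt f = src g\<rbrakk> \<Longrightarrow> whisk a (g \<bullet> f) b = whisk a g b \<bullet> whisk a f b"
  using tns_cmp[of f g "Id b" "Id b"] tns_cmp[of "Id a" "Id a" "f \<boxtimes> Id b" "g \<boxtimes> Id b"]
  by (simp add: whisk_def)

lemma whisk_pls:
  "\<lbrakk>valid f; valid g; src g = src f; tgt g = tgt f\<rbrakk> \<Longrightarrow> whisk a (f \<oplus> g) b = whisk a f b \<oplus> whisk a g b"
  by (simp add: whisk_def tns_pls pls_tns)

lemma whisk_scl [simp]: "valid f \<Longrightarrow> whisk a (c *\<^sub>a f) b = c *\<^sub>a whisk a f b"
  by (simp add: whisk_def)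

lemma tns_as_whisk:
  assumes "valid f" "valid g"
  shows "f \<boxtimes> g = whisk [] f (tgt g) \<bullet> whisk (src f) g []"
    and "f \<boxtimes> g = whisk (tgt f) g [] \<bullet> whisk [] f (src g)"
  using assms tns_cmp[of "Id (src f)" f g "Id (tgt g)"] tns_cmp[of f "Id (tgt f)" "Id (src g)" g]
  by (simp_all add: whisk_def)

text \<open>The interchange law in layered form: boxes at disjoint positions can exchange their
  heights, whatever strands \<open>m\<close> run between them.\<close>

lemma slide:
  assumes "valid f" "valid g"
  shows "whisk (a @ tgt f @ m) g b \<bullet> whisk a f (m @ src g @ b)
       = whisk a f (m @ tgt g @ b) \<bullet> whisk (a @ src f @ m) g b"
proof -
  have "whisk (tgt f) (whisk m g b) [] \<bullet> whisk [] f (src (whisk m g b))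
      = whisk [] f (tgt (whisk m g b)) \<bullet> whisk (src f) (whisk m g b) []"
    using assms tns_as_whisk[of f "whisk m g b"] by (metis valid_whisk)
  then have "whisk a (whisk (tgt f) (whisk m g b) [] \<bullet> whisk [] f (src (whisk m g b))) []
      = whisk a (whisk [] f (tgt (whisk m g b)) \<bullet> whisk (src f) (whisk m g b) []) []"
    by simp
  then show ?thesis
    using assms by (simp add: whisk_cmp)
qed

lemma scl_Zero [simp]: "c *\<^sub>a Zero u v = Zero u v"
  using scl_0[of "Zero u v"] scl_scl[of "Zero u v" c 0] by simp

lemma cmp_Zero [simp]: "\<lbrakk>valid f; src f = v\<rbrakk> \<Longrightarrow> f \<bullet> Zero u v = Zero u (tgt f)"
  using cmp_scl[of "Zero u v" f 0] scl_0[of "Zero u v"] scl_0[of "f \<bullet> Zero u v"] by simp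

lemma Zero_cmp [simp]: "\<lbrakk>valid f; tgt f = u\<rbrakk> \<Longrightarrow> Zero u v \<bullet> f = Zero (src f) v"
  using scl_cmp[of f "Zero u v" 0] scl_0[of "Zero u v"] scl_0[of "Zero u v \<bullet> f"] by simp

lemma whisk_Zero [simp]: "whisk a (Zero u v) b = Zero (a @ u @ b) (a @ v @ b)"
  using whisk_scl[of "Zero u v" a 0 b] scl_0[of "Zero u v"] scl_0[of "whisk a (Zero u v) b"] by simp

lemma adj_Zero [simp]: "(Zero u v)\<^sup>\<star> = Zero v u"
  using adj_scl[of "Zero u v" 0] scl_0[of "Zero u v"] scl_0[of "(Zero u v)\<^sup>\<star>"] by simp

lemma scl_eq_Zero:
  assumes "valid f" "c *\<^sub>a f = Zero u v" "c \<noteq> 0"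
  shows "f = Zero u v"
proof -
  have "f = inverse c *\<^sub>a c *\<^sub>a f"
    using assms(1,3) by simp
  also have "\<dots> = Zero u v"
    unfolding assms(2) by simp
  finally show ?thesis .
qed

lemma scl_cancel:
  assumes "valid f" "f \<noteq> Zero (src f) (tgt f)" "a *\<^sub>a f = b *\<^sub>a f"
  shows "a = b"
proof (rule ccontr)
  assume "a \<noteq> b"
  have "(a - b) *\<^sub>a f = a *\<^sub>a f \<oplus> (- b) *\<^sub>a f"
    using assms(1) scl_add_left[of f a "- b"] by simp
  also have "\<dots> = Zero (src f) (tgt f)"
    unfolding assms(3) using assms(1) scl_add_left[of f b "- b"] by (simp add: scl_0)
  finally show False
    using scl_eq_Zero assms \<open>a \<noteq> b\<close> by (metis eq_iff_diff_eq_0)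
qed

end

section \<open>Diagrams modulo relations form a strict monoidal *-category\<close>

text \<open>These conditions keep boundaries of diagrams inside the alphabet and make
  \<open>dstar\<close> a well-typed involution already on the level of syntax.\<close>

locale star_presentation =
  fixes P :: "('a, 'g) presentation"
  assumes gen_boundary: "g \<in> gens P \<Longrightarrow> set (gsrc P g) \<subseteq> letters P \<and> set (gtgt P g) \<subseteq> letters P"
    and gen_star: "g \<in> gens P \<Longrightarrow> gstar P g \<in> gens P \<and> gsrc P (gstar P g) = gtgt P g \<and>
      gtgt P (gstar P g) = gsrc P g \<and> gstar P (gstar P g) = g"
begin

lemma dwf_boundary: "dwf P t \<Longrightarrow> set (dsrc P t) \<subseteq> letters P \<and> set (dtgt P t) \<subseteq> letters P"
  by (induction t) (use gen_boundary in auto)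

lemma dstar_boundary: "dwf P t \<Longrightarrow> dsrc P (dstar P t) = dtgt P t \<and> dtgt P (dstar P t) = dsrc P t"
  by (induction t) (use gen_star in auto)

lemma dwf_dstar: "dwf P t \<Longrightarrow> dwf P (dstar P t)"
  by (induction t) (use gen_star dstar_boundary in auto)

lemma dstar_dstar: "dwf P t \<Longrightarrow> dstar P (dstar P t) = t"
  by (induction t) (use gen_star in auto)

lemma dclass_eq: "deq P s t \<Longrightarrow> dclass P s = dclass P t"
  unfolding dclass_def by (blast intro: deq.sym deq.trans)

lemma mem_dclass: "dwf P t \<Longrightarrow> t \<in> dclass P t"
  by (simp add: dclass_def deq.refl)

text \<open>The operations of \<open>presented\<close> are unions over representatives.
  Compatibility with \<open>deq\<close> makes all members of the union equal, and reflexivity makes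
  it nonempty.\<close>

lemma UN_dclass:
  assumes "dwf P t" "\<And>s. deq P t s \<Longrightarrow> deq P (f t) (f s)"
  shows "(\<Union>s \<in> dclass P t. dclass P (f s)) = dclass P (f t)"
proof -
  have "dclass P (f s) = dclass P (f t)" if "s \<in> dclass P t" for s
    using that assms(2)[of s] dclass_eq by (auto simp: dclass_def)
  then show ?thesis
    using mem_dclass[OF assms(1)] by blast
qed

lemma UN2_dclass:
  assumes "dwf P s" "dwf P t" "\<And>s' t'. \<lbrakk>deq P s s'; deq P t t'\<rbrakk> \<Longrightarrow> deq P (f s t) (f s' t')"
  shows "(\<Union>s' \<in> dclass P s. \<Union>t' \<in> dclass P t. dclass P (f s' t')) = dclass P (f s t)"
proof -
  have "dclass P (f s' t') = dclass P (f s t)" if "s' \<in> dclass P s" "t' \<in> dclass P t" for s' t'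
    using that assms(3)[of s' t'] dclass_eq by (auto simp: dclass_def)
  then show ?thesis
    using mem_dclass[OF assms(1)] mem_dclass[OF assms(2)] by blast
qed

lemma presented_simps [simp]:
  "ob (presented P) = lists (letters P)" "unt (presented P) = []" "tensor_ob (presented P) = (@)"
  "ident (presented P) xs = dclass P (DId xs)" "zero (presented P) xs ys = dclass P (DZero xs ys)"
  "dual (presented P) = word_dual P" "ev (presented P) xs = dclass P (word_ev P xs)"
  by (simp_all add: presented_def)

lemma hom_presentedI: "\<lbrakk>dwf P t; dsrc P t = xs; dtgt P t = ys\<rbrakk> \<Longrightarrow> dclass P t \<in> hom (presented P) xs ys"
  by (auto simp: presented_def)

lemma hom_presentedE:
  assumes "f \<in> hom (presented P) xs ys"
  obtains t where "f = dclass P t" "dwf P t" "dsrc P t = xs" "dtgt P t = ys"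
  using assms by (auto simp: presented_def)

lemma comp_dclass:
  "\<lbrakk>dwf P s; dwf P t; dtgt P t = dsrc P s\<rbrakk>
    \<Longrightarrow> comp (presented P) (dclass P s) (dclass P t) = dclass P (DComp s t)"
  unfolding presented_def by (simp, rule UN2_dclass) (auto intro: deq.cong_comp)

lemma tensor_dclass:
  "\<lbrakk>dwf P s; dwf P t\<rbrakk> \<Longrightarrow> tensor (presented P) (dclass P s) (dclass P t) = dclass P (DTensor s t)"
  unfolding presented_def by (simp, rule UN2_dclass) (auto intro: deq.cong_tensor)

lemma add_dclass:
  "dpar P s t \<Longrightarrow> add (presented P) (dclass P s) (dclass P t) = dclass P (DAdd s t)"
  unfolding presented_def by (simp, rule UN2_dclass) (auto intro: deq.cong_add simp: dpar_def)

lemma scale_dclass: "dwf P t \<Longrightarrow> scale (presented P) a (dclass P t) = dclass P (DScale a t)"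
  unfolding presented_def by (simp, rule UN_dclass) (auto intro: deq.cong_scale)

lemma star_dclass: "dwf P t \<Longrightarrow> star (presented P) (dclass P t) = dclass P (dstar P t)"
  unfolding presented_def by (simp, rule UN_dclass) (auto intro: deq.cong_star)

lemmas dclass_ops = comp_dclass tensor_dclass add_dclass scale_dclass star_dclass

text \<open>Most equations are clauses of \<open>deq\<close> read on representatives, and the star
  laws hold syntactically; neutrality of the zero morphism is the one that has to be
  derived.\<close>

lemma presented_strict_monoidal: "strict_monoidal_star_category (presented P)"
proof (unfold_locales, goal_cases)
  case (1 x)
  then show ?case by (auto simp: subset_iff intro!: hom_presentedI)
next
  case (2 x y z f g)
  then show ?case by (auto elim!: hom_presentedE simp: subset_iff dclass_ops intro!: hom_presentedI)
next
  case (3 x y f)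
  then show ?case
    by (auto elim!: hom_presentedE simp: subset_iff dclass_ops
        dclass_eq[OF deq.comp_id_left] dclass_eq[OF deq.comp_id_right])
next
  case (4 w x y z f g h)
  then show ?case by (auto elim!: hom_presentedE simp: subset_iff dclass_ops dclass_eq[OF deq.comp_assoc])
next
  case (5 x y)
  then show ?case by (auto simp: subset_iff intro!: hom_presentedI)
next
  case (6 x y f g)
  then show ?case by (auto elim!: hom_presentedE simp: subset_iff dclass_ops dpar_def intro!: hom_presentedI)
next
  case (7 x y f a)
  then show ?case by (auto elim!: hom_presentedE simp: subset_iff dclass_ops intro!: hom_presentedI)
next
  case (8 x y f g)
  then show ?case
    by (auto elim!: hom_presentedE simp: subset_iff dclass_ops dpar_def dclass_eq[OF deq.add_commute])
next
  case (9 x y f g h)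
  then show ?case
    by (auto elim!: hom_presentedE simp: subset_iff dclass_ops dpar_def dclass_eq[OF deq.add_assoc])
next
  case (10 x y f)
  then show ?case
  proof (elim hom_presentedE)
    fix t
    assume t: "f = dclass P t" "dwf P t" "dsrc P t = x" "dtgt P t = y"
    have b: "set x \<subseteq> letters P" "set y \<subseteq> letters P"
      using t dwf_boundary by auto
    \<comment> \<open>\<open>deq\<close> has no clause for adding zero, so zero is written as
      \<open>0\<close> times \<open>t\<close> and the sum is collected into \<open>0 + 1\<close>
      times \<open>t\<close>.\<close>
    have "deq P (DAdd (DZero x y) t) (DAdd (DScale 0 t) (DScale 1 t))"
      using t b deq.scale_zero[of P t] deq.scale_one[of P t]
      by (auto intro!: deq.cong_add intro: deq.sym simp: dpar_def)
    moreover have "deq P (DAdd (DScale 0 t) (DScale 1 t)) t"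
      using t deq.scale_add_left[of P t 0 1] deq.scale_one[of P t] by (auto intro: deq.sym deq.trans)
    ultimately show ?thesis
      using t b by (simp add: dclass_ops dpar_def) (metis deq.trans dclass_eq)
  qed
next
  case (11 x y f)
  then show ?case
    by (auto elim!: hom_presentedE simp: subset_iff dclass_ops dclass_eq[OF deq.scale_zero])
next
  case (12 x y f)
  then show ?case
    by (auto elim!: hom_presentedE simp: subset_iff dclass_ops dclass_eq[OF deq.scale_one])
next
  case (13 x y f a b)
  then show ?case
    by (auto elim!: hom_presentedE simp: subset_iff dclass_ops dclass_eq[OF deq.scale_scale])
next
  case (14 x y f a b)
  then show ?case
    by (auto elim!: hom_presentedE simp: subset_iff dclass_ops dpar_def dclass_eq[OF deq.scale_add_left])
next
  case (15 x y f g a)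
  then show ?case
    by (auto elim!: hom_presentedE simp: subset_iff dclass_ops dpar_def dclass_eq[OF deq.scale_add_right])
next
  case (16 x y z f f' g g')
  then show ?case
    by (auto elim!: hom_presentedE simp: subset_iff dclass_ops dpar_def dclass_eq[OF deq.comp_add_left] dclass_eq[OF deq.comp_add_right])
next
  case (17 x y z f g a)
  then show ?case
    by (auto elim!: hom_presentedE simp: subset_iff dclass_ops dclass_eq[OF deq.comp_scale_left] dclass_eq[OF deq.comp_scale_right])
next
  case 18
  then show ?case by simp
next
  case (19 x y)
  then show ?case by simp
next
  case (20 x y z)
  then show ?case by simp
next
  case (21 x)
  then show ?case by simp
next
  case (22 w x y z f g)
  then show ?case by (auto elim!: hom_presentedE simp: subset_iff dclass_ops intro!: hom_presentedI)
next
  case (23 u v w x y z f g h)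
  then show ?case by (auto elim!: hom_presentedE simp: subset_iff dclass_ops dclass_eq[OF deq.tensor_assoc])
next
  case (24 x y f)
  then show ?case
    by (auto elim!: hom_presentedE simp: subset_iff dclass_ops dclass_eq[OF deq.tensor_unit_left] dclass_eq[OF deq.tensor_unit_right])
next
  case (25 x y)
  then show ?case by (auto simp: subset_iff dclass_ops dclass_eq[OF deq.tensor_id])
next
  case (26 x y z x' y' z' f g f' g')
  then show ?case
    by (auto elim!: hom_presentedE simp: subset_iff dclass_ops dclass_eq[OF deq.interchange])
next
  case (27 w x y z f f' g g')
  then show ?case
    by (auto elim!: hom_presentedE simp: subset_iff dclass_ops dpar_def dclass_eq[OF deq.tensor_add_left] dclass_eq[OF deq.tensor_add_right])
next
  case (28 w x y z f g a)
  then show ?case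
    by (auto elim!: hom_presentedE simp: dclass_ops dclass_eq[OF deq.tensor_scale_left] dclass_eq[OF deq.tensor_scale_right])
next
  case (29 x y f)
  then show ?case
    by (auto elim!: hom_presentedE simp: subset_iff dclass_ops dwf_dstar dstar_boundary intro!: hom_presentedI)
next
  case (30 x y f)
  then show ?case
    by (auto elim!: hom_presentedE simp: subset_iff dclass_ops dwf_dstar dstar_dstar)
next
  case (31 x)
  then show ?case by (auto simp: subset_iff dclass_ops)
next
  case (32 x y z f g)
  then show ?case by (auto elim!: hom_presentedE simp: subset_iff dclass_ops dwf_dstar dstar_boundary)
next
  case (33 x y f g)
  then show ?case by (auto elim!: hom_presentedE simp: subset_iff dclass_ops dpar_def dwf_dstar dstar_boundary)
next
  case (34 x y f a)
  then show ?case by (auto elim!: hom_presentedE simp: subset_iff dclass_ops dwf_dstar dstar_boundary)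
next
  case (35 w x y z f g)
  then show ?case by (auto elim!: hom_presentedE simp: subset_iff dclass_ops dwf_dstar dstar_boundary)
qed

end

section \<open>Star structure of the presentations in question\<close>

lemma tl_presentation_simps [simp]:
  "letters (tl_presentation \<delta> R) = UNIV" "gens (tl_presentation \<delta> R) = UNIV"
  "gsrc (tl_presentation \<delta> R) Cup = strands 0" "gsrc (tl_presentation \<delta> R) Cap = strands 2"
  "gtgt (tl_presentation \<delta> R) Cup = strands 2" "gtgt (tl_presentation \<delta> R) Cap = strands 0"
  "gstar (tl_presentation \<delta> R) Cup = Cap" "gstar (tl_presentation \<delta> R) Cap = Cup"
  "ldual (tl_presentation \<delta> R) x = x" "lev (tl_presentation \<delta> R) x = DGen Cap"
  by (simp_all add: tl_presentation_def)

lemma tl_star_presentation: "star_presentation (tl_presentation \<delta> R)"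
  by unfold_locales (case_tac [!] g, auto)

lemma free_product_star_presentation:
  assumes star: "\<And>x y f. \<lbrakk>x \<in> ob A; y \<in> ob A; f \<in> hom A x y\<rbrakk> \<Longrightarrow> star A f \<in> hom A y x \<and> star A (star A f) = f"
    "\<And>x y f. \<lbrakk>x \<in> ob B; y \<in> ob B; f \<in> hom B x y\<rbrakk> \<Longrightarrow> star B f \<in> hom B y x \<and> star B (star B f) = f"
    and words: "\<And>xs. xs \<in> lists (ob A) \<Longrightarrow> tensor_word A xs \<in> ob A"
    "\<And>xs. xs \<in> lists (ob B) \<Longrightarrow> tensor_word B xs \<in> ob B"
  shows "star_presentation (free_product_presentation A B)"
proof -
  have A: "star A f \<in> hom A (tensor_word A ys) (tensor_word A xs) \<and> star A (star A f) = f"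
    if "\<forall>x\<in>set xs. x \<in> ob A" "\<forall>x\<in>set ys. x \<in> ob A" "f \<in> hom A (tensor_word A xs) (tensor_word A ys)"
    for xs ys f
    using that words(1)[of xs] words(1)[of ys] star(1) by (simp add: in_lists_conv_set)
  have B: "star B f \<in> hom B (tensor_word B ys) (tensor_word B xs) \<and> star B (star B f) = f"
    if "\<forall>x\<in>set xs. x \<in> ob B" "\<forall>x\<in>set ys. x \<in> ob B" "f \<in> hom B (tensor_word B xs) (tensor_word B ys)"
    for xs ys f
    using that words(2)[of xs] words(2)[of ys] star(2) by (simp add: in_lists_conv_set)
  show ?thesis
    by unfold_locales
      (auto simp: free_product_presentation_def vertices_def vertex_star_def image_iff A B)
qed

section \<open>Temperley--Lieb diagrams\<close>

locale tl_category =
  fixes \<delta> :: complex and R :: "(tl_diagram \<times> tl_diagram) set"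
begin

abbreviation "P \<equiv> tl_presentation \<delta> R"

sublocale star_presentation P
  by (rule tl_star_presentation)

sublocale word_category "presented P" "\<lambda>w. w"
  by (rule word_category.intro[OF presented_strict_monoidal]) (unfold_locales, auto)

notation cmp (infixr \<open>\<bullet>\<close> 65) and tns (infixr \<open>\<boxtimes>\<close> 70) and pls (infixl \<open>\<oplus>\<close> 60)
  and scl (infixr \<open>*\<^sub>a\<close> 62) and adj (\<open>_\<^sup>\<star>\<close> [1000] 1000)

definition arr :: "tl_diagram \<Rightarrow> (unit, tl_diagram set) arrow" where
  "arr t = Arrow (dsrc P t) (dtgt P t) (dclass P t)"

lemma valid_arr [simp]: "dwf P t \<Longrightarrow> valid (arr t)"
  by (simp add: arr_def valid_def hom_presentedI)

lemma arr_boundary [simp]: "src (arr t) = dsrc P t" "tgt (arr t) = dtgt P t" "mor (arr t) = dclass P t"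
  by (simp_all add: arr_def)

lemma arr_simps:
  "arr (DId xs) = Id xs" "arr (DZero xs ys) = Zero xs ys"
  "dwf P (DComp s t) \<Longrightarrow> arr (DComp s t) = arr s \<bullet> arr t"
  "dwf P (DTensor s t) \<Longrightarrow> arr (DTensor s t) = arr s \<boxtimes> arr t"
  "dwf P (DAdd s t) \<Longrightarrow> arr (DAdd s t) = arr s \<oplus> arr t"
  "dwf P t \<Longrightarrow> arr (DScale a t) = a *\<^sub>a arr t"
  by (simp_all add: arr_def Id_def Zero_def cmp_def tns_def pls_def scl_def dclass_ops dpar_def)

lemma arr_star: "dwf P t \<Longrightarrow> arr (dstar P t) = (arr t)\<^sup>\<star>"
  by (simp add: arr_def adj_def star_dclass dstar_boundary)

lemma arr_eq: "\<lbrakk>(s, t) \<in> rels P; dpar P s t\<rbrakk> \<Longrightarrow> arr s = arr t"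
  using dclass_eq[OF deq.rel] by (auto simp: arr_def dpar_def)

definition cap :: "(unit, tl_diagram set) arrow" where "cap = arr (DGen Cap)"
definition cup :: "(unit, tl_diagram set) arrow" where "cup = arr (DGen Cup)"

lemma strands_simps [simp]:
  "strands 0 = []" "strands (Suc 0) = [()]" "strands 1 = [()]" "strands 2 = [(), ()]"
  "strands 4 = [(), (), (), ()]"
  by (simp_all add: strands_def numeral_eq_Suc)

lemma cap_boundary [simp]:
  "valid cap" "src cap = [(), ()]" "tgt cap = []" "valid cup" "src cup = []" "tgt cup = [(), ()]"
  by (simp_all add: cap_def cup_def)

lemma adj_cap [simp]: "cap\<^sup>\<star> = cup" "cup\<^sup>\<star> = cap"
  using arr_star[of "DGen Cap"] arr_star[of "DGen Cup"] by (simp_all add: cap_def cup_def)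

lemma zigzag: "whisk [] cap [()] \<bullet> whisk [()] cup [] = Id [()]"
  "whisk [()] cap [] \<bullet> whisk [] cup [()] = Id [()]"
  and loop: "cap \<bullet> cup = \<delta> *\<^sub>a Id []"
proof -
  have "arr (DComp (DTensor (DGen Cap) (DId (strands 1))) (DTensor (DId (strands 1)) (DGen Cup)))
      = arr (DId (strands 1))"
    by (rule arr_eq) (simp add: tl_presentation_def, simp add: dpar_def)
  then show "whisk [] cap [()] \<bullet> whisk [()] cup [] = Id [()]"
    by (simp add: arr_simps cap_def cup_def whisk_def)
  have "arr (DComp (DTensor (DId (strands 1)) (DGen Cap)) (DTensor (DGen Cup) (DId (strands 1))))
      = arr (DId (strands 1))"
    by (rule arr_eq) (simp add: tl_presentation_def, simp add: dpar_def)
  then show "whisk [()] cap [] \<bullet> whisk [] cup [()] = Id [()]"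
    by (simp add: arr_simps cap_def cup_def whisk_def)
  have "arr (DComp (DGen Cap) (DGen Cup)) = arr (DScale \<delta> (DId []))"
    by (rule arr_eq) (simp add: tl_presentation_def, simp add: dpar_def)
  then show "cap \<bullet> cup = \<delta> *\<^sub>a Id []"
    by (simp add: arr_simps cap_def cup_def)
qed

lemma whisk_zigzag:
  "whisk a cap (() # b) \<bullet> whisk (a @ [()]) cup b = Id (a @ () # b)"
  "whisk (a @ [()]) cap b \<bullet> whisk a cup (() # b) = Id (a @ () # b)"
  using arg_cong[OF zigzag(1), of "\<lambda>f. whisk a f b"] arg_cong[OF zigzag(2), of "\<lambda>f. whisk a f b"]
  by (simp_all add: whisk_cmp)

abbreviation "ee \<equiv> cup \<bullet> cap"

text \<open>The second Jones-Wenzl projection, with coefficient \<open>[1] / [2]\<close>; its image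
  is the object \<open>\<rho>\<close>.\<close>

definition f2 :: "(unit, tl_diagram set) arrow" where
  "f2 = Id [(), ()] \<oplus> (- (1 / \<delta>)) *\<^sub>a ee"

lemma f2_boundary [simp]: "valid f2" "src f2 = [(), ()]" "tgt f2 = [(), ()]"
  by (simp_all add: f2_def)

lemma cap_cup [simp]:
  "\<lbrakk>valid k; tgt k = []\<rbrakk> \<Longrightarrow> cap \<bullet> cup \<bullet> k = \<delta> *\<^sub>a k"
  by (simp add: loop flip: cmp_assoc)

lemma e_f2:
  assumes "\<delta> \<noteq> 0"
  shows "cap \<bullet> f2 = Zero [(), ()] []" "f2 \<bullet> cup = Zero [] [(), ()]"
  using assms scl_add_left[of cap 1 "-1"] scl_add_left[of cup 1 "-1"]
  by (simp_all add: f2_def cmp_pls pls_cmp cmp_assoc loop scl_0)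

lemma f2_idem:
  assumes "\<delta> \<noteq> 0"
  shows "f2 \<bullet> f2 = f2"
  by (subst (1) f2_def) (simp add: pls_cmp cmp_assoc e_f2 assms)

lemma adj_f2: "cnj \<delta> = \<delta> \<Longrightarrow> f2\<^sup>\<star> = f2"
  by (simp add: f2_def)

text \<open>The cap on the two middle strands out of four. The Temperley-Lieb generator
  \<open>e2\<close> is kept factored through it, so that relations such as
  \<open>e2 e1 e2 = e2\<close> become statements on two strands.\<close>

definition m :: "(unit, tl_diagram set) arrow" where "m = whisk [()] cap [()]"

lemma m_boundary [simp]: "valid m" "src m = [(), (), (), ()]" "tgt m = [(), ()]"
  by (simp_all add: m_def)

abbreviation "e1 \<equiv> whisk [] ee [(), ()]"
abbreviation "e2 \<equiv> m\<^sup>\<star> \<bullet> m"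
abbreviation "e3 \<equiv> whisk [(), ()] ee []"
abbreviation "P1 \<equiv> whisk [] f2 [(), ()]"
abbreviation "Q1 \<equiv> whisk [(), ()] f2 []"
definition "F = P1 \<bullet> Q1"

lemma F_boundary [simp]: "valid F" "src F = [(), (), (), ()]" "tgt F = [(), (), (), ()]"
  by (simp_all add: F_def)

lemma PQ: "P1 \<bullet> Q1 = Q1 \<bullet> P1"
  using slide[of f2 f2 "[]" "[]" "[]"] by simp

lemma F_tns: "F = f2 \<boxtimes> f2"
  by (simp add: F_def tns_as_whisk)

lemma m_e1_m: "m \<bullet> e1 \<bullet> m\<^sup>\<star> = Id [(), ()]"
proof -
  have "m \<bullet> e1 \<bullet> m\<^sup>\<star> = (m \<bullet> whisk [] cup [(), ()]) \<bullet> (whisk [] cap [(), ()] \<bullet> m\<^sup>\<star>)"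
    by (simp add: whisk_cmp cmp_assoc)
  then show ?thesis
    using whisk_zigzag(1)[of "[]" "[()]"] whisk_zigzag(2)[of "[]" "[()]"]
    by (simp add: m_def)
qed

lemma m_e3_m: "m \<bullet> e3 \<bullet> m\<^sup>\<star> = Id [(), ()]"
proof -
  have "m \<bullet> e3 \<bullet> m\<^sup>\<star> = (m \<bullet> whisk [(), ()] cup []) \<bullet> (whisk [(), ()] cap [] \<bullet> m\<^sup>\<star>)"
    by (simp add: whisk_cmp cmp_assoc)
  then show ?thesis
    using whisk_zigzag(1)[of "[()]" "[]"] whisk_zigzag(2)[of "[()]" "[]"]
    by (simp add: m_def)
qed

text \<open>Two zigzags straighten, and the cap and cup that remain lie on disjoint strands and
  slide past each other.\<close>

lemma m_e1e3_m: "m \<bullet> e1 \<bullet> e3 \<bullet> m\<^sup>\<star> = ee"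
proof -
  have 1: "m \<bullet> whisk [] cup [(), ()] = Id [(), ()]" "whisk [(), ()] cap [] \<bullet> m\<^sup>\<star> = Id [(), ()]"
    using whisk_zigzag(1)[of "[]" "[()]"] whisk_zigzag(2)[of "[]" "[()]"]
      whisk_zigzag(1)[of "[()]" "[]"] whisk_zigzag(2)[of "[()]" "[]"]
    by (simp_all add: m_def)
  have "m \<bullet> e1 \<bullet> e3 \<bullet> m\<^sup>\<star>
    = (m \<bullet> whisk [] cup [(), ()]) \<bullet> (whisk [] cap [(), ()] \<bullet> whisk [(), ()] cup []) \<bullet>
      (whisk [(), ()] cap [] \<bullet> m\<^sup>\<star>)"
    by (simp add: whisk_cmp cmp_assoc)
  also have "\<dots> = whisk [] cap [(), ()] \<bullet> whisk [(), ()] cup []"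
    by (simp add: 1)
  also have "\<dots> = cup \<bullet> cap"
    using slide[of cap cup "[]" "[]" "[]"] by simp
  finally show ?thesis .
qed

lemma m_m: "m \<bullet> m\<^sup>\<star> = \<delta> *\<^sub>a Id [(), ()]"
  using whisk_cmp[of cup cap "[()]" "[()]"] by (simp add: m_def loop)

lemma P1_e3: "P1 \<bullet> e3 = e3 \<bullet> P1"
  using slide[of f2 ee "[]" "[]" "[]"] by simp

text \<open>On the image of \<open>F\<close>, which is \<open>\<rho>\<close> tensored with itself,
  joining one pair of strands gives the trivalent vertex \<open>y\<close>, joining two nested pairs
  gives the cap \<open>ev2\<close>. The vertex is not normalised.\<close>

definition y :: "(unit, tl_diagram set) arrow" where "y = f2 \<bullet> m \<bullet> F"
definition ev2 :: "(unit, tl_diagram set) arrow" where "ev2 = cap \<bullet> m \<bullet> F"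

lemma y_ev2_boundary [simp]: "valid y" "src y = [(), (), (), ()]" "tgt y = [(), ()]"
  "valid ev2" "src ev2 = [(), (), (), ()]" "tgt ev2 = []"
  by (simp_all add: y_def ev2_def)

context
  assumes nz: "\<delta> \<noteq> 0" and re: "cnj \<delta> = \<delta>"
begin

lemma F_props: "F \<bullet> P1 = F" "P1 \<bullet> F = F" "F \<bullet> F = F" "F\<^sup>\<star> = F"
  "e3 \<bullet> F = Zero [(), (), (), ()] [(), (), (), ()]" "F \<bullet> e3 = Zero [(), (), (), ()] [(), (), (), ()]"
proof -
  have P: "P1 \<bullet> P1 = P1" and Q: "Q1 \<bullet> Q1 = Q1"
    by (simp_all add: f2_idem nz flip: whisk_cmp)
  show 1: "F \<bullet> P1 = F"
    unfolding F_def PQ by (simp add: cmp_assoc P)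
  show 2: "P1 \<bullet> F = F"
    unfolding F_def by (simp add: P flip: cmp_assoc)
  have "F \<bullet> F = (F \<bullet> P1) \<bullet> Q1"
    by (simp add: F_def cmp_assoc)
  then show "F \<bullet> F = F"
    unfolding 1 by (simp add: F_def cmp_assoc Q)
  show "F\<^sup>\<star> = F"
    unfolding F_def by (simp add: adj_f2 re PQ)
  have "e3 \<bullet> Q1 = Zero [(), (), (), ()] [(), (), (), ()]" "Q1 \<bullet> e3 = Zero [(), (), (), ()] [(), (), (), ()]"
    using nz by (simp_all add: e_f2 cmp_assoc flip: whisk_cmp) (simp add: e_f2 flip: cmp_assoc)
  then show "e3 \<bullet> F = Zero [(), (), (), ()] [(), (), (), ()]" "F \<bullet> e3 = Zero [(), (), (), ()] [(), (), (), ()]"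
    by (simp add: F_def PQ flip: cmp_assoc, simp add: F_def cmp_assoc)
qed

lemma e2_P1_e3_e2: "m \<bullet> P1 \<bullet> e3 \<bullet> m\<^sup>\<star> = f2"
proof -
  have "P1 = Id [(), (), (), ()] \<oplus> (- (1 / \<delta>)) *\<^sub>a e1"
    by (simp add: f2_def whisk_pls)
  then have "m \<bullet> P1 \<bullet> e3 \<bullet> m\<^sup>\<star> = m \<bullet> e3 \<bullet> m\<^sup>\<star> \<oplus> (- (1 / \<delta>)) *\<^sub>a (m \<bullet> e1 \<bullet> e3 \<bullet> m\<^sup>\<star>)"
    by (simp add: pls_cmp cmp_pls cmp_assoc)
  then show ?thesis
    by (simp add: m_e3_m m_e1e3_m f2_def)
qed

lemma y_y: "y\<^sup>\<star> \<bullet> y = F \<bullet> m\<^sup>\<star> \<bullet> f2 \<bullet> m \<bullet> F"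
proof -
  have "y\<^sup>\<star> \<bullet> y = F\<^sup>\<star> \<bullet> m\<^sup>\<star> \<bullet> (f2\<^sup>\<star> \<bullet> f2) \<bullet> m \<bullet> F"
    by (simp add: y_def cmp_assoc)
  then show ?thesis
    by (simp add: F_props adj_f2 re f2_idem nz)
qed

lemma ev2_ev2: "ev2\<^sup>\<star> \<bullet> ev2 = F \<bullet> m\<^sup>\<star> \<bullet> ee \<bullet> m \<bullet> F"
  by (simp add: ev2_def cmp_assoc F_props)

text \<open>Here \<open>G\<close> is the third Jones--Wenzl projection next to a strand, and the sandwiched element is the fourth one.\<close>

lemma sandwich_G:
  fixes G
  defines "G \<equiv> P1 \<oplus> (- 1) *\<^sub>a (P1 \<bullet> e2 \<bullet> P1)"
  shows "F \<bullet> (G \<oplus> (- \<delta>) *\<^sub>a (G \<bullet> e3 \<bullet> G)) \<bullet> F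
    = F \<oplus> (- 1) *\<^sub>a (F \<bullet> e2 \<bullet> F) \<oplus> (- \<delta>) *\<^sub>a (y\<^sup>\<star> \<bullet> y)"
proof -
  have FP: "F \<bullet> P1 \<bullet> k = F \<bullet> k" if "valid k" "tgt k = [(), (), (), ()]" for k
    using that F_props(1) by (simp flip: cmp_assoc)
  have Fe: "F \<bullet> e3 \<bullet> k = Zero (src k) [(), (), (), ()]" if "valid k" "tgt k = [(), (), (), ()]" for k
    using that F_props(6) by (simp flip: cmp_assoc)
  have V [simp]: "valid G" "src G = [(), (), (), ()]" "tgt G = [(), (), (), ()]"
    by (simp_all add: G_def)
  have FGF: "F \<bullet> G \<bullet> F = F \<oplus> (- 1) *\<^sub>a (F \<bullet> e2 \<bullet> F)"
    by (simp add: G_def pls_cmp cmp_pls cmp_assoc FP F_props)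
  have FGe: "F \<bullet> G \<bullet> e3 = (- 1) *\<^sub>a (F \<bullet> m\<^sup>\<star> \<bullet> m \<bullet> P1 \<bullet> e3)"
    by (simp add: G_def pls_cmp cmp_pls cmp_assoc FP F_props)
  have eGF: "e3 \<bullet> G \<bullet> F = (- 1) *\<^sub>a (P1 \<bullet> e3 \<bullet> m\<^sup>\<star> \<bullet> m \<bullet> F)"
  proof -
    have "e3 \<bullet> G \<bullet> F = e3 \<bullet> F \<oplus> (- 1) *\<^sub>a ((e3 \<bullet> P1) \<bullet> m\<^sup>\<star> \<bullet> m \<bullet> F)"
      by (simp add: G_def pls_cmp cmp_pls cmp_assoc F_props)
    then show ?thesis
      by (simp add: F_props cmp_assoc flip: P1_e3)
  qed
  have e3e3: "e3 \<bullet> e3 = \<delta> *\<^sub>a e3"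
    by (simp add: cmp_assoc flip: whisk_cmp)
  \<comment> \<open>Doubling \<open>e3\<close> uses up the loop value and puts a copy of
    \<open>e3\<close> next to each \<open>G\<close>. Between \<open>F\<close> and \<open>e3\<close>
    only the second summand of \<open>G\<close> survives, because \<open>e3\<close> kills
    \<open>F\<close>.\<close>
  have "\<delta> *\<^sub>a (F \<bullet> G \<bullet> e3 \<bullet> G \<bullet> F) = F \<bullet> G \<bullet> (e3 \<bullet> e3) \<bullet> G \<bullet> F"
    unfolding e3e3 by simp
  also have "\<dots> = (F \<bullet> G \<bullet> e3) \<bullet> (e3 \<bullet> G \<bullet> F)"
    by (simp add: cmp_assoc)
  also have "\<dots> = F \<bullet> m\<^sup>\<star> \<bullet> m \<bullet> P1 \<bullet> (e3 \<bullet> P1) \<bullet> e3 \<bullet> m\<^sup>\<star> \<bullet> m \<bullet> F"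
    unfolding FGe eGF by (simp add: cmp_assoc)
  also have "\<dots> = F \<bullet> m\<^sup>\<star> \<bullet> m \<bullet> (P1 \<bullet> P1) \<bullet> (e3 \<bullet> e3) \<bullet> m\<^sup>\<star> \<bullet> m \<bullet> F"
    unfolding P1_e3[symmetric] by (simp add: cmp_assoc)
  also have "\<dots> = \<delta> *\<^sub>a (F \<bullet> m\<^sup>\<star> \<bullet> (m \<bullet> P1 \<bullet> e3 \<bullet> m\<^sup>\<star>) \<bullet> m \<bullet> F)"
    unfolding e3e3 by (simp add: cmp_assoc f2_idem nz flip: whisk_cmp)
  finally have "\<delta> *\<^sub>a (F \<bullet> G \<bullet> e3 \<bullet> G \<bullet> F) = \<delta> *\<^sub>a (y\<^sup>\<star> \<bullet> y)"
    by (simp add: e2_P1_e3_e2 y_y)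
  then have "(-1) *\<^sub>a \<delta> *\<^sub>a (F \<bullet> G \<bullet> e3 \<bullet> G \<bullet> F) = (-1) *\<^sub>a \<delta> *\<^sub>a (y\<^sup>\<star> \<bullet> y)"
    by (rule arg_cong)
  then show ?thesis
    by (simp add: pls_cmp cmp_pls cmp_assoc FGF)
qed

text \<open>Expanding both projections in \<open>F\<close> leaves the four terms evaluated above;
  the result is the quantum integer \<open>[3]\<close>, the dimension of
  \<open>\<rho>\<close>.\<close>

lemma loop2: "ev2 \<bullet> ev2\<^sup>\<star> = (\<delta>\<^sup>2 - 1) *\<^sub>a Id []"
proof -
  have FF: "F \<bullet> F \<bullet> k = F \<bullet> k" if "valid k" "tgt k = [(), (), (), ()]" for k
    using that F_props(3) by (simp flip: cmp_assoc)
  have "F = Id [(), (), (), ()] \<oplus> (- (1 / \<delta>)) *\<^sub>a e1 \<oplus> (- (1 / \<delta>)) *\<^sub>a e3 \<oplus> (1 / \<delta>\<^sup>2) *\<^sub>a (e1 \<bullet> e3)"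
    unfolding F_def f2_def
    by (simp add: whisk_pls pls_cmp cmp_pls power2_eq_square pls_assoc scl_pls)
  then have "m \<bullet> F \<bullet> m\<^sup>\<star> = m \<bullet> m\<^sup>\<star> \<oplus> (- (1 / \<delta>)) *\<^sub>a (m \<bullet> e1 \<bullet> m\<^sup>\<star>)
      \<oplus> (- (1 / \<delta>)) *\<^sub>a (m \<bullet> e3 \<bullet> m\<^sup>\<star>) \<oplus> (1 / \<delta>\<^sup>2) *\<^sub>a (m \<bullet> e1 \<bullet> e3 \<bullet> m\<^sup>\<star>)"
    by (simp add: pls_cmp cmp_pls cmp_assoc)
  also have "\<dots> = (\<delta> - 2 / \<delta>) *\<^sub>a Id [(), ()] \<oplus> (1 / \<delta>\<^sup>2) *\<^sub>a ee"
    by (simp add: m_m m_e1_m m_e3_m m_e1e3_m flip: scl_add_left)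
  finally have "m \<bullet> F \<bullet> m\<^sup>\<star> = (\<delta> - 2 / \<delta>) *\<^sub>a Id [(), ()] \<oplus> (1 / \<delta>\<^sup>2) *\<^sub>a ee" .
  moreover have "ev2 \<bullet> ev2\<^sup>\<star> = cap \<bullet> (m \<bullet> F \<bullet> m\<^sup>\<star>) \<bullet> cup"
    by (simp add: ev2_def cmp_assoc F_props FF)
  ultimately have "ev2 \<bullet> ev2\<^sup>\<star> = ((\<delta> - 2 / \<delta> + \<delta> / \<delta>\<^sup>2) * \<delta>) *\<^sub>a Id []"
    by (simp add: pls_cmp cmp_pls cmp_assoc loop flip: scl_add_left)
  moreover have "(\<delta> - 2 / \<delta> + \<delta> / \<delta>\<^sup>2) * \<delta> = \<delta>\<^sup>2 - 1"
    using nz by (simp add: field_simps power2_eq_square)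
  ultimately show ?thesis
    by simp
qed

end

end

section \<open>The golden loop parameter and the category of \<open>\<rho>\<close>\<close>

lemma golden_ne: "golden \<noteq> 0" "cnj golden = golden" and golden_square: "golden\<^sup>2 = golden + 1"
proof -
  have "1 + sqrt 5 > 0"
    by (simp add: add_pos_pos)
  then show "golden \<noteq> 0"
    unfolding golden_def of_real_eq_0_iff by simp
  have "((1 + sqrt 5) / 2)\<^sup>2 = (1 + sqrt 5) / 2 + 1"
    by (simp add: power2_eq_square field_simps)
  then show "golden\<^sup>2 = golden + 1"
    unfolding golden_def of_real_power[symmetric] by simp
  show "cnj golden = golden"
    by (simp add: golden_def)
qed

lemma qint_golden: "qint golden 2 = golden" "qint golden 3 = golden" "qint golden 4 = 1"
proof -
  have 1: "golden * golden = golden + 1"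
    using golden_square by (simp add: power2_eq_square)
  show "qint golden 2 = golden" "qint golden 3 = golden" "qint golden 4 = 1"
    by (simp_all add: numeral_eq_Suc 1 algebra_simps)
qed

lemma jones_wenzl_2: "jones_wenzl golden 2 =
    (let f = DTensor (DId [()]) (DId [()]); e = DTensor (DId []) (DComp (DGen Cup) (DGen Cap))
     in DAdd f (DScale (- (1 / golden)) (DComp f (DComp e f))))"
  by (simp add: numeral_2_eq_2 strands_def)

text \<open>The coefficient \<open>[2] / [3]\<close> is 1, both quantum integers being
  golden.\<close>

lemma jones_wenzl_3: "jones_wenzl golden 3 =
    (let f = DTensor (jones_wenzl golden 2) (DId [()]); e = DTensor (DId [()]) (DComp (DGen Cup) (DGen Cap))
     in DAdd f (DScale (- 1) (DComp f (DComp e f))))"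
proof -
  have n: "Suc 1 = 2" "Suc 2 = 3" "strands 1 = [()]"
    by (simp_all add: strands_def)
  show ?thesis
    using jones_wenzl.simps(3)[of golden 1] unfolding n qint_golden div_self[OF golden_ne(1)] .
qed

text \<open>The coefficient \<open>[3] / [4]\<close> is golden over one. Its coincidence with the
  loop value is what \<open>sandwich_G\<close> exploits.\<close>

lemma jones_wenzl_4: "jones_wenzl golden 4 =
    (let f = DTensor (jones_wenzl golden 3) (DId [()]); e = DTensor (DId [(), ()]) (DComp (DGen Cup) (DGen Cap))
     in DAdd f (DScale (- golden) (DComp f (DComp e f))))"
proof -
  have n: "Suc 2 = 3" "Suc 3 = 4" "strands 1 = [()]" "strands 2 = [(), ()]"
    by (simp_all add: strands_def numeral_2_eq_2)
  show ?thesis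
    using jones_wenzl.simps(3)[of golden 2] unfolding n qint_golden div_by_1 .
qed

locale fib_category = tl_category golden R for R +
  assumes R_eq: "R = {(jones_wenzl golden 4, DZero (strands 4) (strands 4))}"
begin

notation cmp (infixr \<open>\<bullet>\<close> 65) and tns (infixr \<open>\<boxtimes>\<close> 70) and pls (infixl \<open>\<oplus>\<close> 60)
  and scl (infixr \<open>*\<^sub>a\<close> 62) and adj (\<open>_\<^sup>\<star>\<close> [1000] 1000)

lemma P_eq: "TLA4_presentation = P"
  by (simp only: TLA4_presentation_def R_eq)

lemma jw2_boundary [simp]: "dwf P (jones_wenzl golden 2)" "dsrc P (jones_wenzl golden 2) = [(), ()]"
    "dtgt P (jones_wenzl golden 2) = [(), ()]"
  by (simp_all add: jones_wenzl_2 Let_def)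

lemma arr_jw2: "arr (jones_wenzl golden 2) = f2"
  by (simp add: jones_wenzl_2 Let_def arr_simps f2_def flip: cap_def cup_def)

lemma jw3_boundary [simp]: "dwf P (jones_wenzl golden 3)" "dsrc P (jones_wenzl golden 3) = [(), (), ()]"
    "dtgt P (jones_wenzl golden 3) = [(), (), ()]"
  by (simp_all add: jones_wenzl_3 Let_def)

definition G :: "(unit, tl_diagram set) arrow" where
  "G = P1 \<oplus> (- 1) *\<^sub>a (P1 \<bullet> e2 \<bullet> P1)"

lemma arr_jw3: "arr (DTensor (jones_wenzl golden 3) (DId [()])) = G"
proof -
  let ?f = "whisk [] f2 [()]" and ?e = "whisk [()] ee []"
  have 1: "arr (jones_wenzl golden 3) = ?f \<oplus> (- 1) *\<^sub>a (?f \<bullet> ?e \<bullet> ?f)"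
    by (simp add: jones_wenzl_3 Let_def arr_simps arr_jw2 whisk_def flip: cap_def cup_def)
  have "arr (DTensor (jones_wenzl golden 3) (DId [()])) = whisk [] (arr (jones_wenzl golden 3)) [()]"
    by (simp add: arr_simps whisk_def)
  also have "\<dots> = G"
    unfolding 1 G_def by (simp add: whisk_pls whisk_cmp m_def)
  finally show ?thesis .
qed

lemma jw4: "G \<oplus> (- golden) *\<^sub>a (G \<bullet> e3 \<bullet> G) = Zero [(), (), (), ()] [(), (), (), ()]"
proof -
  have "arr (jones_wenzl golden 4) = arr (DZero (strands 4) (strands 4))"
    by (rule arr_eq) (simp add: tl_presentation_def R_eq, simp add: dpar_def jones_wenzl_4 Let_def)
  moreover have "arr (jones_wenzl golden 4) = G \<oplus> (- golden) *\<^sub>a (G \<bullet> e3 \<bullet> G)"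
    unfolding jones_wenzl_4 Let_def
    by (simp add: arr_simps(5,6,3) arr_jw3)
      (simp add: arr_simps whisk_def flip: cap_def cup_def)
  ultimately show ?thesis
    by (simp add: arr_simps)
qed

text \<open>This is the splitting of \<open>\<rho> \<rho>\<close> into the unit and
  \<open>\<rho>\<close>. Compressing the relation \<open>jw4\<close> by \<open>F\<close> expresses
  \<open>F\<close> through the square of \<open>y\<close> and
  \<open>F \<bullet> e2 \<bullet> F\<close>; the latter splits again by the formula for
  \<open>f2\<close>. The square of \<open>y\<close> is thus counted \<open>golden + 1\<close> times,
  which is \<open>golden\<^sup>2\<close>.\<close>

lemma F_decomposition: "F = (1 / golden) *\<^sub>a (ev2\<^sup>\<star> \<bullet> ev2) \<oplus> golden\<^sup>2 *\<^sub>a (y\<^sup>\<star> \<bullet> y)"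
proof -
  note pr = F_props[OF golden_ne]
  let ?y = "y\<^sup>\<star> \<bullet> y" and ?n = "ev2\<^sup>\<star> \<bullet> ev2" and ?A = "F \<bullet> e2 \<bullet> F"
  have A: "?A = ?y \<oplus> (1 / golden) *\<^sub>a ?n"
  proof -
    have "?y = ?A \<oplus> (- (1 / golden)) *\<^sub>a ?n"
      unfolding y_y[OF golden_ne] ev2_ev2[OF golden_ne] f2_def
      by (simp add: pls_cmp cmp_pls cmp_assoc)
    then have "?y \<oplus> (1 / golden) *\<^sub>a ?n = ?A \<oplus> ((- (1 / golden)) *\<^sub>a ?n \<oplus> (1 / golden) *\<^sub>a ?n)"
      by (simp add: pls_assoc)
    also have "\<dots> = ?A"
      by (simp add: scl_0 flip: scl_add_left)
    finally show ?thesis ..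
  qed
  have "F \<oplus> (- 1) *\<^sub>a ?A \<oplus> (- golden) *\<^sub>a ?y = Zero [(), (), (), ()] [(), (), (), ()]"
    using sandwich_G[OF golden_ne] jw4 by (simp add: G_def)
  then have "F \<oplus> (- 1) *\<^sub>a ?A \<oplus> (- golden) *\<^sub>a ?y \<oplus> (golden *\<^sub>a ?y \<oplus> ?A) = golden *\<^sub>a ?y \<oplus> ?A"
    by simp
  moreover have "F \<oplus> (- 1) *\<^sub>a ?A \<oplus> (- golden) *\<^sub>a ?y \<oplus> (golden *\<^sub>a ?y \<oplus> ?A)
    = F \<oplus> (- 1) *\<^sub>a ?A \<oplus> ((- golden) *\<^sub>a ?y \<oplus> golden *\<^sub>a ?y) \<oplus> ?A"
    by (simp add: pls_assoc)
  moreover have "\<dots> = F"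
    using scl_add_left[of ?A "-1" 1, symmetric] scl_add_left[of ?y "- golden" golden, symmetric]
    by (simp add: pls_assoc scl_0)
  ultimately have "F = golden *\<^sub>a ?y \<oplus> ?A"
    by simp
  also have "\<dots> = (golden *\<^sub>a ?y \<oplus> 1 *\<^sub>a ?y) \<oplus> (1 / golden) *\<^sub>a ?n"
    unfolding A by (simp add: pls_assoc)
  also have "golden *\<^sub>a ?y \<oplus> 1 *\<^sub>a ?y = golden\<^sup>2 *\<^sub>a ?y"
    by (simp add: golden_square flip: scl_add_left del: scl_1)
  finally show ?thesis
    by (simp add: pls_commute)
qed

lemma ev2_loop: "ev2 \<bullet> ev2\<^sup>\<star> = golden *\<^sub>a Id []"
  using loop2[OF golden_ne] by (simp add: golden_square)

definition rp :: "nat \<Rightarrow> (unit, tl_diagram set) arrow" where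
  "rp k = arr (rho_proj k)"

lemma strands_Suc: "strands (Suc (Suc k)) = () # () # strands k"
  by (simp add: strands_def)

lemma rho_proj_boundary [simp]: "dwf P (rho_proj k)" "dsrc P (rho_proj k) = strands (2 * k)"
    "dtgt P (rho_proj k) = strands (2 * k)"
  by (induction k) (simp_all add: strands_Suc)

lemma rp_boundary [simp]: "valid (rp k)" "src (rp k) = strands (2 * k)" "tgt (rp k) = strands (2 * k)"
  by (simp_all add: rp_def)

lemma rp_0: "rp 0 = Id []" and rp_Suc: "rp (Suc k) = f2 \<boxtimes> rp k"
  by (simp_all add: rp_def arr_simps arr_jw2)

lemma rp_props: "rp k \<bullet> rp k = rp k" "(rp k)\<^sup>\<star> = rp k"
  by (induction k) (simp_all add: rp_0 rp_Suc f2_idem adj_f2 golden_ne flip: tns_cmp)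

lemma rp_12: "rp 1 = f2" "rp 2 = F"
  by (simp_all add: numeral_2_eq_2 rp_Suc rp_0 F_tns)

abbreviation T2_arrow :: "nat \<Rightarrow> nat \<Rightarrow> tl_diagram set \<Rightarrow> (unit, tl_diagram set) arrow" where
  "T2_arrow a b x \<equiv> Arrow (strands (2 * a)) (strands (2 * b)) x"

lemma T2_simps [simp]: "ob T2 = UNIV" "unt T2 = 0" "tensor_ob T2 = (+)" "dual T2 a = a"
    "comp T2 = comp (presented P)" "add T2 = add (presented P)" "scale T2 = scale (presented P)"
    "star T2 = star (presented P)" "tensor T2 = tensor (presented P)"
  by (simp_all add: T2_def Let_def P_eq)

lemma ident_T2: "ident T2 a = mor (rp a)"
  by (simp add: T2_def Let_def P_eq rp_def)

lemma hom_T2_iff: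
  "x \<in> hom T2 a b \<longleftrightarrow> valid (T2_arrow a b x) \<and> rp b \<bullet> T2_arrow a b x \<bullet> rp a = T2_arrow a b x"
  by (auto simp: T2_def Let_def P_eq valid_def cmp_def rp_def)

lemma hom_T2I:
  "\<lbrakk>valid f; src f = strands (2 * a); tgt f = strands (2 * b); rp b \<bullet> f \<bullet> rp a = f\<rbrakk> \<Longrightarrow> mor f \<in> hom T2 a b"
  by (cases f) (simp add: hom_T2_iff)

lemma hom_T2E:
  assumes "x \<in> hom T2 a b"
  obtains f where "valid f" "src f = strands (2 * a)" "tgt f = strands (2 * b)" "rp b \<bullet> f \<bullet> rp a = f"
    "rp b \<bullet> f = f" "f \<bullet> rp a = f" "x = mor f"
proof -
  let ?f = "T2_arrow a b x"
  have f: "valid ?f" "rp b \<bullet> ?f \<bullet> rp a = ?f"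
    using assms by (simp_all add: hom_T2_iff)
  have "rp b \<bullet> ?f = rp b \<bullet> rp b \<bullet> ?f \<bullet> rp a" "?f \<bullet> rp a = (rp b \<bullet> ?f \<bullet> rp a) \<bullet> rp a"
    using f(2) by simp_all
  moreover have "rp b \<bullet> rp b \<bullet> ?f \<bullet> rp a = rp b \<bullet> ?f \<bullet> rp a"
    using f(1) by (subst cmp_assoc[symmetric]) (simp_all add: rp_props)
  moreover have "(rp b \<bullet> ?f \<bullet> rp a) \<bullet> rp a = rp b \<bullet> ?f \<bullet> rp a"
    using f(1) by (simp add: rp_props cmp_assoc)
  ultimately show ?thesis
    using f by (intro that[of ?f]) simp_all
qed

lemma comp_hom_T2: "\<lbrakk>f \<in> hom T2 a b; g \<in> hom T2 b c\<rbrakk> \<Longrightarrow> comp T2 g f \<in> hom T2 a c"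
proof (elim hom_T2E)
  fix f' g'
  assume f: "valid f'" "src f' = strands (2 * a)" "tgt f' = strands (2 * b)" "f' \<bullet> rp a = f'" "f = mor f'"
    and g: "valid g'" "src g' = strands (2 * b)" "tgt g' = strands (2 * c)" "rp c \<bullet> g' = g'" "g = mor g'"
  have "rp c \<bullet> (g' \<bullet> f') \<bullet> rp a = (rp c \<bullet> g') \<bullet> (f' \<bullet> rp a)"
    using f(1-3) g(1-3) by (simp add: cmp_assoc)
  then have "mor (g' \<bullet> f') \<in> hom T2 a c"
    using f g by (intro hom_T2I) simp_all
  then show ?thesis
    using f g by (simp add: cmp_def)
qed

lemma add_hom_T2: "\<lbrakk>f \<in> hom T2 a b; g \<in> hom T2 a b\<rbrakk> \<Longrightarrow> add T2 f g \<in> hom T2 a b"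
proof (elim hom_T2E)
  fix f' g'
  assume f: "valid f'" "src f' = strands (2 * a)" "tgt f' = strands (2 * b)" "rp b \<bullet> f' \<bullet> rp a = f'" "f = mor f'"
    and g: "valid g'" "src g' = strands (2 * a)" "tgt g' = strands (2 * b)" "rp b \<bullet> g' \<bullet> rp a = g'" "g = mor g'"
  then have "mor (f' \<oplus> g') \<in> hom T2 a b"
    by (intro hom_T2I) (simp_all add: pls_cmp cmp_pls)
  then show ?thesis
    using f g by (simp add: pls_def)
qed

lemma scale_hom_T2: "f \<in> hom T2 a b \<Longrightarrow> scale T2 c f \<in> hom T2 a b"
proof (elim hom_T2E)
  fix f'
  assume f: "valid f'" "src f' = strands (2 * a)" "tgt f' = strands (2 * b)" "rp b \<bullet> f' \<bullet> rp a = f'" "f = mor f'"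
  then have "mor (c *\<^sub>a f') \<in> hom T2 a b"
    by (intro hom_T2I) simp_all
  then show ?thesis
    using f by (simp add: scl_def)
qed

lemma star_hom_T2: "f \<in> hom T2 a b \<Longrightarrow> star T2 f \<in> hom T2 b a \<and> star T2 (star T2 f) = f"
proof (elim hom_T2E)
  fix f'
  assume f: "valid f'" "src f' = strands (2 * a)" "tgt f' = strands (2 * b)" "rp b \<bullet> f' \<bullet> rp a = f'" "f = mor f'"
  have "rp a \<bullet> f'\<^sup>\<star> \<bullet> rp b = (rp b \<bullet> f' \<bullet> rp a)\<^sup>\<star>"
    using f(1-3) by (simp add: rp_props cmp_assoc)
  then have "mor (f'\<^sup>\<star>) \<in> hom T2 b a" "mor (f'\<^sup>\<star>\<^sup>\<star>) = mor f'"
    using f by (auto intro!: hom_T2I)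
  then show ?thesis
    using f by (simp add: adj_def)
qed

lemma ident_hom_T2: "ident T2 a \<in> hom T2 a a"
  unfolding ident_T2 by (rule hom_T2I) (simp_all add: rp_props)

lemma ev_T2: "ev T2 1 = mor ev2"
proof -
  have "arr (word_ev P [(), ()]) = cap \<bullet> m"
    by (simp add: word_dual_def arr_simps cap_def m_def whisk_def)
  then have "arr (word_ev P [(), ()]) \<bullet> (rp 1 \<boxtimes> rp 1) = ev2"
    by (simp add: rp_12 ev2_def F_tns cmp_assoc del: One_nat_def)
  moreover have "ev T2 1 = mor (arr (word_ev P [(), ()]) \<bullet> (rp 1 \<boxtimes> rp 1))"
    by (simp add: T2_def Let_def P_eq cmp_def tns_def rp_def)
  ultimately show ?thesis
    by simp
qed

text \<open>All that is later used of the diagrammatics of \<open>T2\<close>, phrased by its own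
  operations so that it can be transported along the quotient functor.\<close>

lemma T2_structure:
  "mor y \<in> hom T2 2 1" "ev T2 1 \<in> hom T2 2 0"
  "comp T2 (ev T2 1) (star T2 (ev T2 1)) = scale T2 golden (ident T2 0)"
  "ident T2 2 = add T2 (scale T2 (1 / golden) (comp T2 (star T2 (ev T2 1)) (ev T2 1)))
    (scale T2 (golden\<^sup>2) (comp T2 (star T2 (mor y)) (mor y)))"
proof -
  have "f2 \<bullet> y = y"
    by (simp add: y_def f2_idem golden_ne flip: cmp_assoc)
  moreover have "y \<bullet> F = y" "ev2 \<bullet> F = ev2"
    by (simp_all add: y_def ev2_def F_props golden_ne cmp_assoc)
  ultimately show "mor y \<in> hom T2 2 1" "ev T2 1 \<in> hom T2 2 0"
    unfolding ev_T2 by (auto intro!: hom_T2I simp: rp_12 rp_0 simp del: One_nat_def)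
  show "comp T2 (ev T2 1) (star T2 (ev T2 1)) = scale T2 golden (ident T2 0)"
    using arg_cong[OF ev2_loop, of mor] unfolding ev_T2 ident_T2 rp_0
    by (simp add: cmp_def adj_def scl_def)
  show "ident T2 2 = add T2 (scale T2 (1 / golden) (comp T2 (star T2 (ev T2 1)) (ev T2 1)))
    (scale T2 (golden\<^sup>2) (comp T2 (star T2 (mor y)) (mor y)))"
    using arg_cong[OF F_decomposition, of mor] unfolding ev_T2 ident_T2 rp_12
    by (simp add: cmp_def adj_def scl_def pls_def)
qed

end

section \<open>The category of \<open>\<theta>\<close>\<close>

locale involution_category = tl_category 1 R for R +
  assumes R_eq: "R = {(DId (strands 2), DComp (DGen Cup) (DGen Cap))}"
begin

lemma A2_eq: "A2 = presented P"
  by (simp only: A2_def R_eq)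

lemma cup_cap: "Id [(), ()] = cmp cup cap"
proof -
  have "arr (DId (strands 2)) = arr (DComp (DGen Cup) (DGen Cap))"
    by (rule arr_eq) (simp add: tl_presentation_def R_eq, simp add: dpar_def)
  then show ?thesis
    by (simp add: arr_simps flip: cap_def cup_def)
qed

lemma ev_A2: "ev A2 [()] = mor cap"
proof -
  have "arr (word_ev P [()]) = cap"
    by (simp add: word_dual_def arr_simps cap_def)
  then show ?thesis
    by (metis A2_eq arr_boundary(3) presented_simps(7))
qed

lemma A2_structure:
  "ev A2 [()] \<in> hom A2 [(), ()] []"
  "comp A2 (ev A2 [()]) (star A2 (ev A2 [()])) = ident A2 []"
  "ident A2 [(), ()] = comp A2 (star A2 (ev A2 [()])) (ev A2 [()])"
proof -
  show "ev A2 [()] \<in> hom A2 [(), ()] []"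
    using cap_boundary unfolding ev_A2 unfolding A2_eq by (simp add: valid_def)
  have "mor (cmp cap (adj cap)) = mor (Id [])" "mor (Id [(), ()]) = mor (cmp (adj cap) cap)"
    by (simp_all add: loop cup_cap)
  then show "comp A2 (ev A2 [()]) (star A2 (ev A2 [()])) = ident A2 []"
    "ident A2 [(), ()] = comp A2 (star A2 (ev A2 [()])) (ev A2 [()])"
    unfolding ev_A2 unfolding A2_eq by (simp_all only: cmp_def Id_def adj_def arrow.sel)
qed

end

section \<open>Self-dual letters\<close>

locale self_dual_category = word_category C obj
  for C :: "('o, 'm, 'z) pivotal_data_scheme" (structure) and obj :: "'a list \<Rightarrow> 'o" +
  fixes cap :: "'a \<Rightarrow> ('a, 'm) arrow"
  assumes cap_boundary [simp]: "valid (cap x)" "src (cap x) = [x, x]" "tgt (cap x) = []"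
    and zigzag: "whisk [] (cap x) [x] \<bullet> whisk [x] ((cap x)\<^sup>\<star>) [] = Id [x]"
      "whisk [x] (cap x) [] \<bullet> whisk [] ((cap x)\<^sup>\<star>) [x] = Id [x]"
begin

abbreviation "cup x \<equiv> (cap x)\<^sup>\<star>"

lemma whisk_zigzag:
  "whisk a (cap x) (x # b) \<bullet> whisk (a @ [x]) (cup x) b = Id (a @ x # b)"
  "whisk (a @ [x]) (cap x) b \<bullet> whisk a (cup x) (x # b) = Id (a @ x # b)"
  using arg_cong[OF zigzag(1), of "\<lambda>f. whisk a f b"] arg_cong[OF zigzag(2), of "\<lambda>f. whisk a f b"]
  by (simp_all add: whisk_cmp)

text \<open>Frobenius reciprocity one letter at a time: \<open>Lup\<close> and \<open>Rup\<close>
  bend the first or last source letter into the target, \<open>Ldn\<close> and \<open>Rdn\<close> go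
  back. \<open>tl\<close> and \<open>butlast\<close> make them total; they are meaningful only if
  the letter in question is \<open>x\<close>.\<close>

definition Lup :: "'a \<Rightarrow> ('a, 'm) arrow \<Rightarrow> ('a, 'm) arrow" where
  "Lup x f = whisk [x] f [] \<bullet> whisk [] (cup x) (tl (src f))"

definition Ldn :: "'a \<Rightarrow> ('a, 'm) arrow \<Rightarrow> ('a, 'm) arrow" where
  "Ldn x f = whisk [] (cap x) (tl (tgt f)) \<bullet> whisk [x] f []"

definition Rup :: "'a \<Rightarrow> ('a, 'm) arrow \<Rightarrow> ('a, 'm) arrow" where
  "Rup x f = whisk [] f [x] \<bullet> whisk (butlast (src f)) (cup x) []"

definition Rdn :: "'a \<Rightarrow> ('a, 'm) arrow \<Rightarrow> ('a, 'm) arrow" where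
  "Rdn x f = whisk (butlast (tgt f)) (cap x) [] \<bullet> whisk [] f [x]"

lemma mate_boundary [simp]:
  "src (Lup x f) = tl (src f)" "tgt (Lup x f) = x # tgt f"
  "src (Ldn x f) = x # src f" "tgt (Ldn x f) = tl (tgt f)"
  "src (Rup x f) = butlast (src f)" "tgt (Rup x f) = tgt f @ [x]"
  "src (Rdn x f) = src f @ [x]" "tgt (Rdn x f) = butlast (tgt f)"
  by (simp_all add: Lup_def Ldn_def Rup_def Rdn_def)

lemma valid_mate [simp]:
  "\<lbrakk>valid f; src f \<noteq> []; hd (src f) = x\<rbrakk> \<Longrightarrow> valid (Lup x f)"
  "\<lbrakk>valid f; tgt f \<noteq> []; hd (tgt f) = x\<rbrakk> \<Longrightarrow> valid (Ldn x f)"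
  "\<lbrakk>valid f; src f \<noteq> []; last (src f) = x\<rbrakk> \<Longrightarrow> valid (Rup x f)"
  "\<lbrakk>valid f; tgt f \<noteq> []; last (tgt f) = x\<rbrakk> \<Longrightarrow> valid (Rdn x f)"
  unfolding Lup_def Ldn_def Rup_def Rdn_def by auto

lemma adj_mate:
  "\<lbrakk>valid f; src f \<noteq> []; hd (src f) = x\<rbrakk> \<Longrightarrow> (Lup x f)\<^sup>\<star> = Ldn x (f\<^sup>\<star>)"
  "\<lbrakk>valid f; tgt f \<noteq> []; hd (tgt f) = x\<rbrakk> \<Longrightarrow> (Ldn x f)\<^sup>\<star> = Lup x (f\<^sup>\<star>)"
  "\<lbrakk>valid f; src f \<noteq> []; last (src f) = x\<rbrakk> \<Longrightarrow> (Rup x f)\<^sup>\<star> = Rdn x (f\<^sup>\<star>)"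
  "\<lbrakk>valid f; tgt f \<noteq> []; last (tgt f) = x\<rbrakk> \<Longrightarrow> (Rdn x f)\<^sup>\<star> = Rup x (f\<^sup>\<star>)"
  unfolding Lup_def Ldn_def Rup_def Rdn_def by auto

lemma mate_scl [simp]:
  "\<lbrakk>valid f; src f \<noteq> []; hd (src f) = x\<rbrakk> \<Longrightarrow> Lup x (c *\<^sub>a f) = c *\<^sub>a Lup x f"
  "\<lbrakk>valid f; tgt f \<noteq> []; hd (tgt f) = x\<rbrakk> \<Longrightarrow> Ldn x (c *\<^sub>a f) = c *\<^sub>a Ldn x f"
  "\<lbrakk>valid f; src f \<noteq> []; last (src f) = x\<rbrakk> \<Longrightarrow> Rup x (c *\<^sub>a f) = c *\<^sub>a Rup x f"
  "\<lbrakk>valid f; tgt f \<noteq> []; last (tgt f) = x\<rbrakk> \<Longrightarrow> Rdn x (c *\<^sub>a f) = c *\<^sub>a Rdn x f"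
  unfolding Lup_def Ldn_def Rup_def Rdn_def by auto

lemma mate_Zero [simp]:
  "Lup x (Zero (x # u) v) = Zero u (x # v)" "Ldn x (Zero u (x # v)) = Zero (x # u) v"
  "Rup x (Zero (u @ [x]) v) = Zero u (v @ [x])" "Rdn x (Zero u (v @ [x])) = Zero (u @ [x]) v"
  by (simp_all add: Lup_def Ldn_def Rup_def Rdn_def)

lemma Lup_cmp: "\<lbrakk>valid f; valid g; tgt f = src g; src f = x # u\<rbrakk> \<Longrightarrow> Lup x (g \<bullet> f) = whisk [x] g [] \<bullet> Lup x f"
  by (simp add: Lup_def whisk_cmp cmp_assoc)

lemma Rup_cmp: "\<lbrakk>valid f; valid g; tgt f = src g; src f = u @ [x]\<rbrakk> \<Longrightarrow> Rup x (g \<bullet> f) = whisk [] g [x] \<bullet> Rup x f"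
  by (simp add: Rup_def whisk_cmp cmp_assoc)

lemma Rdn_cmp: "\<lbrakk>valid f; valid g; tgt f = src g; tgt g = u @ [x]\<rbrakk> \<Longrightarrow> Rdn x (g \<bullet> f) = Rdn x g \<bullet> whisk [] f [x]"
  by (simp add: Rdn_def whisk_cmp cmp_assoc)

lemma Lup_cmp_whisk:
  assumes "valid f" "valid k" "src f = x # u" "tgt k = u"
  shows "Lup x (f \<bullet> whisk [x] k []) = Lup x f \<bullet> k"
  using assms slide[of "cup x" k "[]" "[]" "[]"] by (simp add: Lup_def whisk_cmp cmp_assoc)

lemma Rup_cmp_whisk:
  assumes "valid f" "valid k" "src f = u @ [x]" "tgt k = u"
  shows "Rup x (f \<bullet> whisk [] k [x]) = Rup x f \<bullet> k"
  using assms slide[of k "cup x" "[]" "[]" "[]"] by (simp add: Rup_def whisk_cmp cmp_assoc)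

lemma Rdn_whisk_cmp:
  assumes "valid f" "valid k" "tgt f = u @ [x]" "src k = u"
  shows "Rdn x (whisk [] k [x] \<bullet> f) = k \<bullet> Rdn x f"
proof -
  have "(Rup x (f\<^sup>\<star> \<bullet> whisk [] (k\<^sup>\<star>) [x]))\<^sup>\<star> = (Rup x (f\<^sup>\<star>) \<bullet> k\<^sup>\<star>)\<^sup>\<star>"
    using assms by (simp add: Rup_cmp_whisk)
  then show ?thesis
    using assms by (simp add: adj_mate)
qed

lemma Lup_whisk: "\<lbrakk>valid f; src f = x # u\<rbrakk> \<Longrightarrow> Lup x (whisk [] f b) = whisk [] (Lup x f) b"
  by (simp add: Lup_def whisk_cmp)

lemma Rdn_whisk: "\<lbrakk>valid f; tgt f = u @ [x]\<rbrakk> \<Longrightarrow> Rdn x (whisk a f []) = whisk a (Rdn x f) []"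
  by (simp add: Rdn_def whisk_cmp butlast_append)

text \<open>The cap slides past \<open>f\<close> and meets the cup in a zigzag.\<close>

lemma Ldn_Lup_aux:
  assumes "valid f" "src f = x # u"
  shows "Ldn x (Lup x f) = f"
proof -
  have "Ldn x (Lup x f) = whisk [] (cap x) (tgt f) \<bullet> whisk [x, x] f [] \<bullet> whisk [x] (cup x) u"
    using assms by (simp add: Ldn_def Lup_def whisk_cmp)
  also have "\<dots> = (whisk [] (cap x) (tgt f) \<bullet> whisk [x, x] f []) \<bullet> whisk [x] (cup x) u"
    using assms by (simp add: cmp_assoc)
  also have "\<dots> = (f \<bullet> whisk [] (cap x) (x # u)) \<bullet> whisk [x] (cup x) u"
    using assms slide[of "cap x" f "[]" "[]" "[]"] by simp
  also have "\<dots> = f"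
    using assms whisk_zigzag(1)[of "[]" x u] by (simp add: cmp_assoc)
  finally show ?thesis .
qed

lemma Ldn_Lup [simp]: "\<lbrakk>valid f; src f \<noteq> []; hd (src f) = x\<rbrakk> \<Longrightarrow> Ldn x (Lup x f) = f"
  by (rule Ldn_Lup_aux[where u = "tl (src f)"]) auto

lemma Rdn_Rup_aux:
  assumes "valid f" "src f = u @ [x]"
  shows "Rdn x (Rup x f) = f"
proof -
  have "Rdn x (Rup x f) = whisk (tgt f) (cap x) [] \<bullet> whisk [] f [x, x] \<bullet> whisk u (cup x) [x]"
    using assms by (simp add: Rdn_def Rup_def whisk_cmp)
  also have "\<dots> = (whisk (tgt f) (cap x) [] \<bullet> whisk [] f [x, x]) \<bullet> whisk u (cup x) [x]"
    using assms by (simp add: cmp_assoc)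
  also have "\<dots> = (f \<bullet> whisk (u @ [x]) (cap x) []) \<bullet> whisk u (cup x) [x]"
    using assms slide[of f "cap x" "[]" "[]" "[]"] by simp
  also have "\<dots> = f"
    using assms whisk_zigzag(2)[of u x "[]"] by (simp add: cmp_assoc)
  finally show ?thesis .
qed

lemma Rdn_Rup [simp]: "\<lbrakk>valid f; src f \<noteq> []; last (src f) = x\<rbrakk> \<Longrightarrow> Rdn x (Rup x f) = f"
  by (rule Rdn_Rup_aux[where u = "butlast (src f)"]) auto

lemma Lup_Ldn_aux:
  assumes "valid f" "tgt f = x # u"
  shows "Lup x (Ldn x f) = f"
proof -
  have "Ldn x (Lup x (f\<^sup>\<star>)) = f\<^sup>\<star>"
    using assms by simp
  moreover have "(Ldn x (Lup x (f\<^sup>\<star>)))\<^sup>\<star> = Lup x (Ldn x f)"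
    using assms by (simp add: adj_mate del: Ldn_Lup)
  ultimately show ?thesis
    using assms(1) by (simp only: adj_adj)
qed

lemma Lup_Ldn [simp]: "\<lbrakk>valid f; tgt f \<noteq> []; hd (tgt f) = x\<rbrakk> \<Longrightarrow> Lup x (Ldn x f) = f"
  by (rule Lup_Ldn_aux[where u = "tl (tgt f)"]) auto

lemma Rup_Rdn_aux:
  assumes "valid f" "tgt f = u @ [x]"
  shows "Rup x (Rdn x f) = f"
proof -
  have "Rdn x (Rup x (f\<^sup>\<star>)) = f\<^sup>\<star>"
    using assms by simp
  moreover have "(Rdn x (Rup x (f\<^sup>\<star>)))\<^sup>\<star> = Rup x (Rdn x f)"
    using assms by (simp add: adj_mate del: Rdn_Rup)
  ultimately show ?thesis
    using assms(1) by (simp only: adj_adj)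
qed

lemma Rup_Rdn [simp]: "\<lbrakk>valid f; tgt f \<noteq> []; last (tgt f) = x\<rbrakk> \<Longrightarrow> Rup x (Rdn x f) = f"
  by (rule Rup_Rdn_aux[where u = "butlast (tgt f)"]) auto

text \<open>The two cups lie on disjoint strands; writing the source with both end letters ensures
  that the bent letters are different occurrences.\<close>

lemma Lup_Rup:
  assumes "valid f" "src f = x # u @ [z]"
  shows "Lup x (Rup z f) = Rup z (Lup x f)"
  using assms slide[of "cup x" "cup z" "[]" u "[]"]
  by (simp add: Lup_def Rup_def whisk_cmp cmp_assoc butlast_append)

lemma Ldn_Rdn:
  assumes "valid f" "tgt f = x # u @ [z]"
  shows "Ldn x (Rdn z f) = Rdn z (Ldn x f)"
proof -
  have "(Lup x (Rup z (f\<^sup>\<star>)))\<^sup>\<star> = (Rup z (Lup x (f\<^sup>\<star>)))\<^sup>\<star>"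
    using assms by (simp add: Lup_Rup)
  then show ?thesis
    using assms by (simp add: adj_mate)
qed

section \<open>Hom spaces of dimension zero and at most one\<close>

definition no_maps :: "'a list \<Rightarrow> 'a list \<Rightarrow> bool" where
  "no_maps u v \<longleftrightarrow> (\<forall>f \<in> Hom u v. f = Zero u v)"

text \<open>The spanning arrow may be zero: this bounds the dimension by one and names a generator,
  while nonvanishing is a separate matter.\<close>

definition spanned :: "'a list \<Rightarrow> 'a list \<Rightarrow> ('a, 'm) arrow \<Rightarrow> bool" where
  "spanned u v g \<longleftrightarrow> g \<in> Hom u v \<and> (\<forall>f \<in> Hom u v. \<exists>c. f = c *\<^sub>a g)"

lemma no_mapsD: "\<lbrakk>no_maps u v; valid f; src f = u; tgt f = v\<rbrakk> \<Longrightarrow> f = Zero u v"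
  by (simp add: no_maps_def)

lemma no_mapsI: "(\<And>f. \<lbrakk>valid f; src f = u; tgt f = v\<rbrakk> \<Longrightarrow> f = Zero u v) \<Longrightarrow> no_maps u v"
  by (simp add: no_maps_def)

lemma spannedD: "\<lbrakk>spanned u v g; valid f; src f = u; tgt f = v\<rbrakk> \<Longrightarrow> \<exists>c. f = c *\<^sub>a g"
  by (simp add: spanned_def)

lemma spanned_boundary: "spanned u v g \<Longrightarrow> valid g \<and> src g = u \<and> tgt g = v"
  by (simp add: spanned_def)

lemma no_maps_sym:
  assumes "no_maps u v"
  shows "no_maps v u"
proof -
  have "f = Zero v u" if f: "valid f" "src f = v" "tgt f = u" for f
  proof -
    have "f\<^sup>\<star> = Zero u v"
      using f by (intro no_mapsD[OF assms]) simp_all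
    then have "f\<^sup>\<star>\<^sup>\<star> = (Zero u v)\<^sup>\<star>"
      by (rule arg_cong)
    then show ?thesis
      using f by simp
  qed
  then show ?thesis
    by (simp add: no_maps_def)
qed

lemma no_maps_Lfrob: "no_maps (x # u) v \<longleftrightarrow> no_maps u (x # v)"
proof -
  have "f = Zero u (x # v)" if "no_maps (x # u) v" "valid f" "src f = u" "tgt f = x # v" for f
  proof -
    have "Ldn x f = Zero (x # u) v"
      using that(2-4) by (intro no_mapsD[OF that(1)]) simp_all
    then have "Lup x (Ldn x f) = Lup x (Zero (x # u) v)"
      by (rule arg_cong)
    then show ?thesis
      using that(2-4) by simp
  qed
  moreover have "f = Zero (x # u) v" if "no_maps u (x # v)" "valid f" "src f = x # u" "tgt f = v" for f
  proof -
    have "Lup x f = Zero u (x # v)"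
      using that(2-4) by (intro no_mapsD[OF that(1)]) simp_all
    then have "Ldn x (Lup x f) = Ldn x (Zero u (x # v))"
      by (rule arg_cong)
    then show ?thesis
      using that(2-4) by simp
  qed
  ultimately show ?thesis
    by (blast intro: no_mapsI)
qed

lemma no_maps_Rfrob: "no_maps (u @ [x]) v \<longleftrightarrow> no_maps u (v @ [x])"
proof -
  have "f = Zero u (v @ [x])" if "no_maps (u @ [x]) v" "valid f" "src f = u" "tgt f = v @ [x]" for f
  proof -
    have "Rdn x f = Zero (u @ [x]) v"
      using that(2-4) by (intro no_mapsD[OF that(1)]) simp_all
    then have "Rup x (Rdn x f) = Rup x (Zero (u @ [x]) v)"
      by (rule arg_cong)
    then show ?thesis
      using that(2-4) by simp
  qed
  moreover have "f = Zero (u @ [x]) v" if "no_maps u (v @ [x])" "valid f" "src f = u @ [x]" "tgt f = v" for f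
  proof -
    have "Rup x f = Zero u (v @ [x])"
      using that(2-4) by (intro no_mapsD[OF that(1)]) simp_all
    then have "Rdn x (Rup x f) = Rdn x (Zero u (v @ [x]))"
      by (rule arg_cong)
    then show ?thesis
      using that(2-4) by simp
  qed
  ultimately show ?thesis
    by (blast intro: no_mapsI)
qed

lemma spanned_adj: "spanned u v g \<Longrightarrow> spanned v u (g\<^sup>\<star>)"
proof -
  assume g: "spanned u v g"
  have "\<exists>c. f = c *\<^sub>a g\<^sup>\<star>" if f: "valid f" "src f = v" "tgt f = u" for f
  proof -
    obtain c where "f\<^sup>\<star> = c *\<^sub>a g"
      using spannedD[OF g, of "f\<^sup>\<star>"] f by auto
    then have "f\<^sup>\<star>\<^sup>\<star> = cnj c *\<^sub>a g\<^sup>\<star>"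
      using spanned_boundary[OF g] by simp
    then show ?thesis
      using f by auto
  qed
  then show ?thesis
    using spanned_boundary[OF g] by (auto simp: spanned_def)
qed

text \<open>An isometry \<open>i\<close> makes \<open>u\<close> a summand of \<open>w\<close>, and
  \<open>f\<close> is the restriction along \<open>i\<close> of its extension
  \<open>f \<bullet> i\<^sup>\<star>\<close>.\<close>

lemma spanned_iso:
  assumes "spanned w v g" "valid i" "src i = u" "tgt i = w" "i\<^sup>\<star> \<bullet> i = Id u"
  shows "spanned u v (g \<bullet> i)"
proof -
  have "\<exists>c. f = c *\<^sub>a (g \<bullet> i)" if f: "valid f" "src f = u" "tgt f = v" for f
  proof -
    obtain c where c: "f \<bullet> i\<^sup>\<star> = c *\<^sub>a g"
      using spannedD[OF assms(1), of "f \<bullet> i\<^sup>\<star>"] f assms by auto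
    have "f = (f \<bullet> i\<^sup>\<star>) \<bullet> i"
      using f assms by (simp add: cmp_assoc)
    also have "\<dots> = c *\<^sub>a (g \<bullet> i)"
      unfolding c using spanned_boundary[OF assms(1)] assms by simp
    finally show ?thesis ..
  qed
  then show ?thesis
    using spanned_boundary[OF assms(1)] assms by (auto simp: spanned_def)
qed

end

section \<open>Words in \<open>\<rho>\<close> and \<open>\<theta>\<close>\<close>

datatype letter = R | T

text \<open>The interface to the quotient: fusion of \<open>R R\<close> and \<open>T T\<close>, loop
  values, positivity, a simple unit and a single instance of the pivotal axiom. The norm of
  \<open>Y\<close> is left open.\<close>

locale fib_theta_category = self_dual_category C obj cap
  for C :: "('o, 'm, 'z) pivotal_data_scheme" (structure) and obj :: "letter list \<Rightarrow> 'o" and cap +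
  fixes Y :: "(letter, 'm) arrow"
  assumes positive: "\<lbrakk>valid f; f\<^sup>\<star> \<bullet> f = Zero (src f) (src f)\<rbrakk> \<Longrightarrow> f = Zero (src f) (tgt f)"
    and unit_scalars: "\<lbrakk>valid f; src f = []; tgt f = []\<rbrakk> \<Longrightarrow> \<exists>c. f = c *\<^sub>a Id []"
    and Id_Nil_ne: "Id [] \<noteq> Zero [] []"
    and cap_swap: "\<lbrakk>valid g; src g = []; tgt g = [R]\<rbrakk> \<Longrightarrow> cap R \<bullet> whisk [R] g [] = cap R \<bullet> whisk [] g [R]"
    and Y_boundary [simp]: "valid Y" "src Y = [R, R]" "tgt Y = [R]"
    and loop_R: "cap R \<bullet> cup R = golden *\<^sub>a Id []"
    and Id_RR: "Id [R, R] = (1 / golden) *\<^sub>a (cup R \<bullet> cap R) \<oplus> golden\<^sup>2 *\<^sub>a (Y\<^sup>\<star> \<bullet> Y)"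
    and loop_T: "cap T \<bullet> cup T = Id []"
    and Id_TT: "Id [T, T] = cup T \<bullet> cap T"
begin

lemma split_RR:
  assumes "valid f" "src f = a @ R # R # b"
  shows "f = (1 / golden) *\<^sub>a (f \<bullet> whisk a (cup R) b \<bullet> whisk a (cap R) b)
    \<oplus> golden\<^sup>2 *\<^sub>a (f \<bullet> whisk a (Y\<^sup>\<star>) b \<bullet> whisk a Y b)"
proof -
  have "f = f \<bullet> whisk a (Id [R, R]) b"
    using assms by simp
  also have "\<dots> = (1 / golden) *\<^sub>a (f \<bullet> whisk a (cup R) b \<bullet> whisk a (cap R) b)
    \<oplus> golden\<^sup>2 *\<^sub>a (f \<bullet> whisk a (Y\<^sup>\<star>) b \<bullet> whisk a Y b)"
    unfolding Id_RR using assms by (simp add: whisk_pls whisk_cmp cmp_pls)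
  finally show ?thesis .
qed

lemma split_TT:
  assumes "valid f" "src f = a @ T # T # b"
  shows "f = f \<bullet> whisk a (cup T) b \<bullet> whisk a (cap T) b"
proof -
  have "f = f \<bullet> whisk a (Id [T, T]) b"
    using assms by simp
  also have "\<dots> = f \<bullet> whisk a (cup T) b \<bullet> whisk a (cap T) b"
    unfolding Id_TT using assms by (simp add: whisk_cmp)
  finally show ?thesis .
qed

text \<open>Up to normalisation the cup and \<open>Y\<^sup>\<star>\<close> are the inclusions of the
  two summands of \<open>R R\<close>, so a map out of \<open>R R\<close> is determined by its
  restrictions along them.\<close>

lemma eq_Zero_RR:
  assumes "valid f" "src f = a @ R # R # b"
    and "f \<bullet> whisk a (cup R) b = Zero (a @ b) (tgt f)" "f \<bullet> whisk a (Y\<^sup>\<star>) b = Zero (a @ R # b) (tgt f)"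
  shows "f = Zero (src f) (tgt f)"
proof -
  have "f = (1 / golden) *\<^sub>a ((f \<bullet> whisk a (cup R) b) \<bullet> whisk a (cap R) b)
    \<oplus> golden\<^sup>2 *\<^sub>a ((f \<bullet> whisk a (Y\<^sup>\<star>) b) \<bullet> whisk a Y b)"
    using assms(1,2) by (subst split_RR[OF assms(1,2)]) (simp add: cmp_assoc)
  also have "\<dots> = Zero (src f) (tgt f)"
    unfolding assms(3,4) using assms(2) by simp
  finally show ?thesis .
qed

lemma no_maps_RR:
  assumes "no_maps (a @ b) v" "no_maps (a @ R # b) v"
  shows "no_maps (a @ R # R # b) v"
proof (rule no_mapsI)
  fix f
  assume f: "valid f" "src f = a @ R # R # b" "tgt f = v"
  then show "f = Zero (a @ R # R # b) v"
    using eq_Zero_RR[OF f(1,2)] no_mapsD[OF assms(1), of "f \<bullet> whisk a (cup R) b"]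
      no_mapsD[OF assms(2), of "f \<bullet> whisk a (Y\<^sup>\<star>) b"] by simp
qed

lemma no_maps_TT: assumes "no_maps (a @ b) v" shows "no_maps (a @ T # T # b) v"
proof -
  have "f = Zero (a @ T # T # b) v" if f: "valid f" "src f = a @ T # T # b" "tgt f = v" for f
  proof -
    have "f \<bullet> whisk a (cup T) b = Zero (a @ b) v"
      using no_mapsD[OF assms] f by simp
    moreover have "f = (f \<bullet> whisk a (cup T) b) \<bullet> whisk a (cap T) b"
      using f by (subst split_TT[OF f(1,2)]) (simp add: cmp_assoc)
    ultimately show ?thesis
      by simp
  qed
  then show ?thesis
    by (simp add: no_maps_def)
qed

lemma spanned_RR:
  assumes "no_maps (a @ b) v" "spanned (a @ R # b) v g"
  shows "spanned (a @ R # R # b) v (g \<bullet> whisk a Y b)"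
proof -
  note g = spanned_boundary[OF assms(2)]
  have "\<exists>c. f = c *\<^sub>a (g \<bullet> whisk a Y b)" if f: "valid f" "src f = a @ R # R # b" "tgt f = v" for f
  proof -
    obtain c where c: "f \<bullet> whisk a (Y\<^sup>\<star>) b = c *\<^sub>a g"
      using spannedD[OF assms(2), of "f \<bullet> whisk a (Y\<^sup>\<star>) b"] f by auto
    have z: "f \<bullet> whisk a (cup R) b = Zero (a @ b) v"
      using no_mapsD[OF assms(1)] f by simp
    have "f = (1 / golden) *\<^sub>a ((f \<bullet> whisk a (cup R) b) \<bullet> whisk a (cap R) b)
      \<oplus> golden\<^sup>2 *\<^sub>a ((f \<bullet> whisk a (Y\<^sup>\<star>) b) \<bullet> whisk a Y b)"
      using f by (subst split_RR[OF f(1,2)]) (simp add: cmp_assoc)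
    also have "\<dots> = (golden\<^sup>2 * c) *\<^sub>a (g \<bullet> whisk a Y b)"
      unfolding z c using g by simp
    finally show ?thesis ..
  qed
  then show ?thesis
    using g by (auto simp: spanned_def)
qed

lemma spanned_TT:
  assumes "spanned (a @ b) v g"
  shows "spanned (a @ T # T # b) v (g \<bullet> whisk a (cap T) b)"
  by (rule spanned_iso[OF assms]) (simp_all add: Id_TT[symmetric] flip: whisk_cmp)

lemma Lup_cap_T: "Lup T (whisk [] (cap T) u) = Id (T # u)"
  using whisk_zigzag(2)[of "[]" T u] by (simp add: Lup_def)

lemma Rup_cap_T: "Rup T (whisk u (cap T) []) = Id (u @ [T])"
  using whisk_zigzag(1)[of u T "[]"] by (simp add: Rup_def butlast_append)

text \<open>\<open>T\<close> is invertible: bending one of its copies over produces a pair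
  \<open>T T\<close>, which cancels.\<close>

lemma no_maps_strip: "no_maps u v \<Longrightarrow> no_maps (T # u) (T # v)" "no_maps u v \<Longrightarrow> no_maps (u @ [T]) (v @ [T])"
  using no_maps_TT[of "[]" u v] no_maps_TT[of u "[]" v] no_maps_Lfrob[of T "T # u" v]
    no_maps_Rfrob[of "u @ [T]" T v] by simp_all

lemma spanned_strip_right:
  assumes g: "spanned u v g"
  shows "spanned (u @ [T]) (v @ [T]) (whisk [] g [T])"
proof -
  note gb = spanned_boundary[OF g]
  have "\<exists>c. f = c *\<^sub>a whisk [] g [T]" if f: "valid f" "src f = u @ [T]" "tgt f = v @ [T]" for f
  proof -
    obtain c where c: "Rdn T f = c *\<^sub>a (g \<bullet> whisk u (cap T) [])"
      using spannedD[OF spanned_TT[of u "[]" v g], of "Rdn T f"] f g by auto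
    have "f = Rup T (Rdn T f)"
      using f by simp
    also have "\<dots> = c *\<^sub>a (whisk [] g [T] \<bullet> Rup T (whisk u (cap T) []))"
      unfolding c using gb by (simp add: Rup_cmp[where u = "u @ [T]"])
    also have "\<dots> = c *\<^sub>a whisk [] g [T]"
      using gb by (simp add: Rup_cap_T)
    finally show ?thesis ..
  qed
  then show ?thesis
    using gb by (auto simp: spanned_def)
qed

lemma spanned_strip_left:
  assumes g: "spanned u v g"
  shows "spanned (T # u) (T # v) (whisk [T] g [])"
proof -
  note gb = spanned_boundary[OF g]
  have "\<exists>c. f = c *\<^sub>a whisk [T] g []" if f: "valid f" "src f = T # u" "tgt f = T # v" for f
  proof -
    obtain c where c: "Ldn T f = c *\<^sub>a (g \<bullet> whisk [] (cap T) u)"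
      using spannedD[OF spanned_TT[of "[]" u v g], of "Ldn T f"] f g by auto
    have "f = Lup T (Ldn T f)"
      using f by simp
    also have "\<dots> = c *\<^sub>a (whisk [T] g [] \<bullet> Lup T (whisk [] (cap T) u))"
      unfolding c using gb by (simp add: Lup_cmp)
    also have "\<dots> = c *\<^sub>a whisk [T] g []"
      using gb by (simp add: Lup_cap_T)
    finally show ?thesis ..
  qed
  then show ?thesis
    using gb by (auto simp: spanned_def)
qed

lemma spanned_strip_replicate:
  "spanned u v g \<Longrightarrow> spanned (u @ replicate k T) (v @ replicate k T) (whisk [] g (replicate k T))"
proof (induction k)
  case 0
  then show ?case
    using spanned_boundary[OF 0] by simp
next
  case (Suc k)
  then show ?case
    using spanned_strip_right[OF Suc.IH] spanned_boundary[OF Suc.prems]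
    by (simp add: replicate_append_same)
qed

text \<open>Closing the first strand turns the identity into the loop value, which is nonzero, times
  the identity of the shorter word.\<close>

lemma Id_ne_Zero: "Id w \<noteq> Zero w w"
proof (induction w)
  case Nil
  then show ?case
    by (rule Id_Nil_ne)
next
  case (Cons x w)
  show ?case
  proof
    assume "Id (x # w) = Zero (x # w) (x # w)"
    then have "whisk [] (cap x) w \<bullet> whisk [x] (Id (x # w)) [] \<bullet> whisk [] (cup x) w
      = whisk [] (cap x) w \<bullet> whisk [x] (Zero (x # w) (x # w)) [] \<bullet> whisk [] (cup x) w"
      by simp
    then have 1: "whisk [] (cap x \<bullet> cup x) w = Zero w w"
      by (simp add: whisk_cmp del: whisk_Id) simp
    obtain c where "c \<noteq> 0" "cap x \<bullet> cup x = c *\<^sub>a Id []"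
      using loop_R loop_T golden_ne(1) by (cases x) (auto intro: that[of golden] that[of 1])
    with 1 have "c *\<^sub>a Id w = Zero w w"
      by simp
    then show False
      using scl_eq_Zero \<open>c \<noteq> 0\<close> Cons by (metis valid_Id)
  qed
qed

lemma scalar_unique: "a *\<^sub>a Id w = b *\<^sub>a Id w \<Longrightarrow> a = b"
  using scl_cancel[of "Id w"] Id_ne_Zero by simp

end

section \<open>Maps between alternating words\<close>

context fib_theta_category
begin

lemma golden_one: "golden \<noteq> 1"
  using golden_square by auto

lemma golden_reciprocal: "(golden - 1) * golden = 1"
  using golden_square by (simp add: power2_eq_square algebra_simps)

lemma adj_zero_imp:
  assumes "valid f" "f \<bullet> f\<^sup>\<star> = Zero (tgt f) (tgt f)"
  shows "f = Zero (src f) (tgt f)"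
proof -
  have "f\<^sup>\<star> = Zero (tgt f) (src f)"
    using positive[of "f\<^sup>\<star>"] assms by simp
  then have "f\<^sup>\<star>\<^sup>\<star> = (Zero (tgt f) (src f))\<^sup>\<star>"
    by (rule arg_cong)
  then show ?thesis
    using assms by simp
qed

text \<open>Only here pivotality enters.\<close>

lemma trace_rank_one:
  assumes g: "valid g" "src g = []" "tgt g = [R]"
  shows "cap R \<bullet> whisk [] (g \<bullet> g\<^sup>\<star>) [R] \<bullet> cup R = g\<^sup>\<star> \<bullet> g"
proof -
  let ?k = "whisk [R] (g\<^sup>\<star>) [] \<bullet> cup R"
  have "(cap R \<bullet> whisk [R] g [])\<^sup>\<star> = (cap R \<bullet> whisk [] g [R])\<^sup>\<star>"
    using cap_swap[OF g] by (rule arg_cong)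
  then have k: "whisk [] (g\<^sup>\<star>) [R] \<bullet> cup R = ?k"
    using g by simp
  have "cap R \<bullet> whisk [] (g \<bullet> g\<^sup>\<star>) [R] \<bullet> cup R = cap R \<bullet> whisk [] g [R] \<bullet> whisk [] (g\<^sup>\<star>) [R] \<bullet> cup R"
    using g by (simp add: whisk_cmp cmp_assoc)
  also have "\<dots> = cap R \<bullet> whisk [] g [R] \<bullet> whisk [] ?k []"
    unfolding k using g by simp
  also have "whisk [] g [R] \<bullet> whisk [] ?k [] = whisk [R] ?k [] \<bullet> g"
    using g slide[of g ?k "[]" "[]" "[]"] by simp
  also have "cap R \<bullet> whisk [R] ?k [] \<bullet> g = (cap R \<bullet> whisk [R, R] (g\<^sup>\<star>) []) \<bullet> whisk [R] (cup R) [] \<bullet> g"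
    using g by (simp add: whisk_cmp cmp_assoc)
  also have "cap R \<bullet> whisk [R, R] (g\<^sup>\<star>) [] = g\<^sup>\<star> \<bullet> whisk [] (cap R) [R]"
    using g slide[of "cap R" "g\<^sup>\<star>" "[]" "[]" "[]"] by simp
  also have "(g\<^sup>\<star> \<bullet> whisk [] (cap R) [R]) \<bullet> whisk [R] (cup R) [] \<bullet> g
    = g\<^sup>\<star> \<bullet> (whisk [] (cap R) [R] \<bullet> whisk [R] (cup R) []) \<bullet> g"
    using g by (simp add: cmp_assoc)
  also have "\<dots> = g\<^sup>\<star> \<bullet> g"
    using g by (simp add: zigzag)
  finally show ?thesis .
qed

text \<open>A projection \<open>p\<close> on \<open>R\<close> of trace \<open>1 / golden\<close> would give a summand of \<open>R R\<close> whose complement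
  in \<open>p \<otimes> R\<close> has partial trace zero.\<close>

lemma projection_rank_one:
  assumes p: "valid p" "src p = [R]" "tgt p = [R]" "p \<bullet> p = p" "p\<^sup>\<star> = p"
    and tr: "cap R \<bullet> whisk [] p [R] \<bullet> cup R = (golden - 1) *\<^sub>a Id []"
  shows "whisk [] p [R] = golden *\<^sub>a (whisk [] p [R] \<bullet> cup R \<bullet> cap R \<bullet> whisk [] p [R])"
proof -
  let ?P = "whisk [] p [R]"
  define v where "v = ?P \<bullet> cup R"
  have v [simp]: "valid v" "src v = []" "tgt v = [R, R]"
    using p by (simp_all add: v_def)
  have PP: "?P \<bullet> ?P = ?P" "?P\<^sup>\<star> = ?P"
    using p by (simp_all flip: whisk_cmp)
  have Pv: "?P \<bullet> v = v" "v\<^sup>\<star> \<bullet> ?P = v\<^sup>\<star>"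
    using p PP by (simp_all add: v_def cmp_assoc) (simp add: PP(1) flip: cmp_assoc)
  have vv: "v\<^sup>\<star> \<bullet> v = (golden - 1) *\<^sub>a Id []"
  proof -
    have "v\<^sup>\<star> \<bullet> v = cap R \<bullet> (?P \<bullet> ?P) \<bullet> cup R"
      using p by (simp add: v_def PP(2) cmp_assoc)
    then show ?thesis
      unfolding PP(1) tr .
  qed
  \<comment> \<open>The squared norm of \<open>v\<close> is \<open>golden - 1\<close>, the inverse
    of \<open>golden\<close>. Hence \<open>golden *\<^sub>a (v \<bullet> v\<^sup>\<star>)\<close> is
    a projection below \<open>?P\<close>, and \<open>z\<close> is its complement there.\<close>
  define z where "z = ?P \<oplus> (- golden) *\<^sub>a (v \<bullet> v\<^sup>\<star>)"
  have z [simp]: "valid z" "src z = [R, R]" "tgt z = [R, R]"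
    using p by (simp_all add: z_def)
  have zs: "z\<^sup>\<star> = z"
    using p PP golden_ne by (simp add: z_def)
  have zz: "z \<bullet> z = z"
  proof -
    have "z \<bullet> v = v \<oplus> (- golden) *\<^sub>a (v \<bullet> v\<^sup>\<star> \<bullet> v)"
      using p by (simp add: z_def pls_cmp Pv cmp_assoc)
    also have "\<dots> = 1 *\<^sub>a v \<oplus> (- (golden * (golden - 1))) *\<^sub>a v"
      unfolding vv by simp
    also have "\<dots> = Zero [] [R, R]"
      using golden_reciprocal scl_add_left[of v 1 "-1"] by (simp add: mult.commute scl_0)
    finally have zv: "z \<bullet> v = Zero [] [R, R]" .
    have "z \<bullet> ?P = z"
      using p PP by (simp add: z_def pls_cmp Pv cmp_assoc)
    moreover have "z \<bullet> z = z \<bullet> ?P \<oplus> (- golden) *\<^sub>a ((z \<bullet> v) \<bullet> v\<^sup>\<star>)"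
      using p by (subst (2) z_def) (simp add: cmp_pls cmp_assoc)
    ultimately show ?thesis
      unfolding zv by simp
  qed
  have E: "whisk [R] (cap R) [] \<bullet> whisk [] z [R] \<bullet> whisk [R] (cup R) [] = Zero [R] [R]"
  proof -
    have sl: "whisk [R] (cap R) [] \<bullet> whisk [] p [R, R] = p \<bullet> whisk [R] (cap R) []"
      using p slide[of p "cap R" "[]" "[]" "[]"] by simp
    have 1: "whisk [R] (cap R) [] \<bullet> whisk [] ?P [R] \<bullet> whisk [R] (cup R) [] = golden *\<^sub>a p"
    proof -
      have "whisk [R] (cap R) [] \<bullet> whisk [] ?P [R] \<bullet> whisk [R] (cup R) []
        = (whisk [R] (cap R) [] \<bullet> whisk [] p [R, R]) \<bullet> whisk [R] (cup R) []"
        using p by (simp add: cmp_assoc)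
      also have "\<dots> = p \<bullet> whisk [R] (cap R \<bullet> cup R) []"
        unfolding sl using p by (simp add: cmp_assoc whisk_cmp)
      also have "\<dots> = golden *\<^sub>a p"
        unfolding loop_R using p by simp
      finally show ?thesis .
    qed
    have 2: "whisk [R] (cap R) [] \<bullet> whisk [] v [R] = p"
    proof -
      have "whisk [R] (cap R) [] \<bullet> whisk [] v [R]
        = (whisk [R] (cap R) [] \<bullet> whisk [] p [R, R]) \<bullet> whisk [] (cup R) [R]"
        using p by (simp add: cmp_assoc whisk_cmp v_def)
      also have "\<dots> = p"
        unfolding sl using p by (simp add: cmp_assoc zigzag)
      finally show ?thesis .
    qed
    have 3: "whisk [] (v\<^sup>\<star>) [R] \<bullet> whisk [R] (cup R) [] = p"
      using arg_cong[OF 2, of adj] p by simp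
    have "whisk [R] (cap R) [] \<bullet> whisk [] (v \<bullet> v\<^sup>\<star>) [R] \<bullet> whisk [R] (cup R) []
      = (whisk [R] (cap R) [] \<bullet> whisk [] v [R]) \<bullet> (whisk [] (v\<^sup>\<star>) [R] \<bullet> whisk [R] (cup R) [])"
      by (simp add: whisk_cmp cmp_assoc)
    also have "\<dots> = p"
      unfolding 2 3 using p by simp
    finally have 4: "whisk [R] (cap R) [] \<bullet> whisk [] (v \<bullet> v\<^sup>\<star>) [R] \<bullet> whisk [R] (cup R) [] = p" .
    have "whisk [R] (cap R) [] \<bullet> whisk [] z [R] \<bullet> whisk [R] (cup R) []
      = whisk [R] (cap R) [] \<bullet> whisk [] ?P [R] \<bullet> whisk [R] (cup R) []
      \<oplus> (- golden) *\<^sub>a (whisk [R] (cap R) [] \<bullet> whisk [] (v \<bullet> v\<^sup>\<star>) [R] \<bullet> whisk [R] (cup R) [])"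
      using p by (simp add: z_def whisk_pls cmp_pls pls_cmp)
    also have "\<dots> = golden *\<^sub>a p \<oplus> (- golden) *\<^sub>a p"
      unfolding 1 4 ..
    also have "\<dots> = Zero [R] [R]"
      using p scl_add_left[of p golden "- golden"] by (simp add: scl_0)
    finally show ?thesis .
  qed
  \<comment> \<open>Since \<open>z\<close> is a projection, its partial trace is the square of
    \<open>z\<close> with the last strand bent up, and positivity applies to the bent arrow.\<close>
  have "(Rup R z)\<^sup>\<star> \<bullet> Rup R z = whisk [R] (cap R) [] \<bullet> whisk [] (z\<^sup>\<star> \<bullet> z) [R] \<bullet> whisk [R] (cup R) []"
    by (simp add: Rup_def whisk_cmp cmp_assoc)
  then have "Rup R z = Zero [R] [R, R, R]"
    using positive[of "Rup R z"] by (simp add: zs zz E)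
  then have "Rdn R (Rup R z) = Rdn R (Zero [R] ([R, R] @ [R]))"
    by simp
  then have "z = Zero [R, R] [R, R]"
    by (simp del: append.simps) simp
  then have "?P \<oplus> (- golden) *\<^sub>a (v \<bullet> v\<^sup>\<star>) \<oplus> golden *\<^sub>a (v \<bullet> v\<^sup>\<star>) = golden *\<^sub>a (v \<bullet> v\<^sup>\<star>)"
    by (simp add: z_def)
  moreover have "?P \<oplus> (- golden) *\<^sub>a (v \<bullet> v\<^sup>\<star>) \<oplus> golden *\<^sub>a (v \<bullet> v\<^sup>\<star>) = ?P"
    using p scl_add_left[of "v \<bullet> v\<^sup>\<star>" "- golden" golden, symmetric] by (simp add: pls_assoc scl_0)
  ultimately have "?P = golden *\<^sub>a (v \<bullet> v\<^sup>\<star>)"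
    by simp
  then show ?thesis
    using p by (simp add: v_def PP cmp_assoc)
qed

text \<open>A nonzero \<open>g\<close> would split the unit off \<open>R\<close>, leaving a
  complement \<open>p\<close> of trace \<open>golden - 1\<close>. By
  \<open>projection_rank_one\<close> the projection \<open>p\<close> tensored with \<open>R\<close>
  factors through the unit; compressing the factor \<open>R\<close> by \<open>g\<close> then makes
  \<open>p\<close> itself factor through the unit. But a projection on \<open>R\<close> of that kind
  has trace 1, which would force \<open>golden = 2\<close>.\<close>

lemma no_maps_R: "no_maps [] [R]"
proof (rule no_mapsI)
  fix g
  assume g: "valid g" "src g = []" "tgt g = [R]"
  show "g = Zero [] [R]"
  proof (rule ccontr)
    assume g0: "g \<noteq> Zero [] [R]"
    obtain c where c: "g\<^sup>\<star> \<bullet> g = c *\<^sub>a Id []"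
      using unit_scalars[of "g\<^sup>\<star> \<bullet> g"] g by auto
    have c0: "c \<noteq> 0"
    proof
      assume "c = 0"
      then have "g\<^sup>\<star> \<bullet> g = Zero (src g) (src g)"
        using c g by (simp add: scl_0)
      then show False
        using positive[OF g(1)] g g0 by simp
    qed
    have cr: "cnj c = c"
    proof -
      have "(g\<^sup>\<star> \<bullet> g)\<^sup>\<star> = g\<^sup>\<star> \<bullet> g"
        using g by simp
      then have "cnj c *\<^sub>a Id [] = c *\<^sub>a Id []"
        unfolding c by simp
      then show ?thesis
        by (rule scalar_unique)
    qed
    define p where "p = Id [R] \<oplus> (- (1 / c)) *\<^sub>a (g \<bullet> g\<^sup>\<star>)"
    have p [simp]: "valid p" "src p = [R]" "tgt p = [R]"
      using g by (simp_all add: p_def)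
    have pg: "p \<bullet> g = Zero [] [R]"
    proof -
      have "p \<bullet> g = g \<oplus> (- (1 / c)) *\<^sub>a (g \<bullet> (g\<^sup>\<star> \<bullet> g))"
        using g by (simp add: p_def pls_cmp cmp_assoc)
      then show ?thesis
        unfolding c using g c0 scl_add_left[of g 1 "-1", symmetric] by (simp add: scl_0)
    qed
    have pp: "p \<bullet> p = p"
    proof -
      have "p \<bullet> p = p \<oplus> (- (1 / c)) *\<^sub>a ((p \<bullet> g) \<bullet> g\<^sup>\<star>)"
        using g by (subst (2) p_def) (simp add: cmp_pls cmp_assoc)
      then show ?thesis
        unfolding pg using g by simp
    qed
    have ps: "p\<^sup>\<star> = p"
      using g cr by (simp add: p_def)
    have tr: "cap R \<bullet> whisk [] p [R] \<bullet> cup R = (golden - 1) *\<^sub>a Id []"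
    proof -
      have "cap R \<bullet> whisk [] p [R] \<bullet> cup R
        = cap R \<bullet> cup R \<oplus> (- (1 / c)) *\<^sub>a (cap R \<bullet> whisk [] (g \<bullet> g\<^sup>\<star>) [R] \<bullet> cup R)"
        using g by (simp add: p_def whisk_pls pls_cmp cmp_pls)
      also have "\<dots> = golden *\<^sub>a Id [] \<oplus> (- 1) *\<^sub>a Id []"
        unfolding trace_rank_one[OF g] c loop_R using c0 by simp
      also have "\<dots> = (golden - 1) *\<^sub>a Id []"
        using scl_add_left[of "Id []" golden "- 1"] by simp
      finally show ?thesis .
    qed
    note P = projection_rank_one[OF p pp ps tr]
    \<comment> \<open>The unit vector of \<open>p\<close> and \<open>R\<close>, with its second
      strand closed off by \<open>g\<close>; a multiple of
      \<open>k \<bullet> k\<^sup>\<star>\<close> turns out to be \<open>p\<close>.\<close>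
    define k where "k = whisk [R] (g\<^sup>\<star>) [] \<bullet> whisk [] p [R] \<bullet> cup R"
    have k [simp]: "valid k" "src k = []" "tgt k = [R]"
      using g by (simp_all add: k_def)
    have ks: "k\<^sup>\<star> = cap R \<bullet> whisk [] p [R] \<bullet> whisk [R] g []"
      using g by (simp add: k_def ps cmp_assoc)
    have sl: "whisk [] p [R] \<bullet> whisk [R] g [] = whisk [R] g [] \<bullet> p"
      using g slide[of p g "[]" "[]" "[]"] by simp
    have "whisk [R] (g\<^sup>\<star>) [] \<bullet> whisk [] p [R] \<bullet> whisk [R] g [] = c *\<^sub>a p"
    proof -
      have "whisk [R] (g\<^sup>\<star>) [] \<bullet> whisk [] p [R] \<bullet> whisk [R] g [] = whisk [R] (g\<^sup>\<star> \<bullet> g) [] \<bullet> p"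
        unfolding sl using g by (simp add: whisk_cmp cmp_assoc)
      then show ?thesis
        unfolding c by simp
    qed
    moreover have "whisk [R] (g\<^sup>\<star>) [] \<bullet> whisk [] p [R] \<bullet> whisk [R] g [] = golden *\<^sub>a (k \<bullet> k\<^sup>\<star>)"
      unfolding ks using g by (subst P) (simp add: k_def cmp_assoc)
    ultimately have cp: "c *\<^sub>a p = golden *\<^sub>a (k \<bullet> k\<^sup>\<star>)"
      by simp
    obtain d where d: "k\<^sup>\<star> \<bullet> k = d *\<^sub>a Id []"
      using unit_scalars[of "k\<^sup>\<star> \<bullet> k"] by auto
    have trc: "(c * (golden - 1)) *\<^sub>a Id [] = (golden * d) *\<^sub>a Id []"
    proof -
      have "(c * (golden - 1)) *\<^sub>a Id [] = cap R \<bullet> whisk [] (c *\<^sub>a p) [R] \<bullet> cup R"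
        using tr by simp
      also have "\<dots> = golden *\<^sub>a (cap R \<bullet> whisk [] (k \<bullet> k\<^sup>\<star>) [R] \<bullet> cup R)"
        unfolding cp by simp
      also have "\<dots> = (golden * d) *\<^sub>a Id []"
        using trace_rank_one[of k] d by simp
      finally show ?thesis .
    qed
    have sq: "(c * c) *\<^sub>a p = (golden * d * c) *\<^sub>a p"
    proof -
      have "(c * c) *\<^sub>a p = (c *\<^sub>a p) \<bullet> (c *\<^sub>a p)"
        by (simp add: pp)
      also have "\<dots> = (golden * golden) *\<^sub>a (k \<bullet> (k\<^sup>\<star> \<bullet> k) \<bullet> k\<^sup>\<star>)"
        unfolding cp by (simp add: cmp_assoc)
      also have "\<dots> = (golden * d) *\<^sub>a golden *\<^sub>a (k \<bullet> k\<^sup>\<star>)"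
        unfolding d by (simp add: mult_ac)
      also have "\<dots> = (golden * d * c) *\<^sub>a p"
        unfolding cp[symmetric] by simp
      finally show ?thesis .
    qed
    have p0: "p \<noteq> Zero [R] [R]"
    proof
      assume "p = Zero [R] [R]"
      then have "(golden - 1) *\<^sub>a Id [] = 0 *\<^sub>a Id []"
        using tr by (simp add: scl_0)
      then have "golden - 1 = 0"
        by (rule scalar_unique)
      then show False
        using golden_one by simp
    qed
    \<comment> \<open>The squared norm \<open>d\<close> of \<open>k\<close> is now known twice, from
      idempotence of \<open>p\<close> and from its trace.\<close>
    have "c * c = golden * d * c"
      using scl_cancel[OF p(1) _ sq] p0 by simp
    then have "c = golden * d"
      using c0 by simp
    moreover have "c * (golden - 1) = golden * d"
      using trc by (rule scalar_unique)
    ultimately have "golden - 1 = 1"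
      using c0 by simp
    then have "golden = 2"
      by (simp add: diff_eq_eq)
    then have "(2 :: complex)\<^sup>2 = 2 + 1"
      using golden_square by metis
    then show False
      by simp
  qed
qed

text \<open>Bending the letter \<open>R\<close> turns endomorphisms of \<open>R e\<close> into maps
  from \<open>R R e\<close> to \<open>e\<close>, that is, into endomorphisms of \<open>e\<close>
  together with maps from \<open>R e\<close> to \<open>e\<close>.\<close>

lemma spanned_Id_R:
  assumes e: "spanned e e (Id e)" and n: "no_maps (R # e) e"
  shows "spanned (R # e) (R # e) (Id (R # e))"
proof -
  have "\<exists>c. f = c *\<^sub>a Id (R # e)" if f: "valid f" "src f = R # e" "tgt f = R # e" for f
  proof -
    have z: "Ldn R f \<bullet> whisk [] (Y\<^sup>\<star>) e = Zero (R # e) e"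
      using f by (intro no_mapsD[OF n]) simp_all
    obtain c where c: "Ldn R f \<bullet> whisk [] (cup R) e = c *\<^sub>a Id e"
      using spannedD[OF e, of "Ldn R f \<bullet> whisk [] (cup R) e"] f by auto
    have "Ldn R f = (1 / golden) *\<^sub>a ((Ldn R f \<bullet> whisk [] (cup R) e) \<bullet> whisk [] (cap R) e)
      \<oplus> golden\<^sup>2 *\<^sub>a ((Ldn R f \<bullet> whisk [] (Y\<^sup>\<star>) e) \<bullet> whisk [] Y e)"
      using f by (subst split_RR[of "Ldn R f" "[]" e]) (simp_all add: cmp_assoc)
    also have "\<dots> = (c / golden) *\<^sub>a whisk [] (cap R) e"
      unfolding z c by simp
    finally have "Lup R (Ldn R f) = Lup R ((c / golden) *\<^sub>a whisk [] (cap R) e)"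
      by (rule arg_cong)
    moreover have "Lup R (whisk [] (cap R) e) = Id (R # e)"
      using whisk_zigzag(2)[of "[]" R e] by (simp add: Lup_def)
    ultimately have "f = (c / golden) *\<^sub>a Id (R # e)"
      using f by simp
    then show ?thesis ..
  qed
  then show ?thesis
    by (auto simp: spanned_def)
qed

definition iso_words :: "letter list \<Rightarrow> letter list \<Rightarrow> bool" where
  "iso_words u v \<longleftrightarrow> (\<exists>f \<in> Hom u v. \<exists>g \<in> Hom v u. g \<bullet> f = Id u \<and> f \<bullet> g = Id v)"

text \<open>Schur's lemma without kernels or images: for a nonzero \<open>f\<close>, positivity
  makes the scalar \<open>f\<^sup>\<star> \<bullet> f\<close> nonzero, associativity makes it agree
  with the scalar \<open>f \<bullet> f\<^sup>\<star>\<close>, and so a rescaled adjoint inverts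
  \<open>f\<close>.\<close>

lemma no_maps_schur:
  assumes u: "spanned u u (Id u)" and v: "spanned v v (Id v)" and n: "\<not> iso_words u v"
  shows "no_maps u v"
proof (rule no_mapsI, rule ccontr)
  fix f
  assume f: "valid f" "src f = u" "tgt f = v" and f0: "f \<noteq> Zero u v"
  obtain c where c: "f\<^sup>\<star> \<bullet> f = c *\<^sub>a Id u"
    using spannedD[OF u, of "f\<^sup>\<star> \<bullet> f"] f by auto
  obtain d where d: "f \<bullet> f\<^sup>\<star> = d *\<^sub>a Id v"
    using spannedD[OF v, of "f \<bullet> f\<^sup>\<star>"] f by auto
  have "c \<noteq> 0"
  proof
    assume "c = 0"
    then have "f\<^sup>\<star> \<bullet> f = Zero (src f) (src f)"
      using c f by (simp add: scl_0)
    then show False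
      using positive[OF f(1)] f f0 by simp
  qed
  moreover have "c *\<^sub>a f = d *\<^sub>a f"
  proof -
    have "c *\<^sub>a f = f \<bullet> (f\<^sup>\<star> \<bullet> f)"
      unfolding c using f by simp
    also have "\<dots> = (f \<bullet> f\<^sup>\<star>) \<bullet> f"
      using f by (simp add: cmp_assoc)
    also have "\<dots> = d *\<^sub>a f"
      unfolding d using f by simp
    finally show ?thesis .
  qed
  then have "c = d"
    using scl_cancel[of f c d] f f0 by simp
  ultimately have "((1 / c) *\<^sub>a f\<^sup>\<star>) \<bullet> f = Id u" "f \<bullet> ((1 / c) *\<^sub>a f\<^sup>\<star>) = Id v"
    using c d f by simp_all
  moreover have "f \<in> Hom u v" "(1 / c) *\<^sub>a f\<^sup>\<star> \<in> Hom v u"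
    using f by simp_all
  ultimately show False
    using n unfolding iso_words_def by blast
qed

text \<open>Simplicity of \<open>R\<close> makes the square of \<open>Y\<close> a scalar. If
  \<open>Y\<close> vanished, the identity of \<open>R R\<close> would factor through the unit, and
  closing the second strand would give \<open>golden = 1 / golden\<close>.\<close>

lemma Y_nonzero: obtains N where "N \<noteq> 0" "Y \<bullet> Y\<^sup>\<star> = N *\<^sub>a Id [R]"
proof -
  have "spanned [] [] (Id [])"
    using unit_scalars by (auto simp: spanned_def)
  then have "spanned [R] [R] (Id [R])"
    using spanned_Id_R[of "[]"] no_maps_sym[OF no_maps_R] by simp
  then obtain N where N: "Y \<bullet> Y\<^sup>\<star> = N *\<^sub>a Id [R]"
    using spannedD[of "[R]" "[R]" "Id [R]" "Y \<bullet> Y\<^sup>\<star>"] by auto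
  moreover have "N \<noteq> 0"
  proof
    assume "N = 0"
    then have "Y = Zero [R, R] [R]"
      using adj_zero_imp[of Y] N by (simp add: scl_0)
    then have "Id [R, R] = (1 / golden) *\<^sub>a (cup R \<bullet> cap R)"
      using Id_RR by simp
    then have "whisk [R] (cap R) [] \<bullet> whisk [] (Id [R, R]) [R] \<bullet> whisk [R] (cup R) []
      = whisk [R] (cap R) [] \<bullet> whisk [] ((1 / golden) *\<^sub>a (cup R \<bullet> cap R)) [R] \<bullet> whisk [R] (cup R) []"
      by simp
    then have "whisk [R] (cap R \<bullet> cup R) [] = (1 / golden) *\<^sub>a
      ((whisk [R] (cap R) [] \<bullet> whisk [] (cup R) [R]) \<bullet> (whisk [] (cap R) [R] \<bullet> whisk [R] (cup R) []))"
      by (simp add: whisk_cmp cmp_assoc)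
    then have "golden *\<^sub>a Id [R] = (1 / golden) *\<^sub>a Id [R]"
      unfolding zigzag loop_R by simp
    then have "golden = 1 / golden"
      by (rule scalar_unique)
    then have "golden * golden = 1"
      using golden_ne by (simp add: field_simps)
    then show False
      using golden_square golden_ne by (simp add: power2_eq_square)
  qed
  ultimately show ?thesis
    by (rule that[rotated])
qed

end

section \<open>Simplicity of the alternating words\<close>

definition eta :: "nat \<Rightarrow> letter list" where
  "eta j = word_power [T, R] j"

lemma eta_simps [simp]: "eta 0 = []" "eta (Suc j) = T # R # eta j"
  by (simp_all add: eta_def word_power_def)

lemma eta_Suc_right: "eta j @ [T, R] = T # R # eta j"
  by (induction j) simp_all

lemma word_power_eta: "word_power [R, T] (Suc j) = R # eta j @ [T]" "word_power [T, R] (Suc j) = T # R # eta j"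
proof -
  show "word_power [T, R] (Suc j) = T # R # eta j"
    by (simp add: eta_def word_power_def)
  show "word_power [R, T] (Suc j) = R # eta j @ [T]"
    by (induction j) (simp_all add: eta_def word_power_def)
qed

text \<open>Here \<open>k\<close> is \<open>n - 1\<close>. Each Fourier transform consists of two
  bends; in \<open>rotate_T\<close> and \<open>rotate_R\<close> one of them has been moved to the
  side of the adjoint.\<close>

locale at_category = fib_theta_category +
  fixes k :: nat and U :: "(letter, 'b) arrow" and \<omega> :: complex
  assumes U_valid [simp]: "valid U" and U_src: "src U = word_power [R, T] (Suc k)"
    and U_tgt: "tgt U = word_power [T, R] (Suc k)"
    and U_unitary: "U\<^sup>\<star> \<bullet> U = Id (src U)" "U \<bullet> U\<^sup>\<star> = Id (tgt U)"
    and not_iso: "m < k \<Longrightarrow> \<not> iso_words (word_power [R, T] (Suc m)) (word_power [T, R] (Suc m))"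
    and rotate_T: "Rup T U = Lup T (U\<^sup>\<star>)"
    and rotate_R: "Lup R U = \<omega> *\<^sub>a Rup R (U\<^sup>\<star>)"
begin

text \<open>The two claims support each other in the induction. For a map from
  \<open>R # eta (Suc j)\<close> to \<open>eta (Suc j)\<close>, bending the last \<open>R\<close>
  over produces \<open>R R\<close> in the target. Its unit part is excluded by the induction
  hypothesis; its \<open>R\<close> part would be a map between the two alternating words of length
  \<open>2 * j + 2\<close>, excluded by Schur's lemma and the minimality of
  \<open>n\<close>.\<close>

lemma alternating_simple:
  "j \<le> k \<Longrightarrow> no_maps (R # eta j) (eta j) \<and> spanned (R # eta j) (R # eta j) (Id (R # eta j))"
proof (induction j)
  case 0
  have "spanned [] [] (Id [])"
    using unit_scalars by (auto simp: spanned_def)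
  then show ?case
    using no_maps_sym[OF no_maps_R] spanned_Id_R[of "[]"] by simp
next
  case (Suc j)
  then have n: "no_maps (R # eta j) (eta j)" and s: "spanned (R # eta j) (R # eta j) (Id (R # eta j))"
    by simp_all
  have "no_maps (R # eta j @ [T]) (T # R # eta j)"
    using no_maps_schur[of "R # eta j @ [T]" "T # R # eta j"] spanned_strip_left[OF s]
      spanned_strip_right[OF s] not_iso[of j] Suc.prems
    by (simp add: word_power_eta)
  then have 1: "no_maps (eta j @ [T, R]) (R # eta j @ [T])"
    unfolding eta_Suc_right by (rule no_maps_sym)
  have 2: "no_maps (eta j @ [T]) (R # eta j @ [T])"
    using no_maps_strip(2)[OF no_maps_sym[OF n]] by simp
  have "no_maps (R # eta j @ [T]) ((eta j @ [T, R]) @ [R])"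
    using no_maps_RR[of "eta j @ [T]" "[]"] 1 2 by (simp add: no_maps_sym)
  then have "no_maps ((R # eta j @ [T]) @ [R]) (eta j @ [T, R])"
    unfolding no_maps_Rfrob .
  then have "no_maps (R # eta (Suc j)) (eta (Suc j))"
    using eta_Suc_right[of j] by simp
  moreover have "spanned (eta (Suc j)) (eta (Suc j)) (Id (eta (Suc j)))"
    using spanned_strip_left[OF s] by simp
  ultimately show ?case
    using spanned_Id_R by blast
qed

lemma alternating_distinct: "j < k \<Longrightarrow> no_maps (R # eta j @ [T]) (T # R # eta j)"
  using no_maps_schur[of "R # eta j @ [T]" "T # R # eta j"] alternating_simple[of j]
    spanned_strip_left[of "R # eta j" "R # eta j" "Id (R # eta j)"]
    spanned_strip_right[of "R # eta j" "R # eta j" "Id (R # eta j)"] not_iso[of j]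
  by (simp add: word_power_eta)

section \<open>Rotating the generator inside a ring\<close>

definition x :: "letter list" where "x = R # eta k"

definition V :: "(letter, 'b) arrow" where "V = whisk [] Y (eta k)"

lemma U_boundary [simp]: "src U = x @ [T]" "tgt U = T # x"
  by (simp_all add: U_src U_tgt word_power_eta x_def)

lemma V_boundary [simp]: "valid V" "src V = R # x" "tgt V = x"
  by (simp_all add: V_def x_def)

lemma UU [simp]: "U\<^sup>\<star> \<bullet> U = Id (x @ [T])" "U \<bullet> U\<^sup>\<star> = Id (T # x)"
  using U_unitary by simp_all

lemma whisk_UU:
  "whisk a (U\<^sup>\<star>) b \<bullet> whisk a U b = Id (a @ x @ T # b)" "whisk a U b \<bullet> whisk a (U\<^sup>\<star>) b = Id (a @ T # x @ b)"
  by (simp_all flip: whisk_cmp)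

lemma spanned_V: "spanned (R # x) x V"
proof -
  have "spanned ([] @ R # R # eta k) x (Id x \<bullet> whisk [] Y (eta k))"
    using alternating_simple[of k] no_maps_sym[of "R # eta k" "eta k"]
    by (intro spanned_RR) (simp_all add: x_def)
  then show ?thesis
    by (simp add: V_def x_def)
qed

lemma VV: obtains N where "N \<noteq> 0" "V \<bullet> V\<^sup>\<star> = N *\<^sub>a Id x"
proof -
  obtain N where N: "N \<noteq> 0" "Y \<bullet> Y\<^sup>\<star> = N *\<^sub>a Id [R]"
    by (rule Y_nonzero)
  have "V \<bullet> V\<^sup>\<star> = whisk [] (Y \<bullet> Y\<^sup>\<star>) (eta k)"
    by (simp add: V_def whisk_cmp)
  also have "\<dots> = N *\<^sub>a Id x"
    unfolding N(2) by (simp add: x_def)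
  finally show ?thesis
    using N(1) that by blast
qed

abbreviation num_T :: "letter list \<Rightarrow> nat" where
  "num_T w \<equiv> count_list w T"

abbreviation Ts :: "nat \<Rightarrow> letter list" where
  "Ts j \<equiv> replicate j T"

text \<open>Letters \<open>R\<close> are absorbed into \<open>x\<close> by \<open>V\<close>, while letters \<open>T\<close> are moved past \<open>x\<close> by \<open>U\<close>.\<close>

primrec act :: "letter list \<Rightarrow> (letter, 'b) arrow" where
  "act [] = Id x"
| "act (l # w) = (case l of R \<Rightarrow> whisk [] V (Ts (num_T w)) \<bullet> whisk [R] (act w) []
                           | T \<Rightarrow> whisk [] (U\<^sup>\<star>) (Ts (num_T w)) \<bullet> whisk [T] (act w) [])"

lemma act_boundary [simp]: "valid (act w)" "src (act w) = w @ x" "tgt (act w) = x @ Ts (num_T w)"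
  by (induction w) (auto split: letter.split)

lemma Ts_append: "Ts i @ Ts j = Ts (i + j)" "Ts i @ T # Ts j = T # Ts (i + j)"
  by (simp_all add: replicate_add flip: replicate_app_Cons_same)

lemma act_append: "act (u @ w) = whisk [] (act u) (Ts (num_T w)) \<bullet> whisk u (act w) []"
proof (induction u)
  case (Cons l u)
  show ?case
    by (cases l) (simp_all add: Cons.IH whisk_cmp cmp_assoc Ts_append)
qed simp

text \<open>Every step of \<open>act\<close> is, up to a nonzero scalar, the adjoint of an
  isometry.\<close>

lemma act_act: "\<exists>c. c \<noteq> 0 \<and> act w \<bullet> (act w)\<^sup>\<star> = c *\<^sub>a Id (x @ Ts (num_T w))"
proof (induction w)
  case Nil
  show ?case
    by (intro exI[of _ 1]) simp
next
  case (Cons l w)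
  then obtain c where c: "c \<noteq> 0" "act w \<bullet> (act w)\<^sup>\<star> = c *\<^sub>a Id (x @ Ts (num_T w))"
    by blast
  obtain N where N: "N \<noteq> 0" "V \<bullet> V\<^sup>\<star> = N *\<^sub>a Id x"
    by (rule VV)
  show ?case
  proof (cases l)
    case R
    have "act (l # w) \<bullet> (act (l # w))\<^sup>\<star>
      = whisk [] V (Ts (num_T w)) \<bullet> whisk [R] (act w \<bullet> (act w)\<^sup>\<star>) [] \<bullet> whisk [] (V\<^sup>\<star>) (Ts (num_T w))"
      using R by (simp add: whisk_cmp cmp_assoc)
    also have "\<dots> = c *\<^sub>a whisk [] (V \<bullet> V\<^sup>\<star>) (Ts (num_T w))"
      unfolding c(2) by (simp add: whisk_cmp)
    also have "\<dots> = (c * N) *\<^sub>a Id (x @ Ts (num_T w))"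
      unfolding N(2) by simp
    finally show ?thesis
      using R c(1) N(1) by (intro exI[of _ "c * N"]) simp
  next
    case T
    have "act (l # w) \<bullet> (act (l # w))\<^sup>\<star>
      = whisk [] (U\<^sup>\<star>) (Ts (num_T w)) \<bullet> whisk [T] (act w \<bullet> (act w)\<^sup>\<star>) [] \<bullet> whisk [] U (Ts (num_T w))"
      using T by (simp add: whisk_cmp cmp_assoc)
    also have "\<dots> = c *\<^sub>a Id (x @ Ts (Suc (num_T w)))"
      unfolding c(2) by (simp add: whisk_UU)
    finally show ?thesis
      using T c(1) by (intro exI[of _ c]) simp
  qed
qed

text \<open>The rest of the boundary of \<open>U\<close> when a letter \<open>R\<close> instead of a
  letter \<open>T\<close> is split off; rotating by \<open>R\<close> uses this second reading of the
  same words.\<close>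

definition zeta :: "letter list" where "zeta = eta k @ [T]"

lemma zeta_x: "R # zeta = x @ [T]" "zeta @ [R] = T # x"
  by (simp_all add: zeta_def x_def eta_Suc_right)

lemma num_T_zeta: "num_T zeta = Suc k" "num_T x = k"
proof -
  have "num_T (eta j) = j" for j
    by (induction j) simp_all
  then show "num_T zeta = Suc k" "num_T x = k"
    by (simp_all add: zeta_def x_def)
qed

lemma U_zeta: "src U = R # zeta" "tgt U = zeta @ [R]"
  by (simp_all add: zeta_x)

text \<open>The value of \<open>U\<close> inside a ring labelled \<open>x\<close>, computed by opening the ring at a letter \<open>R\<close>
  and at a letter \<open>T\<close>.\<close>

definition ring :: "(letter, 'b) arrow" where
  "ring = act (T # x) \<bullet> whisk [] U x \<bullet> (act (x @ [T]))\<^sup>\<star>"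

text \<open>A strand \<open>T\<close> passes two copies of \<open>x\<close>, which then merge. This
  is \<open>ring\<close> without its outermost crossing and without the splitting of
  \<open>x\<close> at the bottom.\<close>

definition cross :: "(letter, 'b) arrow" where
  "cross = whisk [T] (act x) [] \<bullet> whisk [] U x \<bullet> whisk x U []"

lemma cross_boundary [simp]: "valid cross" "src cross = x @ x @ [T]" "tgt cross = T # x @ Ts k"
  by (simp_all add: cross_def num_T_zeta)

lemma ring_cross: "ring = whisk [] (U\<^sup>\<star>) (Ts k) \<bullet> cross \<bullet> whisk [] ((act x)\<^sup>\<star>) [T]"
proof -
  have "(act (x @ [T]))\<^sup>\<star> = whisk x U [] \<bullet> whisk [] ((act x)\<^sup>\<star>) [T]"
    unfolding act_append by simp
  then show ?thesis
    by (simp add: ring_def cross_def cmp_assoc num_T_zeta)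
qed

text \<open>With the outermost vertex \<open>V\<close> taken off, what remains lies in the line
  spanned by \<open>V\<close>, so the ring is a scalar. Carrying the leg \<open>R\<close> of
  \<open>U\<close> around the ring then compares the ring with its adjoint.\<close>

lemma ring_scalar:
  obtains g where "ring = g *\<^sub>a Id (x @ Ts (Suc k))" "cnj g * \<omega> = g"
proof -
  obtain N where N: "N \<noteq> 0" "V \<bullet> V\<^sup>\<star> = N *\<^sub>a Id x"
    by (rule VV)
  define V' where "V' = whisk [] V (Ts (Suc k))"
  have V' [simp]: "valid V'" "src V' = R # x @ Ts (Suc k)" "tgt V' = x @ Ts (Suc k)"
    by (simp_all add: V'_def)
  have VV': "V' \<bullet> V'\<^sup>\<star> = N *\<^sub>a Id (x @ Ts (Suc k))"
    using N(2) by (simp add: V'_def flip: whisk_cmp)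
  \<comment> \<open>Rotating the leg \<open>R\<close> of \<open>V\<close> gives its adjoint up to a
    factor. The travelling strand is rotated once at each of its two ends, so
    \<open>\<kappa>\<close> will occur on both sides and cancel.\<close>
  obtain \<kappa> where \<kappa>: "Lup R V = \<kappa> *\<^sub>a V\<^sup>\<star>"
    using spannedD[OF spanned_adj[OF spanned_V], of "Lup R V"] by auto
  have V_down: "V = \<kappa> *\<^sub>a Ldn R (V\<^sup>\<star>)"
    using arg_cong[OF \<kappa>, of "Ldn R"] by (simp add: x_def)
  have \<kappa>0: "\<kappa> \<noteq> 0"
  proof
    assume "\<kappa> = 0"
    then have "V = Zero (R # x) x"
      using V_down by (simp add: scl_0 x_def)
    then have "N *\<^sub>a Id x = Zero x x"
      using N(2) by simp
    then show False
      using scl_eq_Zero[of "Id x" N x x] N(1) Id_ne_Zero by simp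
  qed
  let ?A = "act zeta"
  note num_T_zeta [simp]
  define B where "B = ?A \<bullet> whisk zeta V [] \<bullet> whisk [] U x"
  have B [simp]: "valid B" "src B = R # zeta @ x" "tgt B = x @ Ts (Suc k)"
    using U_zeta by (simp_all add: B_def del: U_boundary)
  have act_l: "act (R # zeta) = V' \<bullet> whisk [R] ?A []"
    by (simp add: V'_def num_T_zeta)
  have act_r: "act (zeta @ [R]) = ?A \<bullet> whisk zeta V []"
    unfolding act_append by simp
  have ring: "ring = B \<bullet> whisk [R] (?A\<^sup>\<star>) [] \<bullet> V'\<^sup>\<star>"
    unfolding ring_def zeta_x[symmetric] act_l act_r B_def
    using U_zeta by (simp add: cmp_assoc del: U_boundary)
  obtain c where c: "B \<bullet> whisk [R] (?A\<^sup>\<star>) [] = c *\<^sub>a V'"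
    using spannedD[OF spanned_strip_replicate[OF spanned_V, of "Suc k"], of "B \<bullet> whisk [R] (?A\<^sup>\<star>) []"]
    by (auto simp: V'_def)
  have ring_c: "ring = (c * N) *\<^sub>a Id (x @ Ts (Suc k))"
  proof -
    have "ring = (B \<bullet> whisk [R] (?A\<^sup>\<star>) []) \<bullet> V'\<^sup>\<star>"
      unfolding ring by (simp add: cmp_assoc)
    then show ?thesis
      unfolding c by (simp add: VV')
  qed
  \<comment> \<open>The cap that bends the last leg of \<open>L\<close> down can equally be regarded
    as bending the leg of the vertex attached to it.\<close>
  have V_slide: "whisk [] (Rdn R L) x \<bullet> whisk zeta (V\<^sup>\<star>) [] = whisk (R # zeta) (Ldn R (V\<^sup>\<star>)) [] \<bullet> whisk [] L x"
    if L [simp]: "valid L" "src L = zeta" "tgt L = R # zeta @ [R]" for L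
  proof -
    have "whisk [] (Rdn R L) x \<bullet> whisk zeta (V\<^sup>\<star>) []
      = whisk (R # zeta) (cap R) x \<bullet> (whisk [] L (R # x) \<bullet> whisk zeta (V\<^sup>\<star>) [])"
      by (simp add: Rdn_def whisk_cmp cmp_assoc butlast_append)
    also have "whisk [] L (R # x) \<bullet> whisk zeta (V\<^sup>\<star>) [] = whisk (R # zeta @ [R]) (V\<^sup>\<star>) [] \<bullet> whisk [] L x"
      using slide[of L "V\<^sup>\<star>" "[]" "[]" "[]"] by simp
    also have "whisk (R # zeta) (cap R) x \<bullet> (whisk (R # zeta @ [R]) (V\<^sup>\<star>) [] \<bullet> whisk [] L x)
      = whisk (R # zeta) (Ldn R (V\<^sup>\<star>)) [] \<bullet> whisk [] L x"
      by (simp add: Ldn_def whisk_cmp cmp_assoc)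
    finally show ?thesis .
  qed
  have V_slide: "whisk [] (Rdn R (Lup R U)) x \<bullet> whisk zeta (V\<^sup>\<star>) []
    = whisk (R # zeta) (Ldn R (V\<^sup>\<star>)) [] \<bullet> Lup R (whisk [] U x)"
    using V_slide[of "Lup R U"] Lup_whisk[of U R zeta x] U_zeta by (simp del: U_boundary)
  have "U\<^sup>\<star> = Rdn R (Rup R (U\<^sup>\<star>))"
    using U_zeta by (simp del: U_boundary)
  then have star_U: "\<omega> *\<^sub>a U\<^sup>\<star> = Rdn R (Lup R U)"
    unfolding rotate_R using U_zeta by (simp del: U_boundary Rdn_Rup)
  have "\<omega> *\<^sub>a ring\<^sup>\<star> = V' \<bullet> whisk [R] ?A [] \<bullet> whisk [] (\<omega> *\<^sub>a U\<^sup>\<star>) x \<bullet> whisk zeta (V\<^sup>\<star>) [] \<bullet> ?A\<^sup>\<star>"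
    unfolding ring_def zeta_x[symmetric] act_l act_r
    using U_zeta by (simp add: cmp_assoc del: U_boundary)
  also have "\<dots> = V' \<bullet> whisk [R] ?A [] \<bullet> (whisk [] (Rdn R (Lup R U)) x \<bullet> whisk zeta (V\<^sup>\<star>) []) \<bullet> ?A\<^sup>\<star>"
    unfolding star_U using U_zeta by (simp add: cmp_assoc del: U_boundary)
  finally have "\<kappa> *\<^sub>a \<omega> *\<^sub>a ring\<^sup>\<star>
    = \<kappa> *\<^sub>a (V' \<bullet> whisk [R] ?A [] \<bullet> (whisk (R # zeta) (Ldn R (V\<^sup>\<star>)) [] \<bullet> Lup R (whisk [] U x)) \<bullet> ?A\<^sup>\<star>)"
    unfolding V_slide by simp
  also have "\<dots> = V' \<bullet> whisk [R] ?A [] \<bullet> whisk (R # zeta) (\<kappa> *\<^sub>a Ldn R (V\<^sup>\<star>)) [] \<bullet> Lup R (whisk [] U x) \<bullet> ?A\<^sup>\<star>"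
    using U_zeta by (simp add: cmp_assoc x_def del: U_boundary)
  \<comment> \<open>Bending turns the leftover of the vertex back into \<open>V\<close>, so the
    inner part is again the one that defined \<open>c\<close>, now with its leg \<open>R\<close>
    rotated.\<close>
  also have "\<dots> = V' \<bullet> Lup R (B \<bullet> whisk [R] (?A\<^sup>\<star>) [])"
  proof -
    have "Lup R B = whisk [R] ?A [] \<bullet> whisk (R # zeta) V [] \<bullet> Lup R (whisk [] U x)"
      unfolding B_def using U_zeta by (simp add: Lup_cmp whisk_cmp cmp_assoc del: U_boundary)
    then have "Lup R (B \<bullet> whisk [R] (?A\<^sup>\<star>) [])
      = (whisk [R] ?A [] \<bullet> whisk (R # zeta) V [] \<bullet> Lup R (whisk [] U x)) \<bullet> ?A\<^sup>\<star>"
      by (subst Lup_cmp_whisk[where u = "zeta @ x"]) simp_all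
    then show ?thesis
      unfolding V_down[symmetric] using U_zeta by (simp add: cmp_assoc del: U_boundary)
  qed
  also have "\<dots> = (c * \<kappa> * N) *\<^sub>a Id (x @ Ts (Suc k))"
  proof -
    have "Lup R V' = \<kappa> *\<^sub>a V'\<^sup>\<star>"
      unfolding V'_def by (simp add: Lup_whisk \<kappa>)
    then show ?thesis
      unfolding c by (simp add: VV' mult_ac)
  qed
  finally have "(\<kappa> * \<omega> * cnj (c * N)) *\<^sub>a Id (x @ Ts (Suc k)) = (c * \<kappa> * N) *\<^sub>a Id (x @ Ts (Suc k))"
    unfolding ring_c by (simp add: mult_ac)
  then have "\<kappa> * \<omega> * cnj (c * N) = c * \<kappa> * N"
    by (rule scalar_unique)
  then have "cnj (c * N) * \<omega> = c * N"
    using \<kappa>0 by (simp add: mult_ac)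
  with ring_c show ?thesis
    by (rule that)
qed

text \<open>A crossing of \<open>T\<close> with some word is symmetric if its two rotations by \<open>T\<close> agree; the
  crossings obtained from \<open>U\<close> inherit this property.\<close>

lemma ring_real:
  assumes g: "ring = g *\<^sub>a Id (x @ Ts (Suc k))"
  shows "cnj g = g"
proof -
  let ?A = "act x" and ?W = "whisk [] U x \<bullet> whisk x U []"
  define L where "L = cross \<bullet> whisk [] (?A\<^sup>\<star>) [T]"
  have U_adj_cup: "whisk [] U [T] \<bullet> whisk x (cup T) [] = whisk [T] (U\<^sup>\<star>) [] \<bullet> whisk [] (cup T) x"
    using rotate_T by (simp add: Rup_def Lup_def)
  \<comment> \<open>The symmetry of \<open>U\<close> is applied at the second crossing, the two
    boxes exchange heights, and it is applied again at the first one.\<close>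
  have W: "Rup T ?W = Lup T (?W\<^sup>\<star>)"
  proof -
    have "Rup T ?W = whisk [] U (x @ [T]) \<bullet> whisk x (whisk [] U [T] \<bullet> whisk x (cup T) []) []"
      by (simp add: Rup_def whisk_cmp cmp_assoc butlast_append)
    also have "\<dots> = (whisk [] U (x @ [T]) \<bullet> whisk (x @ [T]) (U\<^sup>\<star>) []) \<bullet> whisk x (cup T) x"
      unfolding U_adj_cup by (simp add: whisk_cmp cmp_assoc)
    also have "\<dots> = (whisk (T # x) (U\<^sup>\<star>) [] \<bullet> whisk [] U (T # x)) \<bullet> whisk x (cup T) x"
      using slide[of U "U\<^sup>\<star>" "[]" "[]" "[]"] by simp
    also have "\<dots> = whisk (T # x) (U\<^sup>\<star>) [] \<bullet> whisk [] (whisk [] U [T] \<bullet> whisk x (cup T) []) x"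
      by (simp add: whisk_cmp cmp_assoc)
    also have "\<dots> = Lup T (?W\<^sup>\<star>)"
      unfolding U_adj_cup by (simp add: Lup_def whisk_cmp cmp_assoc)
    finally show ?thesis .
  qed
  define W where "W = ?W"
  have Wb [simp]: "valid W" "src W = x @ x @ [T]" "tgt W = T # x @ x" and W': "Rup T W = Lup T (W\<^sup>\<star>)"
    using W by (simp_all add: W_def)
  note num_T_zeta [simp]
  have L: "L = (whisk [T] ?A [] \<bullet> W) \<bullet> whisk [] (?A\<^sup>\<star>) [T]"
    by (simp add: L_def cross_def cmp_assoc W_def)
  have "Rup T L = whisk [T] ?A [T] \<bullet> Rup T W \<bullet> ?A\<^sup>\<star>"
    unfolding L by (subst Rup_cmp_whisk[where u = "x @ x"])
      (simp_all add: Rup_cmp[where u = "x @ x"] cmp_assoc butlast_append)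
  also have "\<dots> = Lup T ((whisk [] ?A [T] \<bullet> W\<^sup>\<star>) \<bullet> whisk [T] (?A\<^sup>\<star>) [])"
    unfolding W' by (subst Lup_cmp_whisk[where u = "x @ x"]) (simp_all add: Lup_cmp cmp_assoc)
  also have "\<dots> = Lup T (L\<^sup>\<star>)"
    unfolding L by (simp add: cmp_assoc)
  finally have sym_L: "Rup T L = Lup T (L\<^sup>\<star>)" .
  \<comment> \<open>The letter bent on the right is the last one after appending
    \<open>Ts k\<close>, which need not be the letter \<open>T\<close> of \<open>U\<close>. By
    \<open>tc\<close> a cup passes through strands \<open>T\<close>, because a cup after a cap is
    the identity of \<open>T T\<close>.\<close>
  have sym_U: "Rup T (whisk [] U (Ts k)) = Lup T (whisk [] (U\<^sup>\<star>) (Ts k))"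
  proof -
    have tc: "whisk (Ts j) (cup T) [] = whisk [] (cup T) (Ts j)" for j
    proof (induction j)
      case (Suc j)
      have 1: "whisk [T] (cup T) [] = whisk [] (cup T) [T]"
      proof -
        have "whisk [T] (cup T) [] = whisk [] (Id [T, T]) [T] \<bullet> whisk [T] (cup T) []"
          by simp
        also have "\<dots> = whisk [] (cup T) [T] \<bullet> (whisk [] (cap T) [T] \<bullet> whisk [T] (cup T) [])"
          unfolding Id_TT by (simp add: whisk_cmp cmp_assoc)
        also have "\<dots> = whisk [] (cup T) [T]"
          unfolding zigzag by simp
        finally show ?thesis .
      qed
      have "whisk (Ts (Suc j)) (cup T) [] = whisk [T] (whisk (Ts j) (cup T) []) []"
        by simp
      also have "\<dots> = whisk [] (whisk [T] (cup T) []) (Ts j)"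
        unfolding Suc.IH by simp
      also have "\<dots> = whisk [] (cup T) (Ts (Suc j))"
        unfolding 1 by simp
      finally show ?case .
    qed simp
    have "Rup T (whisk [] U (Ts k)) = whisk [] U (Ts k @ [T]) \<bullet> whisk x (whisk (Ts k) (cup T) []) []"
      by (simp add: Rup_def whisk_cmp butlast_append replicate_append_same flip: replicate_Suc)
        (simp add: replicate_append_same butlast_append flip: replicate_append_same)
    also have "\<dots> = whisk [] (whisk [] U [T] \<bullet> whisk x (cup T) []) (Ts k)"
      unfolding tc by (simp add: whisk_cmp replicate_append_same)
    also have "\<dots> = Lup T (whisk [] (U\<^sup>\<star>) (Ts k))"
      unfolding U_adj_cup by (simp add: Lup_def whisk_cmp)
    finally show ?thesis .
  qed
  have L_g: "L = g *\<^sub>a whisk [] U (Ts k)"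
  proof -
    have "L = whisk [] U (Ts k) \<bullet> ring"
      unfolding ring_cross L_def by (simp add: whisk_UU num_T_zeta flip: cmp_assoc)
    then show ?thesis
      unfolding g by simp
  qed
  have "Rup T L = g *\<^sub>a Lup T (whisk [] (U\<^sup>\<star>) (Ts k))"
    unfolding L_g sym_U[symmetric]
    by (rule mate_scl) (simp_all add: replicate_append_same last_append)
  moreover have "Lup T (L\<^sup>\<star>) = cnj g *\<^sub>a Lup T (whisk [] (U\<^sup>\<star>) (Ts k))"
    unfolding L_g by simp
  ultimately have "g *\<^sub>a Lup T (whisk [] (U\<^sup>\<star>) (Ts k)) = cnj g *\<^sub>a Lup T (whisk [] (U\<^sup>\<star>) (Ts k))"
    using sym_L by simp
  then have "Ldn T (g *\<^sub>a Lup T (whisk [] (U\<^sup>\<star>) (Ts k))) = Ldn T (cnj g *\<^sub>a Lup T (whisk [] (U\<^sup>\<star>) (Ts k)))"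
    by (rule arg_cong)
  then have "g *\<^sub>a whisk [] (U\<^sup>\<star>) (Ts k) = cnj g *\<^sub>a whisk [] (U\<^sup>\<star>) (Ts k)"
    by simp
  then have "(g *\<^sub>a whisk [] (U\<^sup>\<star>) (Ts k)) \<bullet> whisk [] U (Ts k) = (cnj g *\<^sub>a whisk [] (U\<^sup>\<star>) (Ts k)) \<bullet> whisk [] U (Ts k)"
    by (rule arg_cong)
  then have "g *\<^sub>a Id (x @ T # Ts k) = cnj g *\<^sub>a Id (x @ T # Ts k)"
    by (simp add: whisk_UU)
  then show ?thesis
    using scalar_unique by metis
qed

text \<open>For real \<open>g\<close> the rotation by \<open>R\<close> reads
  \<open>g * \<omega> = g\<close>. The hypothesis says that the ring, with its unitary outermost
  crossing removed, is not zero.\<close>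

lemma omega_eq_1:
  assumes "cross \<bullet> whisk [] ((act x)\<^sup>\<star>) [T] \<noteq> Zero (x @ Ts (Suc k)) (T # x @ Ts k)"
  shows "\<omega> = 1"
proof -
  obtain g where g: "ring = g *\<^sub>a Id (x @ Ts (Suc k))" "cnj g * \<omega> = g"
    by (rule ring_scalar)
  have "g \<noteq> 0"
  proof
    assume "g = 0"
    then have "whisk [] U (Ts k) \<bullet> ring = Zero (x @ Ts (Suc k)) (T # x @ Ts k)"
      using g(1) by (simp add: scl_0)
    moreover have "whisk [] U (Ts k) \<bullet> ring = cross \<bullet> whisk [] ((act x)\<^sup>\<star>) [T]"
      unfolding ring_cross by (simp add: whisk_UU num_T_zeta flip: cmp_assoc)
    ultimately show False
      using assms by simp
  qed
  with g ring_real[OF g(1)] show ?thesis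
    by simp
qed

end

section \<open>Nonvanishing of the ring for \<open>n\<close> at most 2\<close>

context at_category
begin

lemma act_single [simp]: "act [R] = V" "act [T] = U\<^sup>\<star>"
  by simp_all

text \<open>Two unitary crossings are followed by \<open>act x\<close>, which is the adjoint of an
  isometry up to a nonzero scalar.\<close>

lemma cross_nonzero: "cross \<noteq> Zero (x @ x @ [T]) (T # x @ Ts k)"
proof
  note num_T_zeta [simp]
  assume z: "cross = Zero (x @ x @ [T]) (T # x @ Ts k)"
  obtain c where c: "c \<noteq> 0" "act x \<bullet> (act x)\<^sup>\<star> = c *\<^sub>a Id (x @ Ts k)"
    using act_act[of x] by auto
  have UU: "whisk a U b \<bullet> whisk a (U\<^sup>\<star>) b \<bullet> f = f" if "valid f" "tgt f = a @ T # x @ b" for a b f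
    using that by (simp add: whisk_UU flip: cmp_assoc)
  have "cross \<bullet> cross\<^sup>\<star> = whisk [T] (act x \<bullet> (act x)\<^sup>\<star>) []"
    by (simp add: cross_def cmp_assoc UU whisk_cmp)
  also have "\<dots> = c *\<^sub>a Id (T # x @ Ts k)"
    unfolding c(2) by simp
  finally have "c *\<^sub>a Id (T # x @ Ts k) = Zero (T # x @ Ts k) (T # x @ Ts k)"
    unfolding z by simp
  then show False
    using scl_eq_Zero c(1) Id_ne_Zero by (metis valid_Id)
qed

text \<open>Factor \<open>act x\<close> into a fusion at the junction of the two copies of
  \<open>x\<close> and \<open>act w\<close>. Removing the outer crossing from the restriction
  \<open>D\<close> to that channel leaves a multiple of \<open>act w\<close>, whose coefficient is
  the ring up to a nonzero factor. So a vanishing ring kills the channel in which the two adjacent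
  letters \<open>R\<close> fuse to one \<open>R\<close>.\<close>

lemma cross_merge:
  assumes z: "cross \<bullet> whisk [] ((act x)\<^sup>\<star>) [T] = Zero (x @ Ts (Suc k)) (T # x @ Ts k)"
    and w: "x = w @ [R]" "num_T w = k" "spanned (w @ x) (x @ Ts k) (act w)"
  shows "cross \<bullet> whisk w (Y\<^sup>\<star>) (eta k @ [T]) = Zero (w @ x @ [T]) (T # x @ Ts k)"
proof -
  note num_T_zeta [simp]
  let ?b = "whisk [] (U\<^sup>\<star>) (Ts k)"
  define D where "D = cross \<bullet> whisk w (V\<^sup>\<star>) [T]"
  have D [simp]: "valid D" "src D = w @ x @ [T]" "tgt D = T # x @ Ts k"
    using w(1) by (simp_all add: D_def flip: append_assoc)
  have A: "act x = act w \<bullet> whisk w V []"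
    using act_append[of w "[R]"] w(1) by simp
  obtain c where c: "?b \<bullet> D = c *\<^sub>a whisk [] (act w) [T]"
    using spannedD[OF spanned_strip_right[OF w(3)], of "?b \<bullet> D"] by (auto simp: replicate_append_same)
  obtain d where d: "d \<noteq> 0" "act w \<bullet> (act w)\<^sup>\<star> = d *\<^sub>a Id (x @ Ts k)"
    using act_act[of w] w(2) by auto
  have "D \<bullet> whisk [] ((act w)\<^sup>\<star>) [T] = cross \<bullet> whisk [] ((act x)\<^sup>\<star>) [T]"
  proof -
    have "src cross = w @ [R] @ x @ [T]"
      using w(1) by simp
    then show ?thesis
      unfolding A D_def by (simp add: whisk_cmp cmp_assoc del: cross_boundary(2))
  qed
  then have "(?b \<bullet> D) \<bullet> whisk [] ((act w)\<^sup>\<star>) [T] = Zero (x @ Ts (Suc k)) (x @ T # Ts k)"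
    using w(2) by (simp add: cmp_assoc z replicate_append_same)
  moreover have "(?b \<bullet> D) \<bullet> whisk [] ((act w)\<^sup>\<star>) [T] = (c * d) *\<^sub>a Id (x @ T # Ts k)"
  proof -
    have "whisk [] (act w) [T] \<bullet> whisk [] ((act w)\<^sup>\<star>) [T] = d *\<^sub>a Id (x @ T # Ts k)"
      using d(2) by (simp add: replicate_append_same flip: whisk_cmp)
    then show ?thesis
      unfolding c by simp
  qed
  ultimately have "(c * d) *\<^sub>a Id (x @ T # Ts k) = 0 *\<^sub>a Id (x @ T # Ts k)"
    by (simp add: scl_0)
  then have "c = 0"
    using scalar_unique[of "c * d" _ 0] d(1) by simp
  then have "whisk [] U (Ts k) \<bullet> ?b \<bullet> D = Zero (w @ x @ [T]) (T # x @ Ts k)"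
    unfolding c using w(2) by (simp add: scl_0 replicate_append_same)
  moreover have "whisk [] U (Ts k) \<bullet> ?b \<bullet> D = D"
    by (simp add: whisk_UU flip: cmp_assoc)
  ultimately show ?thesis
    by (simp add: D_def V_def)
qed

text \<open>The pair \<open>R R\<close> at the junction has only two channels. With the one through
  \<open>Y\<close> dead by \<open>cross_merge\<close>, the nonzero \<open>cross\<close> has to live
  on the unit channel.\<close>

lemma cross_split:
  assumes z: "cross \<bullet> whisk [] ((act x)\<^sup>\<star>) [T] = Zero (x @ Ts (Suc k)) (T # x @ Ts k)"
    and w: "x = w @ [R]" "num_T w = k" "spanned (w @ x) (x @ Ts k) (act w)"
  shows "cross \<bullet> whisk w (cup R) (eta k @ [T]) \<noteq> Zero (w @ eta k @ [T]) (T # x @ Ts k)"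
proof
  assume c: "cross \<bullet> whisk w (cup R) (eta k @ [T]) = Zero (w @ eta k @ [T]) (T # x @ Ts k)"
  have s: "src cross = w @ R # R # eta k @ [T]"
    using w(1) x_def by simp
  have "cross = Zero (src cross) (tgt cross)"
    by (rule eq_Zero_RR[OF _ s]) (use c cross_merge[OF z w] in \<open>simp_all add: x_def\<close>)
  then show False
    using cross_nonzero by simp
qed

lemma spanned_act_RT: "spanned (R # T # x) (x @ [T]) (act [R, T])"
proof -
  have "spanned (R # T # x) (x @ [T]) (whisk [] V [T] \<bullet> whisk [R] (U\<^sup>\<star>) [])"
    by (rule spanned_iso[OF spanned_strip_right[OF spanned_V]]) (simp_all add: whisk_UU)
  then show ?thesis
    by simp
qed

text \<open>The unit channel consists of maps from \<open>T\<close> to \<open>T R\<close>;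
  cancelling \<open>T\<close> leaves maps from the unit to \<open>R\<close>.\<close>

lemma cross_ring_0:
  assumes k: "k = 0"
  shows "cross \<bullet> whisk [] ((act x)\<^sup>\<star>) [T] \<noteq> Zero (x @ Ts (Suc k)) (T # x @ Ts k)"
proof
  assume z: "cross \<bullet> whisk [] ((act x)\<^sup>\<star>) [T] = Zero (x @ Ts (Suc k)) (T # x @ Ts k)"
  have e: "eta k = []" "Ts k = []"
    unfolding k by simp_all
  have x: "x = [R]"
    by (simp add: x_def e)
  have "spanned x x (Id x)"
    using alternating_simple[of k] by (simp add: x_def)
  then have s: "spanned ([] @ x) (x @ Ts k) (act [])"
    by (simp add: e)
  have "no_maps [T] [T, R]"
    using no_maps_strip(1)[OF no_maps_R] by simp
  then have "cross \<bullet> whisk [] (cup R) (eta k @ [T]) = Zero ([] @ eta k @ [T]) (T # x @ Ts k)"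
    by (intro no_mapsD) (simp_all add: x e)
  moreover have "x = [] @ [R]"
    by (simp add: x)
  moreover have "num_T [] = k"
    by (simp only: k count_list.simps)
  ultimately show False
    using cross_split[OF z _ _ s] by blast
qed

lemma no_maps_TRT: "no_maps [] [T, R, T]"
  using no_maps_strip(2)[OF no_maps_R] no_maps_Lfrob[of T "[]" "[R, T]"] by simp

text \<open>Everything is reduced, by bending letters and splitting \<open>R R\<close>, to the
  absence of maps from \<open>R T\<close> to \<open>T R\<close> and from the unit to
  \<open>R\<close>.\<close>

lemma no_maps_small:
  assumes "0 < k"
  shows "no_maps [R] [R, T, R, T]" "no_maps [R, R] [T, R, T, R]"
proof -
  have 0: "no_maps [R, T] [T, R]"
    using alternating_distinct[of 0] assms by simp
  have "no_maps [R] [T, R, T]"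
    using 0 no_maps_Rfrob[of "[R]" T "[T, R]"] by simp
  then have 1: "no_maps [R, R] [T, R, T]"
    using no_maps_RR[of "[]" "[]"] no_maps_TRT by simp
  then show "no_maps [R] [R, T, R, T]"
    using no_maps_Lfrob[of R "[R]" "[T, R, T]"] by simp
  have 2: "no_maps [] [T, R, T, R]"
    using 0 no_maps_Lfrob[of T "[]" "[R, T, R]"] no_maps_Lfrob[of R "[T]" "[T, R]"] by simp
  have "no_maps [R] [T, R, T, R]"
    using 1 no_maps_Rfrob[of "[R]" R "[T, R, T]"] by simp
  then show "no_maps [R, R] [T, R, T, R]"
    using 2 no_maps_RR[of "[]" "[]"] by simp
qed

text \<open>Capping the junction brings two letters \<open>T\<close> together. After they cancel,
  the unit channel consists of maps from \<open>R R T\<close> to \<open>T R T R T\<close>.\<close>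

lemma cross_ring_1:
  assumes k: "k = 1"
  shows "cross \<bullet> whisk [] ((act x)\<^sup>\<star>) [T] \<noteq> Zero (x @ Ts (Suc k)) (T # x @ Ts k)"
proof
  assume z: "cross \<bullet> whisk [] ((act x)\<^sup>\<star>) [T] = Zero (x @ Ts (Suc k)) (T # x @ Ts k)"
  have e: "eta k = [T, R]" "Ts k = [T]" "0 < k"
    unfolding k by simp_all
  have x: "x = [R, T, R]"
    by (simp add: x_def e)
  have "no_maps ([R] @ [T, T] @ [R]) [T, R, T, R]"
    using no_maps_TT[of "[R]" "[R]"] no_maps_small(2)[OF e(3)] by simp
  then have "no_maps [R, T, T, R, T] [T, R, T, R, T]"
    using no_maps_strip(2) by fastforce
  then have c: "cross \<bullet> whisk [R, T] (cup R) (eta k @ [T]) = Zero ([R, T] @ eta k @ [T]) (T # x @ Ts k)"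
    by (intro no_mapsD) (simp_all add: x e)
  have s: "spanned ([R, T] @ x) (x @ Ts k) (act [R, T])"
    using spanned_act_RT by (simp add: e del: act.simps)
  show False
    using cross_split[OF z _ _ s] c x num_T_zeta(2) by simp
qed

text \<open>Otherwise a bent copy of the unitary \<open>U\<close> would vanish, hence
  \<open>U\<close> itself and the identity of its source.\<close>

lemma omega_nonzero: "\<omega> \<noteq> 0"
proof
  assume "\<omega> = 0"
  then have "Lup R U = Zero zeta (R # zeta @ [R])"
    using rotate_R U_zeta by (simp add: scl_0 del: U_boundary)
  then have "Ldn R (Lup R U) = Ldn R (Zero zeta (R # zeta @ [R]))"
    by (rule arg_cong)
  then have "U = Zero (R # zeta) (zeta @ [R])"
    using U_zeta by (simp del: U_boundary)
  then have "Id (x @ [T]) = Zero (x @ [T]) (x @ [T])"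
    using UU(1) zeta_x by simp
  then show False
    using Id_ne_Zero by blast
qed

text \<open>Straightening the strand \<open>T\<close> between the two copies of \<open>U\<close>.\<close>

lemma UU_mates:
  "whisk [] U x \<bullet> whisk x U [] = whisk (T # x) (Ldn T U) [] \<bullet> whisk [] (Rup T U) (x @ [T])"
proof -
  have "whisk (T # x) (Ldn T U) [] \<bullet> whisk [] (Rup T U) (x @ [T])
    = whisk (T # x) (cap T) x \<bullet> (whisk (T # x) (whisk [T] U []) [] \<bullet> whisk [] U (T # x @ [T]))
      \<bullet> whisk x (cup T) (x @ [T])"
    by (simp add: Ldn_def Rup_def whisk_cmp cmp_assoc butlast_append)
  also have "whisk (T # x) (whisk [T] U []) [] \<bullet> whisk [] U (T # x @ [T])
      = whisk [] U (T # T # x) \<bullet> whisk (x @ [T]) (whisk [T] U []) []"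
    using slide[of U "whisk [T] U []" "[]" "[]" "[]"] by simp
  also have "whisk (T # x) (cap T) x \<bullet> (whisk [] U (T # T # x) \<bullet> whisk (x @ [T]) (whisk [T] U []) [])
      \<bullet> whisk x (cup T) (x @ [T])
    = (whisk (T # x) (cap T) x \<bullet> whisk [] U (T # T # x)) \<bullet> (whisk (x @ [T, T]) U [] \<bullet> whisk x (cup T) (x @ [T]))"
    by (simp add: cmp_assoc)
  also have "whisk (T # x) (cap T) x \<bullet> whisk [] U (T # T # x) = whisk [] U x \<bullet> whisk (x @ [T]) (cap T) x"
    using slide[of U "whisk [] (cap T) x" "[]" "[]" "[]"] by simp
  also have "whisk (x @ [T, T]) U [] \<bullet> whisk x (cup T) (x @ [T]) = whisk x (cup T) (T # x) \<bullet> whisk x U []"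
    using slide[of "cup T" U x "[]" "[]"] by simp
  also have "(whisk [] U x \<bullet> whisk (x @ [T]) (cap T) x) \<bullet> whisk x (cup T) (T # x) \<bullet> whisk x U []
    = whisk [] U x \<bullet> (whisk (x @ [T]) (cap T) x \<bullet> whisk x (cup T) (T # x)) \<bullet> whisk x U []"
    by (simp add: cmp_assoc)
  also have "\<dots> = whisk [] U x \<bullet> whisk x U []"
    unfolding whisk_zigzag by simp
  finally show ?thesis ..
qed

end

text \<open>For \<open>k = 2\<close>, i.e. \<open>n = 3\<close>, the morphisms from \<open>x x\<close> to \<open>x T T\<close> form a plane, with one
  direction given by \<open>act x\<close> and the other one passing through a cap.  If the crossing interchanged
  these directions, the diagram of two copies of \<open>U\<close> sharing five legs would vanish; but it is a
  rotation of a composite of isometries with \<open>Y\<close>.\<close>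

locale at_category_3 = at_category +
  assumes k2: "k = 2"
begin

lemma words_3: "eta k = [T, R, T, R]" "Ts k = [T, T]" "zeta = [T, R, T, R, T]" "0 < k" "1 < k"
  "x = [R, T, R, T, R]"
proof -
  show e: "eta k = [T, R, T, R]" "Ts k = [T, T]" "0 < k" "1 < k"
    unfolding k2 by (simp_all add: numeral_2_eq_2)
  show "zeta = [T, R, T, R, T]" "x = [R, T, R, T, R]"
    by (simp_all add: zeta_def x_def e)
qed

lemma U_3: "src U = [R, T, R, T, R, T]" "tgt U = [T, R, T, R, T, R]"
  by (simp_all add: words_3)

text \<open>\<open>U\<close> with three legs bent, so that nine of its twelve legs lie on one side;
  the five legs to be shared are among the nine of both \<open>A3\<close> and
  \<open>B3\<close>.\<close>

definition B3 :: "(letter, 'b) arrow" where "B3 = Ldn T (Ldn R (Ldn T U))"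
definition A3 :: "(letter, 'b) arrow" where "A3 = Rup T (Rup R (Rup T U))"

abbreviation "L3 f \<equiv> Lup T (Lup R (Lup T f))"
abbreviation "R3 f \<equiv> Rdn T (Rdn R (Rdn T f))"

lemma AB3_boundary [simp]: "valid A3" "src A3 = [R, T, R]" "tgt A3 = [T, R, T, R, T, R, T, R, T]"
  "valid B3" "src B3 = [T, R, T, R, T, R, T, R, T]" "tgt B3 = [R, T, R]"
  by (simp_all add: A3_def B3_def U_3 del: U_boundary)

text \<open>The three bends are exchanged from right to left one at a time, by rotations at
  \<open>T\<close>, \<open>R\<close>, \<open>T\<close>. Each rotation exchanges \<open>U\<close>
  with its adjoint, and only the one at \<open>R\<close> contributes a factor
  \<open>\<omega>\<close>. Bends on opposite sides commute, which brings the next rotation next to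
  \<open>U\<close>.\<close>

lemma A3_rotated: "\<omega> *\<^sub>a A3 = L3 (U\<^sup>\<star>)"
proof -
  note [simp] = U_3 and [simp del] = U_boundary
  have "\<omega> *\<^sub>a A3 = \<omega> *\<^sub>a Rup T (Rup R (Lup T (U\<^sup>\<star>)))"
    by (simp add: A3_def rotate_T)
  also have "\<dots> = \<omega> *\<^sub>a Rup T (Lup T (Rup R (U\<^sup>\<star>)))"
    by (subst Lup_Rup[where u = "[R, T, R, T]"]) simp_all
  also have "\<dots> = Rup T (Lup T (Lup R U))"
    unfolding rotate_R by simp
  also have "\<dots> = Lup T (Lup R (Rup T U))"
    by (simp add: Lup_Rup[where u = "[R, T, R]"] Lup_Rup[where u = "[T, R, T, R]"])
  also have "\<dots> = L3 (U\<^sup>\<star>)"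
    unfolding rotate_T ..
  finally show ?thesis .
qed

lemma B3_rotated: "B3 = cnj \<omega> *\<^sub>a R3 (U\<^sup>\<star>)"
proof -
  note [simp] = U_3 and [simp del] = U_boundary
  have T: "Ldn T U = Rdn T (U\<^sup>\<star>)"
    using arg_cong[OF rotate_T, of adj] by (simp add: adj_mate)
  have R: "Ldn R (U\<^sup>\<star>) = cnj \<omega> *\<^sub>a Rdn R U"
    using arg_cong[OF rotate_R, of adj] by (simp add: adj_mate)
  have "B3 = Ldn T (Ldn R (Rdn T (U\<^sup>\<star>)))"
    by (simp add: B3_def T)
  also have "\<dots> = Ldn T (Rdn T (Ldn R (U\<^sup>\<star>)))"
    by (subst Ldn_Rdn[where u = "[T, R, T, R]"]) simp_all
  also have "\<dots> = cnj \<omega> *\<^sub>a Ldn T (Rdn T (Rdn R U))"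
    unfolding R by simp
  also have "\<dots> = cnj \<omega> *\<^sub>a Rdn T (Rdn R (Ldn T U))"
    by (simp add: Ldn_Rdn[where u = "[R, T, R]"] Ldn_Rdn[where u = "[R, T, R, T]"])
  also have "\<dots> = cnj \<omega> *\<^sub>a R3 (U\<^sup>\<star>)"
    unfolding T ..
  finally show ?thesis .
qed

text \<open>Once \<open>UU_mates\<close> has moved the common strand \<open>T\<close> out of the
  way, every remaining cap belongs to one copy of \<open>U\<close> and every remaining cup to the
  other.\<close>

lemma shared_legs:
  "whisk [T, R, T, R] (cap T) [R, T, R] \<bullet> whisk [T, R, T, R, T] (cap R) [T, R, T, R] \<bullet>
    (whisk [] U x \<bullet> whisk x U []) \<bullet>
    whisk [R, T, R, T] (cup R) [T, R, T, R, T] \<bullet> whisk [R, T, R] (cup T) [R, T, R, T]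
  = whisk [T, R, T, R] B3 [] \<bullet> whisk [] A3 [R, T, R, T]"
proof -
  note [simp] = U_3 words_3(6) and [simp del] = U_boundary
  define g where "g = Ldn T U"
  define h where "h = Rup T U"
  have g [simp]: "valid g" "src g = [T, R, T, R, T, R, T]" "tgt g = [R, T, R, T, R]"
    and h [simp]: "valid h" "src h = [R, T, R, T, R]" "tgt h = [T, R, T, R, T, R, T]"
    by (simp_all add: g_def h_def)
  have B: "B3 = whisk [] (cap T) [R, T, R] \<bullet> whisk [T] (cap R) [T, R, T, R] \<bullet> whisk [T, R] g []"
    unfolding B3_def g_def[symmetric] by (simp add: Ldn_def whisk_cmp cmp_assoc)
  have A: "A3 = whisk [] h [R, T] \<bullet> whisk [R, T, R, T] (cup R) [T] \<bullet> whisk [R, T, R] (cup T) []"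
    unfolding A3_def h_def[symmetric] by (simp add: Rup_def whisk_cmp cmp_assoc)
  have W: "whisk [] U x \<bullet> whisk x U [] = whisk (T # x) g [] \<bullet> whisk [] h (x @ [T])"
    unfolding g_def h_def by (rule UU_mates)
  show ?thesis
    unfolding W A B by (simp add: whisk_cmp cmp_assoc)
qed

text \<open>Bending is invertible, so both copies of \<open>U\<close> can be rotated until the five
  common legs run straight from one to the other. The diagram has then become \<open>Y\<close> after
  the unitary \<open>X\<close>, and \<open>Y\<close> is not zero.\<close>

lemma shared_legs_nonzero:
  "whisk [T, R, T] Y [T, R] \<bullet> whisk [T, R, T, R] B3 [] \<bullet> whisk [] A3 [R, T, R, T]
    \<noteq> Zero [R, T, R, R, T, R, T] [T, R, T, R, T, R]"
proof
  note [simp] = U_3 and [simp del] = U_boundary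
  assume z: "whisk [T, R, T] Y [T, R] \<bullet> whisk [T, R, T, R] B3 [] \<bullet> whisk [] A3 [R, T, R, T]
    = Zero [R, T, R, R, T, R, T] [T, R, T, R, T, R]"
  let ?u = "[R, T, R, T]"
  define X where "X = whisk [R] (U\<^sup>\<star>) [] \<bullet> whisk [] (U\<^sup>\<star>) [R]"
  have X [simp]: "valid X" "src X = [T, R, T, R, T, R, R]" "tgt X = [R, R, T, R, T, R, T]"
    by (simp_all add: X_def)
  define Q where "Q = whisk [] Y [T, R] \<bullet> whisk [R] B3 [] \<bullet> whisk [] (U\<^sup>\<star>) ?u"
  have Q [simp]: "valid Q" "src Q = [T, R, T, R, T, R, R, T, R, T]" "tgt Q = [R, T, R]"
    by (simp_all add: Q_def)
  have "L3 Q = whisk [T, R, T] Y [T, R] \<bullet> whisk [T, R, T, R] B3 [] \<bullet> whisk [] (L3 (U\<^sup>\<star>)) ?u"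
    by (simp add: Q_def Lup_cmp[where u = "[R, T, R, T, R, R, T, R, T]"]
        Lup_cmp[where u = "[T, R, T, R, R, T, R, T]"] Lup_cmp[where u = "[R, T, R, R, T, R, T]"]
        Lup_whisk[where u = "[R, T, R, T, R]"] Lup_whisk[where u = "[T, R, T, R]"] Lup_whisk[where u = "[R, T, R]"])
  also have "\<dots> = \<omega> *\<^sub>a (whisk [T, R, T] Y [T, R] \<bullet> whisk [T, R, T, R] B3 [] \<bullet> whisk [] A3 ?u)"
    unfolding A3_rotated[symmetric] by simp
  also have "\<dots> = Zero [R, T, R, R, T, R, T] [T, R, T, R, T, R]"
    unfolding z by simp
  finally have "Ldn T (Ldn R (Ldn T (L3 Q))) = Ldn T (Ldn R (Ldn T (Zero [R, T, R, R, T, R, T] [T, R, T, R, T, R])))"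
    by (rule arg_cong)
  then have Q0: "Q = Zero (src Q) [R, T, R]"
    by simp
  have "Q = cnj \<omega> *\<^sub>a (whisk [] Y [T, R] \<bullet> R3 X)"
    unfolding Q_def B3_rotated X_def
    by (simp add: Rdn_cmp[where u = "[R, R, T, R, T, R]"] Rdn_cmp[where u = "[R, R, T, R, T]"]
        Rdn_cmp[where u = "[R, R, T, R]"] Rdn_whisk[where u = "[R, T, R, T, R]"]
        Rdn_whisk[where u = "[R, T, R, T]"] Rdn_whisk[where u = "[R, T, R]"])
  also have "whisk [] Y [T, R] \<bullet> R3 X = R3 (whisk [] Y [T, R, T, R, T] \<bullet> X)"
    using Rdn_whisk_cmp[where x = T and f = X and k = "whisk [] Y [T, R, T, R]" and u = "[R, R, T, R, T, R]"]
      Rdn_whisk_cmp[where x = R and f = "Rdn T X" and k = "whisk [] Y [T, R, T]" and u = "[R, R, T, R, T]"]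
      Rdn_whisk_cmp[where x = T and f = "Rdn R (Rdn T X)" and k = "whisk [] Y [T, R]" and u = "[R, R, T, R]"]
    by simp
  finally have "R3 (whisk [] Y [T, R, T, R, T] \<bullet> X) = Zero (src Q) [R, T, R]"
    using Q0 omega_nonzero scl_eq_Zero[of "R3 (whisk [] Y [T, R, T, R, T] \<bullet> X)" "cnj \<omega>"] by simp
  then have "Rup T (Rup R (Rup T (R3 (whisk [] Y [T, R, T, R, T] \<bullet> X))))
    = Rup T (Rup R (Rup T (Zero (src Q) [R, T, R])))"
    by (rule arg_cong)
  moreover have "Rup T (Rup R (Rup T (Zero (src Q) [R, T, R])))
    = Zero [T, R, T, R, T, R, R] [R, T, R, T, R, T]"
    using mate_Zero(3)[of T "[T, R, T, R, T, R, R, T, R]" "[R, T, R]"]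
      mate_Zero(3)[of R "[T, R, T, R, T, R, R, T]" "[R, T, R, T]"]
      mate_Zero(3)[of T "[T, R, T, R, T, R, R]" "[R, T, R, T, R]"] by simp
  ultimately have "whisk [] Y [T, R, T, R, T] \<bullet> X = Zero [T, R, T, R, T, R, R] [R, T, R, T, R, T]"
    by simp
  moreover have "(whisk [] Y [T, R, T, R, T] \<bullet> X) \<bullet> X\<^sup>\<star> = whisk [] Y [T, R, T, R, T]"
  proof -
    have "X \<bullet> X\<^sup>\<star> = whisk [R] (U\<^sup>\<star>) [] \<bullet> whisk [] (U\<^sup>\<star> \<bullet> U) [R] \<bullet> whisk [R] U []"
      by (simp add: X_def cmp_assoc whisk_cmp del: UU)
    also have "\<dots> = whisk [R] (U\<^sup>\<star> \<bullet> U) []"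
      by (simp add: words_3) (simp add: words_3 flip: whisk_cmp)
    also have "\<dots> = Id [R, R, T, R, T, R, T]"
      by (simp add: words_3)
    finally show ?thesis
      by (simp add: cmp_assoc)
  qed
  ultimately have Y0: "whisk [] Y [T, R, T, R, T] = Zero [R, R, T, R, T, R, T] [R, T, R, T, R, T]"
    by simp
  obtain N where N: "N \<noteq> 0" "Y \<bullet> Y\<^sup>\<star> = N *\<^sub>a Id [R]"
    by (rule Y_nonzero)
  have "whisk [] Y [T, R, T, R, T] \<bullet> whisk [] (Y\<^sup>\<star>) [T, R, T, R, T] = N *\<^sub>a Id [R, T, R, T, R, T]"
    using N(2) by (simp flip: whisk_cmp)
  then have "N *\<^sub>a Id [R, T, R, T, R, T] = Zero [R, T, R, T, R, T] [R, T, R, T, R, T]"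
    unfolding Y0 by simp
  then show False
    using scl_eq_Zero N(1) Id_ne_Zero by (metis valid_Id)
qed

abbreviation "S3 \<equiv> [R, T, R, T, T, R, T, R]"

text \<open>The surviving unit channel: after \<open>kappa\<close> has capped the junction of
  \<open>x x\<close>, two letters \<open>T\<close> cancel and the next pair \<open>R R\<close>
  fuses.\<close>

definition phi :: "(letter, 'b) arrow" where
  "phi = whisk [R, T] Y [T, R] \<bullet> whisk [R, T, R] (cap T) [R, T, R]"

definition kappa :: "(letter, 'b) arrow" where
  "kappa = whisk [R, T, R, T] (cap R) [T, R, T, R]"

lemma phi_kappa_boundary [simp]: "valid phi" "src phi = S3" "tgt phi = x" "valid kappa" "src kappa = x @ x"
    "tgt kappa = S3"
  by (simp_all add: phi_def kappa_def words_3)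

lemma no_maps_3:
  "no_maps [R, R] [R, T, R, T, R]" "no_maps [R, R, T, R] [R, T, R, T, R, T]"
proof -
  have "no_maps [] [R, T, R, T, R]"
    using no_maps_small(1) words_3(4) no_maps_Rfrob[of "[]" R "[R, T, R, T]"] by simp
  moreover have "no_maps [R] [R, T, R, T, R]"
    using no_maps_small(2) words_3(4) no_maps_Lfrob[of R "[R]" "[T, R, T, R]"] by simp
  ultimately show "no_maps [R, R] [R, T, R, T, R]"
    using no_maps_RR[of "[]" "[]"] by simp
  have "no_maps [R, T, R, T] [T, R, T, R]"
    using alternating_distinct[of 1] words_3(5) by simp
  then have 1: "no_maps [R, T, R] [T, R, T, R, T]"
    using no_maps_Rfrob[of "[R, T, R]" T "[T, R, T, R]"] by simp
  have 2: "no_maps [T, R] [T, R, T, R, T]"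
    using no_maps_strip(1) no_maps_small(1) words_3(4) by blast
  have "no_maps [T, R] [R, T, R, T, R, T]"
    using 1 no_maps_Lfrob[of R "[T, R]" "[T, R, T, R, T]"] by simp
  moreover have "no_maps [R, T, R] [R, T, R, T, R, T]"
    using 1 2 no_maps_RR[of "[]" "[T, R]"] no_maps_Lfrob[of R "[R, T, R]" "[T, R, T, R, T]"] by simp
  ultimately show "no_maps [R, R, T, R] [R, T, R, T, R, T]"
    using no_maps_RR[of "[]" "[T, R]"] by simp
qed

text \<open>Cancel \<open>T T\<close> and split \<open>R R\<close>. The unit part vanishes by
  \<open>no_maps_3\<close>, and the \<open>R\<close> part consists of endomorphisms of the simple
  word \<open>x\<close>.\<close>

lemma spanned_phi: "spanned S3 x phi"
proof -
  have "no_maps ([R, T] @ [T, R]) x"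
    using no_maps_TT[of "[R]" "[R]"] no_maps_3(1) by (simp add: words_3)
  moreover have "spanned ([R, T] @ R # [T, R]) x (Id x)"
    using alternating_simple[of k] by (simp add: words_3)
  ultimately have "spanned ([R, T] @ R # R # [T, R]) x (Id x \<bullet> whisk [R, T] Y [T, R])"
    by (rule spanned_RR)
  then have "spanned ([R, T, R] @ [R, T, R]) x (Id x \<bullet> whisk [R, T] Y [T, R])"
    by simp
  then have "spanned ([R, T, R] @ T # T # [R, T, R]) x ((Id x \<bullet> whisk [R, T] Y [T, R]) \<bullet> whisk [R, T, R] (cap T) [R, T, R])"
    by (rule spanned_TT)
  then show ?thesis
    by (simp add: phi_def words_3)
qed

lemma spanned_phi_cup: "spanned S3 (x @ [T, T]) (whisk x (cup T) [] \<bullet> phi)"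
proof -
  have "spanned (x @ [T, T]) S3 (phi\<^sup>\<star> \<bullet> whisk x (cap T) [])"
    using spanned_TT[of x "[]"] spanned_adj[OF spanned_phi] by simp
  then have "spanned S3 (x @ [T, T]) ((phi\<^sup>\<star> \<bullet> whisk x (cap T) [])\<^sup>\<star>)"
    by (rule spanned_adj)
  then show ?thesis
    by simp
qed

text \<open>The line is carried along letter by letter: a further \<open>R\<close> adds only a unit
  part, which vanishes, and a further \<open>T\<close> changes the source by a unitary.\<close>

lemma spanned_act_RTRT: "spanned ([R, T, R, T] @ x) (x @ Ts k) (act [R, T, R, T])"
proof -
  have "no_maps ([R, T] @ [T, R, T, R]) (x @ [T])"
    using no_maps_TT[of "[R]" "[R, T, R]"] no_maps_3(2) by (simp add: words_3)
  moreover have "spanned ([R, T] @ R # [T, R, T, R]) (x @ [T]) (act [R, T])"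
    using spanned_act_RT by (simp add: words_3 del: act.simps)
  ultimately have "spanned ([R, T] @ R # R # [T, R, T, R]) (x @ [T]) (act [R, T] \<bullet> whisk [R, T] Y [T, R, T, R])"
    by (rule spanned_RR)
  moreover have "act [R, T, R] = act [R, T] \<bullet> whisk [R, T] Y [T, R, T, R]"
    using act_append[of "[R, T]" "[R]"] by (simp add: V_def words_3 del: act.simps)
  ultimately have "spanned ([R, T, R] @ x) (x @ [T]) (act [R, T, R])"
    by (simp add: words_3 del: act.simps)
  from spanned_strip_right[OF this]
  have "spanned ([R, T, R] @ x @ [T]) (x @ [T, T]) (whisk [] (act [R, T, R]) [T])"
    by (simp del: act.simps)
  then have "spanned ([R, T, R] @ T # x) (x @ [T, T]) (whisk [] (act [R, T, R]) [T] \<bullet> whisk [R, T, R] (U\<^sup>\<star>) [])"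
    by (rule spanned_iso) (simp_all add: whisk_UU)
  moreover have "act [R, T, R, T] = whisk [] (act [R, T, R]) [T] \<bullet> whisk [R, T, R] (U\<^sup>\<star>) []"
    using act_append[of "[R, T, R]" "[T]"] by (simp del: act.simps)
  ultimately show ?thesis
    by (simp add: words_3(2) del: act.simps)
qed

text \<open>If one diagonal entry of a unitary matrix of size two is zero, so is the other. Up to
  nonzero factors the ring is the entry at \<open>act x\<close>, \<open>c\<close> is the entry at
  \<open>phi \<bullet> kappa\<close>, and \<open>d\<close> is an entry off the diagonal.\<close>

lemma cross_ring_2: "cross \<bullet> whisk [] ((act x)\<^sup>\<star>) [T] \<noteq> Zero (x @ Ts (Suc k)) (T # x @ Ts k)"
proof
  assume z: "cross \<bullet> whisk [] ((act x)\<^sup>\<star>) [T] = Zero (x @ Ts (Suc k)) (T # x @ Ts k)"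
  let ?w = "[R, T, R, T]"
  note sp = words_3(6)
  have w: "x = ?w @ [R]" "num_T ?w = k"
    by (simp_all add: sp) (simp add: k2)
  define W where "W = whisk [] U x \<bullet> whisk x U []"
  have W [simp]: "valid W" "src W = x @ x @ [T]" "tgt W = T # x @ x"
    by (simp_all add: W_def)
  have cW: "cross = whisk [T] (act x) [] \<bullet> W"
    by (simp add: cross_def W_def)
  have tA [simp]: "tgt (act x) = x @ [T, T]" and tc [simp]: "tgt cross = T # x @ [T, T]"
    by (simp_all add: num_T_zeta words_3(2))
  define e2 where "e2 = cross \<bullet> whisk [] (kappa\<^sup>\<star>) [T]"
  define e1 where "e1 = (whisk [T] (phi \<bullet> kappa) [] \<bullet> W) \<bullet> whisk [] (kappa\<^sup>\<star>) [T]"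
  have e [simp]: "valid e1" "src e1 = S3 @ [T]" "tgt e1 = T # x" "valid e2" "src e2 = S3 @ [T]"
      "tgt e2 = T # x @ [T, T]"
    by (simp_all add: e1_def e2_def words_3(2))
  have kappa_T: "whisk [] (kappa\<^sup>\<star>) [T] = whisk ?w (cup R) [T, R, T, R, T]"
    "whisk [] kappa [T] = whisk ?w (cap R) [T, R, T, R, T]"
    by (simp_all add: kappa_def)
  \<comment> \<open>The channel through \<open>Y\<close> is dead by \<open>cross_merge\<close>, so
    \<open>cross\<close> is recovered from its restriction \<open>e2\<close> to the unit
    channel.\<close>
  have cross_e2: "cross = (1 / golden) *\<^sub>a (e2 \<bullet> whisk [] kappa [T])"
  proof -
    have m: "cross \<bullet> whisk ?w (Y\<^sup>\<star>) [T, R, T, R, T] = Zero (?w @ x @ [T]) (T # x @ [T, T])"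
      using cross_merge[OF z w spanned_act_RTRT] by (simp only: words_3(1,2)) simp
    have "src cross = ?w @ R # R # [T, R, T, R, T]"
      by (simp add: sp)
    then have "cross = (1 / golden) *\<^sub>a ((cross \<bullet> whisk ?w (cup R) [T, R, T, R, T]) \<bullet> whisk ?w (cap R) [T, R, T, R, T])
      \<oplus> golden\<^sup>2 *\<^sub>a ((cross \<bullet> whisk ?w (Y\<^sup>\<star>) [T, R, T, R, T]) \<bullet> whisk ?w Y [T, R, T, R, T])"
      by (subst split_RR[of cross ?w "[T, R, T, R, T]"]) (simp_all add: cmp_assoc sp)
    also have "\<dots> = (1 / golden) *\<^sub>a (e2 \<bullet> whisk [] kappa [T])"
      unfolding m e2_def kappa_T by (simp add: sp words_3(2))
    finally show ?thesis .
  qed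
  have capY: "cap R \<bullet> Y\<^sup>\<star> = Zero [R] []"
    using no_mapsD[OF no_maps_sym[OF no_maps_R], of "cap R \<bullet> Y\<^sup>\<star>"] by simp
  have kA: "kappa \<bullet> (act x)\<^sup>\<star> = Zero (x @ [T, T]) S3"
  proof -
    have "act x = act ?w \<bullet> whisk ?w V []"
      using act_append[of ?w "[R]"] w(1) by (simp del: act.simps)
    then have "kappa \<bullet> (act x)\<^sup>\<star> = (kappa \<bullet> whisk ?w (V\<^sup>\<star>) []) \<bullet> (act ?w)\<^sup>\<star>"
      by (simp add: cmp_assoc sp del: act.simps)
    also have "kappa \<bullet> whisk ?w (V\<^sup>\<star>) [] = whisk ?w (cap R \<bullet> Y\<^sup>\<star>) [T, R, T, R]"
      by (simp add: kappa_def V_def words_3(1) whisk_cmp)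
    finally show ?thesis
      unfolding capY by (simp add: sp del: act.simps)
  qed
  \<comment> \<open>Orthogonality of the two rows: \<open>W\<close> is unitary, and the maps
    \<open>phi \<bullet> kappa\<close> and \<open>act x\<close> that are applied after it are
    orthogonal by \<open>kA\<close>.\<close>
  have ee: "e1 \<bullet> e2\<^sup>\<star> = Zero (T # x @ [T, T]) (T # x)"
  proof -
    have WW: "W \<bullet> W\<^sup>\<star> = Id (T # x @ x)"
    proof -
      have UU: "whisk a U b \<bullet> whisk a (U\<^sup>\<star>) b \<bullet> f = f" if "valid f" "tgt f = a @ T # x @ b" for a b f
        using that by (simp add: whisk_UU flip: cmp_assoc)
      show ?thesis
        by (simp add: W_def cmp_assoc UU whisk_UU)
    qed
    have "(whisk [T] (phi \<bullet> kappa) [] \<bullet> W) \<bullet> cross\<^sup>\<star>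
      = whisk [T] (phi \<bullet> kappa) [] \<bullet> (W \<bullet> W\<^sup>\<star>) \<bullet> whisk [T] ((act x)\<^sup>\<star>) []"
      by (simp add: cW cmp_assoc)
    also have "\<dots> = whisk [T] (phi \<bullet> kappa \<bullet> (act x)\<^sup>\<star>) []"
      unfolding WW by (simp add: whisk_cmp cmp_assoc)
    also have "\<dots> = Zero (T # x @ [T, T]) (T # x)"
      unfolding kA by simp
    finally have 0: "(whisk [T] (phi \<bullet> kappa) [] \<bullet> W) \<bullet> cross\<^sup>\<star> = Zero (T # x @ [T, T]) (T # x)" .
    have "cross\<^sup>\<star> = (1 / golden) *\<^sub>a (whisk [] (kappa\<^sup>\<star>) [T] \<bullet> e2\<^sup>\<star>)"
      by (subst cross_e2) (simp add: golden_ne)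
    then have "(whisk [T] (phi \<bullet> kappa) [] \<bullet> W) \<bullet> cross\<^sup>\<star> = (1 / golden) *\<^sub>a (e1 \<bullet> e2\<^sup>\<star>)"
      by (simp add: e1_def cmp_assoc)
    then have "(1 / golden) *\<^sub>a (e1 \<bullet> e2\<^sup>\<star>) = Zero (T # x @ [T, T]) (T # x)"
      unfolding 0 ..
    moreover have "1 / golden \<noteq> 0"
      using golden_ne(1) by simp
    ultimately show ?thesis
      by (rule scl_eq_Zero[rotated]) simp
  qed
  \<comment> \<open>Both Hom spaces out of \<open>S3\<close> are lines, so removing the outer
    crossings turns the two rows into scalars.\<close>
  obtain c where c: "U\<^sup>\<star> \<bullet> e1 = c *\<^sub>a whisk [] phi [T]"
    using spannedD[OF spanned_strip_right[OF spanned_phi], of "U\<^sup>\<star> \<bullet> e1"] by auto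
  define psi where "psi = whisk x (cup T) [] \<bullet> phi"
  have psi [simp]: "valid psi" "src psi = S3" "tgt psi = x @ [T, T]"
    by (simp_all add: psi_def)
  obtain d where d: "whisk [] (U\<^sup>\<star>) [T, T] \<bullet> e2 = d *\<^sub>a whisk [] psi [T]"
    using spannedD[OF spanned_strip_right[OF spanned_phi_cup], of "whisk [] (U\<^sup>\<star>) [T, T] \<bullet> e2"]
    by (auto simp: psi_def)
  obtain N where N: "N \<noteq> 0" "Y \<bullet> Y\<^sup>\<star> = N *\<^sub>a Id [R]"
    by (rule Y_nonzero)
  have pp: "phi \<bullet> phi\<^sup>\<star> = N *\<^sub>a Id x"
  proof -
    have "phi \<bullet> phi\<^sup>\<star> = whisk [R, T] Y [T, R] \<bullet> whisk [R, T, R] (cap T \<bullet> cup T) [R, T, R] \<bullet> whisk [R, T] (Y\<^sup>\<star>) [T, R]"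
      by (simp add: phi_def cmp_assoc whisk_cmp)
    also have "\<dots> = whisk [R, T] (Y \<bullet> Y\<^sup>\<star>) [T, R]"
      unfolding loop_T by (simp add: whisk_cmp)
    finally show ?thesis
      unfolding N(2) by (simp add: sp)
  qed
  have "(c * cnj d * N) *\<^sub>a whisk x (cap T) [T] = (c *\<^sub>a whisk [] phi [T]) \<bullet> (d *\<^sub>a whisk [] psi [T])\<^sup>\<star>"
  proof -
    have "phi \<bullet> psi\<^sup>\<star> = N *\<^sub>a whisk x (cap T) []"
    proof -
      have "phi \<bullet> psi\<^sup>\<star> = (phi \<bullet> phi\<^sup>\<star>) \<bullet> whisk x (cap T) []"
        by (simp add: psi_def cmp_assoc)
      then show ?thesis
        unfolding pp by simp
    qed
    then have "whisk [] (phi \<bullet> psi\<^sup>\<star>) [T] = N *\<^sub>a whisk x (cap T) [T]"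
      by simp
    then have "whisk [] phi [T] \<bullet> whisk [] (psi\<^sup>\<star>) [T] = N *\<^sub>a whisk x (cap T) [T]"
      by (simp add: whisk_cmp)
    then show ?thesis
      by (simp add: mult_ac)
  qed
  also have "\<dots> = U\<^sup>\<star> \<bullet> (e1 \<bullet> e2\<^sup>\<star>) \<bullet> whisk [] U [T, T]"
    unfolding c[symmetric] d[symmetric] by (simp add: cmp_assoc)
  also have "\<dots> = Zero (x @ [T, T, T]) (x @ [T])"
    unfolding ee by simp
  finally have 0: "(c * cnj d * N) *\<^sub>a whisk x (cap T) [T] = Zero (x @ [T, T, T]) (x @ [T])" .
  have "(c * cnj d * N) *\<^sub>a Id (x @ [T]) = 0 *\<^sub>a Id (x @ [T])"
  proof -
    have "(c * cnj d * N) *\<^sub>a Id (x @ [T]) = ((c * cnj d * N) *\<^sub>a whisk x (cap T) [T]) \<bullet> whisk x (cup T) [T]"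
      using whisk_cmp[of "cup T" "cap T" x "[T]"] by (simp add: loop_T)
    then show ?thesis
      unfolding 0 by (simp add: scl_0)
  qed
  then have "c * cnj d * N = 0"
    by (rule scalar_unique)
  then have "c = 0 \<or> d = 0"
    using N(1) by simp
  then show False
  proof
    assume "d = 0"
    then have "whisk [] U [T, T] \<bullet> whisk [] (U\<^sup>\<star>) [T, T] \<bullet> e2 = Zero (S3 @ [T]) (T # x @ [T, T])"
      unfolding d by (simp add: scl_0)
    moreover have "whisk [] U [T, T] \<bullet> whisk [] (U\<^sup>\<star>) [T, T] \<bullet> e2 = e2"
      by (simp add: whisk_UU flip: cmp_assoc)
    ultimately have "cross = Zero (x @ x @ [T]) (T # x @ [T, T])"
      using cross_e2 by simp
    then show False
      using cross_nonzero by (simp add: words_3(2))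
  next
    assume "c = 0"
    then have "U \<bullet> U\<^sup>\<star> \<bullet> e1 = Zero (S3 @ [T]) (T # x)"
      unfolding c by (simp add: scl_0)
    moreover have "U \<bullet> U\<^sup>\<star> \<bullet> e1 = e1"
      by (simp flip: cmp_assoc)
    ultimately have e10: "e1 = Zero (S3 @ [T]) (T # x)"
      by simp
    \<comment> \<open>The cup \<open>T\<close> cancels against the cap in \<open>phi\<close>'s
      adjoint pattern of legs: precomposed with it, \<open>e1\<close> is exactly the diagram of two
      copies of \<open>U\<close> with five common legs, topped by \<open>Y\<close>.\<close>
    have "whisk [T, R, T] Y [T, R] \<bullet> whisk [T, R, T, R] B3 [] \<bullet> whisk [] A3 [R, T, R, T]
      = e1 \<bullet> whisk [R, T, R] (cup T) [R, T, R, T]"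
      unfolding shared_legs[symmetric] W_def[symmetric] e1_def kappa_T phi_def
      by (simp add: kappa_def whisk_cmp cmp_assoc sp)
    also have "\<dots> = Zero [R, T, R, R, T, R, T] [T, R, T, R, T, R]"
      unfolding e10 by (simp add: sp)
    finally show False
      using shared_legs_nonzero by simp
  qed
qed

end

context at_category
begin

theorem omega_eq_1_if_small:
  assumes "k < 3"
  shows "\<omega> = 1"
proof -
  consider "k = 0" | "k = 1" | "k = 2"
    using assms by linarith
  then show ?thesis
  proof cases
    case 3
    then interpret at_category_3 C obj cap Y k U \<omega>
      by unfold_locales
    show ?thesis
      by (rule omega_eq_1[OF cross_ring_2])
  qed (use omega_eq_1[OF cross_ring_0] omega_eq_1[OF cross_ring_1] in blast)+
qed

end

section \<open>The structure in a unitary quotient\<close>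

text \<open>The relation set of each of these locales is a parameter pinned down by an equation;
  discharging the equation by reflexivity instantiates the parameter.\<close>

lemmas A2_eq = involution_category.A2_eq[OF involution_category.intro, OF HOL.refl]
  and A2_structure = involution_category.A2_structure[OF involution_category.intro, OF HOL.refl]
  and star_hom_T2 = fib_category.star_hom_T2[OF fib_category.intro, OF HOL.refl]
  and T2_simps [simp] = fib_category.T2_simps(1-4)[OF fib_category.intro, OF HOL.refl]
  and T2_closed = fib_category.ident_hom_T2[OF fib_category.intro, OF HOL.refl]
    fib_category.comp_hom_T2[OF fib_category.intro, OF HOL.refl]
    fib_category.add_hom_T2[OF fib_category.intro, OF HOL.refl]
    fib_category.scale_hom_T2[OF fib_category.intro, OF HOL.refl]
  and T2_structure = fib_category.T2_structure[OF fib_category.intro, OF HOL.refl]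

lemma A2_strict: "strict_monoidal_star_category A2"
  unfolding A2_eq by (rule star_presentation.presented_strict_monoidal[OF tl_star_presentation])

lemma A2_simps [simp]: "ob A2 = UNIV" "tensor_ob A2 = (@)" "unt A2 = []" "dual A2 x = rev x"
  by (simp_all add: A2_def presented_def tl_presentation_def word_dual_def map_idI)

interpretation A2: strict_monoidal_star_category A2
  by (rule A2_strict)

type_synonym A2T2_diagram =
  "(unit list + nat, (unit list, tl_diagram set) vertex + (nat, tl_diagram set) vertex) diagram"

abbreviation Q :: "(unit list + nat, (unit list, tl_diagram set) vertex + (nat, tl_diagram set) vertex) presentation"
  where "Q \<equiv> free_product_presentation A2 T2"

interpretation Q: star_presentation Q
  by (rule free_product_star_presentation) (use A2.star_hom A2.star_star star_hom_T2 in auto)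

lemma letters_Q [simp]: "letters Q = UNIV"
  by (simp add: free_product_presentation_def UNIV_sum)

lemma ob_free_product [simp]: "ob (free_product A2 T2) = UNIV"
  by (simp add: free_product_def)

primrec emb :: "letter \<Rightarrow> unit list + nat" where
  "emb R = Inr 1"
| "emb T = Inl [()]"

lemma word_dual_emb: "word_dual Q (map emb w) = map emb (rev w)"
proof -
  have "ldual Q (emb l) = emb l" for l
    by (cases l) (simp_all add: free_product_presentation_def)
  then show ?thesis
    by (simp add: word_dual_def rev_map)
qed

lemma rho_theta: "\<rho> = map emb [R]" "\<theta> = map emb [T]"
  by (simp_all add: \<rho>_def \<theta>_def strands_def)

lemma map_word_power: "map f (word_power w n) = word_power (map f w) n"
  by (simp add: word_power_def map_concat)

locale quotient = unitary_quotient "free_product A2 T2" D F0 F1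
  for D :: "('o, 'm) pivotal_data" and F0 and F1
begin

sublocale unitary_pivotal_category D
  by (rule target)

definition obj :: "letter list \<Rightarrow> 'o" where
  "obj w = F0 (map emb w)"

sublocale word_category D obj
  using F0_ob F0_unt F0_tensor by unfold_locales (auto simp: obj_def free_product_def)

notation cmp (infixr \<open>\<bullet>\<close> 65) and tns (infixr \<open>\<boxtimes>\<close> 70) and pls (infixl \<open>\<oplus>\<close> 60)
  and scl (infixr \<open>*\<^sub>a\<close> 62) and adj (\<open>_\<^sup>\<star>\<close> [1000] 1000)

text \<open>The boundary of a diagram consists of objects of the two factors, so the words in
  \<open>R\<close> and \<open>T\<close> have to be supplied separately.\<close>

definition img :: "letter list \<Rightarrow> letter list \<Rightarrow> A2T2_diagram \<Rightarrow> (letter, 'm) arrow" where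
  "img u v t = Arrow u v (F1 (dclass Q t))"

definition img_ok :: "letter list \<Rightarrow> letter list \<Rightarrow> A2T2_diagram \<Rightarrow> bool" where
  "img_ok u v t \<longleftrightarrow> dwf Q t \<and> dsrc Q t = map emb u \<and> dtgt Q t = map emb v"

lemma img_boundary [simp]: "src (img u v t) = u" "tgt (img u v t) = v"
  by (simp_all add: img_def)

lemma img_hom: "img_ok u v t \<Longrightarrow> dclass Q t \<in> hom (free_product A2 T2) (map emb u) (map emb v)"
  unfolding img_ok_def free_product_def by (rule Q.hom_presentedI) auto

lemma valid_img: "img_ok u v t \<Longrightarrow> valid (img u v t)"
  using F1_hom[OF _ _ img_hom[of u v t]] by (simp add: valid_def img_def obj_def)

lemma img_comp: "\<lbrakk>img_ok u v t; img_ok v w s\<rbrakk> \<Longrightarrow> img v w s \<bullet> img u v t = img u w (DComp s t)"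
  using F1_comp[OF _ _ _ img_hom[of u v t] img_hom[of v w s]] Q.comp_dclass[of s t]
  by (simp add: img_def cmp_def img_ok_def free_product_def)

lemma img_add: "\<lbrakk>img_ok u v s; img_ok u v t\<rbrakk> \<Longrightarrow> img u v s \<oplus> img u v t = img u v (DAdd s t)"
  using F1_add[OF _ _ img_hom[of u v s] img_hom[of u v t]] Q.add_dclass[of s t]
  by (simp add: img_def pls_def img_ok_def dpar_def free_product_def)

lemma img_scale: "img_ok u v t \<Longrightarrow> a *\<^sub>a img u v t = img u v (DScale a t)"
  using F1_scale[OF _ _ img_hom[of u v t], of a] Q.scale_dclass[of t a]
  by (simp add: img_def scl_def img_ok_def free_product_def)

lemma img_star: "img_ok u v t \<Longrightarrow> (img u v t)\<^sup>\<star> = img v u (dstar Q t)"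
  using F1_star[OF _ _ img_hom[of u v t]] Q.star_dclass[of t]
  by (simp add: img_def adj_def img_ok_def free_product_def)

lemma img_Id: "img u u (DId (map emb u)) = Id u"
  using F1_ident[of "map emb u"] by (simp add: img_def Id_def obj_def free_product_def)

lemma img_deq: "deq Q s t \<Longrightarrow> img u v s = img u v t"
  using Q.dclass_eq[of s t] by (simp add: img_def)

end

text \<open>One factor \<open>M\<close> of the free product, restricted to the powers of an object \<open>a\<close> whose letter is \<open>l\<close>.\<close>

locale quotient_factor = quotient D F0 F1
  for D :: "('o, 'm) pivotal_data" and F0 and F1 +
  fixes M :: "('a, 'b) pivotal_data" and inj :: "'a \<Rightarrow> unit list + nat"
    and vtx :: "('a, 'b) vertex \<Rightarrow> (unit list, tl_diagram set) vertex + (nat, tl_diagram set) vertex"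
    and a :: 'a and l :: letter
  assumes rels_factor: "local_rels M inj vtx \<subseteq> rels Q"
    and vertex_gen: "v \<in> vertices M \<Longrightarrow> vtx v \<in> gens Q"
    and vertex_boundary: "gsrc Q (vtx (xs, ys, f)) = map inj xs" "gtgt Q (vtx (xs, ys, f)) = map inj ys"
    and vertex_adj: "gstar Q (vtx v) = vtx (vertex_star M v)"
    and object: "a \<in> ob M" "emb l = inj a"
    and cap_factor: "lev Q (inj a) = DGen (vtx ([a, a], [], ev M a))"
    and closed: "\<And>i. ident M (tensor_word M (replicate i a)) \<in> hom M (tensor_word M (replicate i a)) (tensor_word M (replicate i a))"
      "\<And>i j k f g. \<lbrakk>f \<in> hom M (tensor_word M (replicate i a)) (tensor_word M (replicate j a));
          g \<in> hom M (tensor_word M (replicate j a)) (tensor_word M (replicate k a))\<rbrakk>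
        \<Longrightarrow> comp M g f \<in> hom M (tensor_word M (replicate i a)) (tensor_word M (replicate k a))"
      "\<And>i j f g. \<lbrakk>f \<in> hom M (tensor_word M (replicate i a)) (tensor_word M (replicate j a));
          g \<in> hom M (tensor_word M (replicate i a)) (tensor_word M (replicate j a))\<rbrakk>
        \<Longrightarrow> add M f g \<in> hom M (tensor_word M (replicate i a)) (tensor_word M (replicate j a))"
      "\<And>i j f c. f \<in> hom M (tensor_word M (replicate i a)) (tensor_word M (replicate j a))
        \<Longrightarrow> scale M c f \<in> hom M (tensor_word M (replicate i a)) (tensor_word M (replicate j a))"
begin

abbreviation Hm :: "nat \<Rightarrow> nat \<Rightarrow> 'b set" where
  "Hm i j \<equiv> hom M (tensor_word M (replicate i a)) (tensor_word M (replicate j a))"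

abbreviation gen :: "nat \<Rightarrow> nat \<Rightarrow> 'b \<Rightarrow> A2T2_diagram" where
  "gen i j f \<equiv> DGen (vtx (replicate i a, replicate j a, f))"

definition im :: "nat \<Rightarrow> nat \<Rightarrow> 'b \<Rightarrow> (letter, 'm) arrow" where
  "im i j f = img (replicate i l) (replicate j l) (gen i j f)"

lemma vertex: "f \<in> Hm i j \<Longrightarrow> (replicate i a, replicate j a, f) \<in> vertices M"
  using object(1) by (auto simp: vertices_def)

lemma gen_ok: "f \<in> Hm i j \<Longrightarrow> img_ok (replicate i l) (replicate j l) (gen i j f)"
  using vertex_gen[OF vertex] object(2) by (simp add: img_ok_def vertex_boundary)

lemma im_boundary [simp]: "src (im i j f) = replicate i l" "tgt (im i j f) = replicate j l"
  by (simp_all add: im_def)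

lemma valid_im: "f \<in> Hm i j \<Longrightarrow> valid (im i j f)"
  unfolding im_def by (rule valid_img[OF gen_ok])

lemma im_rel:
  assumes "(s, t) \<in> local_rels M inj vtx" "img_ok u v s" "img_ok u v t"
  shows "img u v s = img u v t"
  using assms rels_factor by (intro img_deq deq.rel) (auto simp: dpar_def img_ok_def)

lemma im_comp:
  assumes "f \<in> Hm i j" "g \<in> Hm j k"
  shows "im j k g \<bullet> im i j f = im i k (comp M g f)"
proof -
  have "im j k g \<bullet> im i j f = img (replicate i l) (replicate k l) (DComp (gen j k g) (gen i j f))"
    unfolding im_def by (rule img_comp[OF gen_ok gen_ok]) fact+
  also have "\<dots> = im i k (comp M g f)"
    unfolding im_def
  proof (rule im_rel)
    show "(DComp (gen j k g) (gen i j f), gen i k (comp M g f)) \<in> local_rels M inj vtx"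
      unfolding local_rels_def using vertex[OF assms(1)] vertex[OF assms(2)] by blast
    show "img_ok (replicate i l) (replicate k l) (DComp (gen j k g) (gen i j f))"
      using gen_ok[OF assms(1)] gen_ok[OF assms(2)] by (simp add: img_ok_def)
    show "img_ok (replicate i l) (replicate k l) (gen i k (comp M g f))"
      by (rule gen_ok[OF closed(2)]) fact+
  qed
  finally show ?thesis .
qed

lemma im_add:
  assumes "f \<in> Hm i j" "g \<in> Hm i j"
  shows "im i j f \<oplus> im i j g = im i j (add M f g)"
proof -
  have "im i j f \<oplus> im i j g = img (replicate i l) (replicate j l) (DAdd (gen i j f) (gen i j g))"
    unfolding im_def by (rule img_add[OF gen_ok gen_ok]) fact+
  also have "\<dots> = im i j (add M f g)"
    unfolding im_def
  proof (rule im_rel)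
    show "(DAdd (gen i j f) (gen i j g), gen i j (add M f g)) \<in> local_rels M inj vtx"
      unfolding local_rels_def using vertex[OF assms(1)] vertex[OF assms(2)] by blast
    show "img_ok (replicate i l) (replicate j l) (DAdd (gen i j f) (gen i j g))"
      using gen_ok[OF assms(1)] gen_ok[OF assms(2)] by (simp add: img_ok_def)
    show "img_ok (replicate i l) (replicate j l) (gen i j (add M f g))"
      by (rule gen_ok[OF closed(3)]) fact+
  qed
  finally show ?thesis .
qed

lemma im_scale:
  assumes "f \<in> Hm i j"
  shows "c *\<^sub>a im i j f = im i j (scale M c f)"
proof -
  have "c *\<^sub>a im i j f = img (replicate i l) (replicate j l) (DScale c (gen i j f))"
    unfolding im_def by (rule img_scale[OF gen_ok]) fact
  also have "\<dots> = im i j (scale M c f)"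
    unfolding im_def
  proof (rule im_rel)
    show "(DScale c (gen i j f), gen i j (scale M c f)) \<in> local_rels M inj vtx"
      unfolding local_rels_def using vertex[OF assms] by blast
    show "img_ok (replicate i l) (replicate j l) (DScale c (gen i j f))"
      using gen_ok[OF assms] by (simp add: img_ok_def)
    show "img_ok (replicate i l) (replicate j l) (gen i j (scale M c f))"
      by (rule gen_ok[OF closed(4)]) fact
  qed
  finally show ?thesis .
qed

lemma im_ident: "im i i (ident M (tensor_word M (replicate i a))) = Id (replicate i l)"
proof -
  have "im i i (ident M (tensor_word M (replicate i a)))
    = img (replicate i l) (replicate i l) (DId (map inj (replicate i a)))"
    unfolding im_def
  proof (rule im_rel)
    show "(gen i i (ident M (tensor_word M (replicate i a))), DId (map inj (replicate i a))) \<in> local_rels M inj vtx"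
      unfolding local_rels_def using object(1) by fastforce
    show "img_ok (replicate i l) (replicate i l) (gen i i (ident M (tensor_word M (replicate i a))))"
      by (rule gen_ok[OF closed(1)])
    show "img_ok (replicate i l) (replicate i l) (DId (map inj (replicate i a)))"
      using object(2) by (simp add: img_ok_def)
  qed
  then show ?thesis
    using img_Id[of "replicate i l"] object(2) by simp
qed

lemma im_star: "f \<in> Hm i j \<Longrightarrow> (im i j f)\<^sup>\<star> = im j i (star M f)"
  unfolding im_def by (subst img_star[OF gen_ok]) (simp_all add: vertex_adj vertex_star_def)

lemma mor_cap:
  assumes "ev M a \<in> Hm 2 0"
  shows "mor (im 2 0 (ev M a)) = ev D (obj [l])"
proof -
  let ?g = "gen 2 0 (ev M a)"
  have g: "lev Q (inj a) = ?g"
    by (simp add: cap_factor numeral_2_eq_2)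
  have ok: "img_ok [l, l] [] ?g"
    using gen_ok[OF assms] by (simp add: numeral_2_eq_2)
  then have dwf: "dwf Q ?g" "dtgt Q ?g = []"
    by (simp_all add: img_ok_def)
  \<comment> \<open>\<open>word_ev\<close> pads the cap of a one-letter word with identities of the
    empty word, which are removed one after another.\<close>
  have "deq Q (DTensor (DId []) (DTensor ?g (DId []))) ?g"
    using deq.trans[OF deq.tensor_unit_left[of Q "DTensor ?g (DId [])"] deq.tensor_unit_right[of Q ?g]] dwf
    by simp
  then have "deq Q (DComp (DId []) (DTensor (DId []) (DTensor ?g (DId [])))) (DComp (DId []) ?g)"
    using dwf by (intro deq.cong_comp deq.refl) simp_all
  moreover have "deq Q (DComp (DId []) ?g) ?g"
    using deq.comp_id_left[of Q ?g] dwf by simp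
  ultimately have "deq Q (word_ev Q [inj a]) ?g"
    using deq.trans by (auto simp: g word_dual_def)
  then have "ev (free_product A2 T2) [emb l] = dclass Q ?g"
    using Q.dclass_eq object(2) by (simp add: free_product_def)
  then show ?thesis
    using F1_ev[of "[emb l]"] by (simp add: im_def img_def obj_def)
qed

end

lemma tensor_word_T2 [simp]: "tensor_word T2 (replicate i 1) = i" "tensor_word T2 (replicate i (Suc 0)) = i"
  by (induction i) (simp_all add: tensor_word_def)

section \<open>Caps, vertex and positivity in the target category\<close>

context quotient
begin

sublocale theta: quotient_factor D F0 F1 A2 Inl Inl "[()]" T
proof unfold_locales
  show "local_rels A2 Inl Inl \<subseteq> rels Q"
    by (simp add: free_product_presentation_def)
qed (auto simp: free_product_presentation_def intro: A2.ident_hom A2.comp_hom A2.add_hom A2.scale_hom)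

sublocale rho: quotient_factor D F0 F1 T2 Inr Inr 1 R
proof unfold_locales
  show "local_rels T2 Inr Inr \<subseteq> rels Q"
    by (simp add: free_product_presentation_def)
qed (auto simp: free_product_presentation_def intro: T2_closed)

definition cap :: "letter \<Rightarrow> (letter, 'm) arrow" where
  "cap l = (case l of R \<Rightarrow> rho.im 2 0 (ev T2 1) | T \<Rightarrow> theta.im 2 0 (ev A2 [()]))"

lemma ev_factor: "ev T2 1 \<in> rho.Hm 2 0" "ev A2 [()] \<in> theta.Hm 2 0"
  using T2_structure(2) A2_structure(1) tensor_word_T2[of 2]
  by (simp_all add: tensor_word_def numeral_2_eq_2)

lemma cap_boundary [simp]: "valid (cap l)" "src (cap l) = [l, l]" "tgt (cap l) = []"
proof -
  show "valid (cap l)"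
    using rho.valid_im[OF ev_factor(1)] theta.valid_im[OF ev_factor(2)]
    by (cases l) (simp_all only: cap_def letter.case)
  show "src (cap l) = [l, l]" "tgt (cap l) = []"
    by (cases l; simp add: cap_def numeral_2_eq_2 del: One_nat_def)
      (cases l; simp add: cap_def numeral_2_eq_2 del: One_nat_def)
qed

lemma mor_cap: "mor (cap l) = ev D (obj [l])"
  using rho.mor_cap[OF ev_factor(1)] theta.mor_cap[OF ev_factor(2)]
  by (cases l) (simp_all only: cap_def letter.case)

lemma dual_obj: "dual D (obj w) = obj (rev w)"
  using F0_dual[of "map emb w"] word_dual_emb[of w] by (simp add: obj_def free_product_def)

lemma coev_obj: "coev D (obj [l]) = mor ((cap l)\<^sup>\<star>)"
  by (simp add: coev_def dual_obj adj_def mor_cap)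

lemma zigzag_obj:
  "whisk [] (cap l) [l] \<bullet> whisk [l] ((cap l)\<^sup>\<star>) [] = Id [l]"
  "whisk [l] (cap l) [] \<bullet> whisk [] ((cap l)\<^sup>\<star>) [l] = Id [l]"
proof -
  have e: "whisk [] (cap l) [l] = cap l \<boxtimes> Id [l]" "whisk [l] ((cap l)\<^sup>\<star>) [] = Id [l] \<boxtimes> (cap l)\<^sup>\<star>"
    "whisk [l] (cap l) [] = Id [l] \<boxtimes> cap l" "whisk [] ((cap l)\<^sup>\<star>) [l] = (cap l)\<^sup>\<star> \<boxtimes> Id [l]"
    by (simp_all add: whisk_def)
  show "whisk [] (cap l) [l] \<bullet> whisk [l] ((cap l)\<^sup>\<star>) [] = Id [l]"
    "whisk [l] (cap l) [] \<bullet> whisk [] ((cap l)\<^sup>\<star>) [l] = Id [l]"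
    using zigzag[of "obj [l]"] unfolding e
    by (simp_all add: cmp_def tns_def Id_def coev_obj mor_cap dual_obj)
qed

lemma arrow_eq_Zero: "\<lbrakk>src f = u; tgt f = v; mor f = zero D (obj u) (obj v)\<rbrakk> \<Longrightarrow> f = Zero u v"
  by (cases f) (simp add: Zero_def)

lemma Id_Nil_nonzero: "Id [] \<noteq> Zero [] []"
  using ident_unt_nonzero by (simp add: Id_def Zero_def obj_Nil)

text \<open>For a nonzero \<open>f\<close> the trace of \<open>f\<^sup>\<star> \<bullet> f\<close>
  is a positive multiple of the nonzero unit scalar, whereas the trace of a zero arrow is
  zero.\<close>

lemma positive_arrow:
  assumes f: "valid f" "f\<^sup>\<star> \<bullet> f = Zero (src f) (src f)"
  shows "f = Zero (src f) (tgt f)"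
proof (rule ccontr)
  let ?s = "src f"
  assume "f \<noteq> Zero ?s (tgt f)"
  then have "mor f \<noteq> zero D (obj ?s) (obj (tgt f))"
    using arrow_eq_Zero by blast
  then obtain r where r: "r > 0" "comp D (ev D (obj ?s)) (comp D (tensor D (ident D (dual D (obj ?s)))
      (comp D (star D (mor f)) (mor f))) (coev D (dual D (obj ?s)))) = scale D (complex_of_real r) (ident D (unt D))"
    using trace_positive[of "obj ?s" "obj (tgt f)" "mor f"] f(1) by (auto simp: valid_def)
  define E where "E = Arrow (rev ?s @ ?s) [] (ev D (obj ?s))"
  have E: "valid E" "src E = rev ?s @ ?s" "tgt E = []" "mor E = ev D (obj ?s)"
    using ev_hom[of "obj ?s"] by (simp_all add: E_def valid_def dual_obj obj_append obj_Nil)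
  have "E \<bullet> (Id (rev ?s) \<boxtimes> (f\<^sup>\<star> \<bullet> f)) \<bullet> E\<^sup>\<star> = complex_of_real r *\<^sub>a Id []"
    using r(2) E(2,3) by (simp add: cmp_def tns_def Id_def adj_def scl_def coev_def dual_obj E(4) obj_Nil)
  moreover have "Id (rev ?s) \<boxtimes> Zero ?s ?s = Zero (rev ?s @ ?s) (rev ?s @ ?s)"
    using whisk_Zero[of "rev ?s" ?s ?s "[]"] by (simp add: whisk_def)
  ultimately have "complex_of_real r *\<^sub>a Id [] = Zero [] []"
    using E by (simp add: f(2))
  then show False
    using scl_eq_Zero[of "Id []" "complex_of_real r" "[]" "[]"] Id_Nil_nonzero r(1) by simp
qed

lemma unit_scalars_arrow: "\<lbrakk>valid f; src f = []; tgt f = []\<rbrakk> \<Longrightarrow> \<exists>c. f = c *\<^sub>a Id []"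
  using unt_simple[of "mor f"] by (cases f) (auto simp: valid_def scl_def Id_def obj_Nil)

text \<open>For a map out of the unit the cups and identities belonging to the unit are trivial, and
  the pivotal axiom reduces to this equation.\<close>

lemma cap_swap:
  assumes g: "valid g" "src g = []" "tgt g = [R]"
  shows "cap R \<bullet> whisk [R] g [] = cap R \<bullet> whisk [] g [R]"
proof -
  have 1: "coev D (unt D) = ident D (unt D)" "dual D (unt D) = unt D"
    using star_ident[of "unt D"] unt_ob by (simp_all add: coev_def dual_unt ev_unt)
  have "mor ((cap R \<boxtimes> Id []) \<bullet> (Id [R] \<boxtimes> g \<boxtimes> Id []) \<bullet> (Id [R] \<boxtimes> Id []))
    = mor ((Id [] \<boxtimes> cap R) \<bullet> (Id [] \<boxtimes> g \<boxtimes> Id [R]) \<bullet> (Id [] \<boxtimes> Id [R]))"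
    using pivotal[of "obj []" "obj [R]" "mor g"] g
    by (simp add: valid_def cmp_def tns_def Id_def mor_cap dual_obj obj_Nil 1 unt_ob)
  then have "mor (cap R \<bullet> whisk [R] g []) = mor (cap R \<bullet> whisk [] g [R])"
    using g by (simp add: whisk_def)
  then show ?thesis
    using g by (simp add: cmp_def)
qed

text \<open>Any vertex with the fusion identity serves. Its norm is recovered from that identity in
  \<open>Y_nonzero\<close>.\<close>

definition Y :: "(letter, 'm) arrow" where
  "Y = rho.im 2 1 (SOME y. y \<in> hom T2 2 1 \<and> ident T2 2 = add T2 (scale T2 (1 / golden) (comp T2 (star T2 (ev T2 1)) (ev T2 1)))
    (scale T2 (golden\<^sup>2) (comp T2 (star T2 y) y)))"

lemma Y_props:
  "valid Y" "src Y = [R, R]" "tgt Y = [R]"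
  "Id [R, R] = (1 / golden) *\<^sub>a ((cap R)\<^sup>\<star> \<bullet> cap R) \<oplus> golden\<^sup>2 *\<^sub>a (Y\<^sup>\<star> \<bullet> Y)"
proof -
  define y where "y = (SOME y. y \<in> hom T2 2 1 \<and> ident T2 2 = add T2 (scale T2 (1 / golden) (comp T2 (star T2 (ev T2 1)) (ev T2 1)))
    (scale T2 (golden\<^sup>2) (comp T2 (star T2 y) y)))"
  have y: "y \<in> hom T2 2 1" "ident T2 2 = add T2 (scale T2 (1 / golden) (comp T2 (star T2 (ev T2 1)) (ev T2 1)))
    (scale T2 (golden\<^sup>2) (comp T2 (star T2 y) y))"
    using someI_ex[of "\<lambda>y. y \<in> hom T2 2 1 \<and> ident T2 2 = add T2 (scale T2 (1 / golden)
      (comp T2 (star T2 (ev T2 1)) (ev T2 1))) (scale T2 (golden\<^sup>2) (comp T2 (star T2 y) y))"]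
      T2_structure(1,4) unfolding y_def by blast+
  have Y: "Y = rho.im 2 1 y"
    by (simp only: Y_def y_def)
  have H: "rho.Hm i j = hom T2 i j" for i j
    by simp
  note ev = ev_factor(1)[unfolded H]
  note st = star_hom_T2[OF ev, THEN conjunct1] star_hom_T2[OF y(1), THEN conjunct1]
  note cl = T2_closed(2)[OF ev st(1)] T2_closed(2)[OF y(1) st(2)]
  show "valid Y"
    unfolding Y by (rule rho.valid_im) (simp only: H y(1))
  show "src Y = [R, R]" "tgt Y = [R]"
    by (simp_all add: Y numeral_2_eq_2 del: One_nat_def) simp
  have "Id [R, R] = rho.im 2 2 (ident T2 2)"
    using rho.im_ident[of 2] by (simp add: numeral_2_eq_2 tensor_word_def)
  also have "\<dots> = (1 / golden) *\<^sub>a ((cap R)\<^sup>\<star> \<bullet> cap R) \<oplus> golden\<^sup>2 *\<^sub>a (Y\<^sup>\<star> \<bullet> Y)"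
    unfolding y(2) Y cap_def letter.case
    using y(1) ev st cl T2_closed(4)[OF cl(1)] T2_closed(4)[OF cl(2)]
    by (simp only: rho.im_star rho.im_comp rho.im_scale rho.im_add H)
  finally show "Id [R, R] = (1 / golden) *\<^sub>a ((cap R)\<^sup>\<star> \<bullet> cap R) \<oplus> golden\<^sup>2 *\<^sub>a (Y\<^sup>\<star> \<bullet> Y)" .
qed

lemma loop_R: "cap R \<bullet> (cap R)\<^sup>\<star> = golden *\<^sub>a Id []"
proof -
  have H: "rho.Hm i j = hom T2 i j" for i j
    by simp
  note ev = ev_factor(1)[unfolded H]
  note st = star_hom_T2[OF ev, THEN conjunct1]
  have "cap R \<bullet> (cap R)\<^sup>\<star> = rho.im 0 0 (scale T2 golden (ident T2 0))"
    unfolding cap_def letter.case T2_structure(3)[symmetric]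
    using ev st by (simp only: rho.im_star rho.im_comp H)
  also have "\<dots> = golden *\<^sub>a rho.im 0 0 (ident T2 0)"
    using T2_closed(1)[of 0] by (simp only: rho.im_scale H)
  also have "rho.im 0 0 (ident T2 0) = Id []"
    using rho.im_ident[of 0] by (simp add: tensor_word_def)
  finally show ?thesis .
qed

lemma theta_relations: "cap T \<bullet> (cap T)\<^sup>\<star> = Id []" "Id [T, T] = (cap T)\<^sup>\<star> \<bullet> cap T"
proof -
  note ev = ev_factor(2)
  have st: "star A2 (ev A2 [()]) \<in> theta.Hm 0 2"
    using ev A2.star_hom by simp
  have "cap T \<bullet> (cap T)\<^sup>\<star> = theta.im 0 0 (ident A2 [])"
    unfolding cap_def letter.case A2_structure(2)[symmetric] using ev st
    by (simp only: theta.im_star theta.im_comp)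
  then show "cap T \<bullet> (cap T)\<^sup>\<star> = Id []"
    using theta.im_ident[of 0] by (simp add: tensor_word_def)
  have "theta.im 2 2 (ident A2 [(), ()]) = (cap T)\<^sup>\<star> \<bullet> cap T"
    unfolding cap_def letter.case A2_structure(3) using ev st
    by (simp only: theta.im_star theta.im_comp)
  then show "Id [T, T] = (cap T)\<^sup>\<star> \<bullet> cap T"
    using theta.im_ident[of 2] by (simp add: tensor_word_def numeral_2_eq_2)
qed

lemma fib_theta: "fib_theta_category D obj cap Y"
  by unfold_locales
    (fact cap_boundary zigzag_obj positive_arrow unit_scalars_arrow Id_Nil_nonzero cap_swap Y_props
      loop_R theta_relations | assumption)+

end

theorem theorem3p17:
  fixes n :: nat and \<omega> :: complex and D :: "('o, 'm) pivotal_data"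
  assumes "n \<in> {1, 2, 3}" and "\<omega> ^ (2 * n) = 1" and "is_AT n \<omega> D"
  shows "\<omega> = 1"
proof -
  obtain F0 F1 U where quot: "unitary_quotient (free_product A2 T2) D F0 F1"
    and niso: "\<And>m. \<lbrakk>0 < m; m < n\<rbrakk>
      \<Longrightarrow> \<not> iso_objects D (F0 (word_power (\<rho> @ \<theta>) m)) (F0 (word_power (\<theta> @ \<rho>) m))"
    and U: "unitary_iso D (F0 (word_power (\<rho> @ \<theta>) n)) (F0 (word_power (\<theta> @ \<rho>) n)) U"
    and inv: "inverse_fourier D (F0 \<theta>) (F0 (\<rho> @ word_power (\<theta> @ \<rho>) (n - 1))) U = star D U"
    and fou: "star D U = scale D (inverse \<omega>) (fourier D (F0 \<rho>) (F0 (word_power (\<theta> @ \<rho>) (n - 1) @ \<theta>)) U)"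
    using assms(3) unfolding is_AT_def by blast
  interpret quotient D F0 F1
    by (rule quotient.intro[OF quot])
  interpret fib_theta_category D obj cap Y
    by (rule fib_theta)
  obtain k where n: "n = Suc k" "k < 3"
    using assms(1) by (cases n) auto
  \<comment> \<open>A root of unity is not zero, so \<open>inverse \<omega>\<close> in the rotation
    condition is a genuine inverse and can be cleared.\<close>
  have w0: "\<omega> \<noteq> 0"
    using assms(2) n(1) by (auto simp: power_0_left)
  define A where "A = Arrow (word_power [R, T] (Suc k)) (word_power [T, R] (Suc k)) U"
  have words: "F0 (word_power (\<rho> @ \<theta>) m) = obj (word_power [R, T] m)"
    "F0 (word_power (\<theta> @ \<rho>) m) = obj (word_power [T, R] m)" for m
    unfolding obj_def map_word_power rho_theta by simp_all
  have A: "valid A" "src A = word_power [R, T] (Suc k)" "tgt A = word_power [T, R] (Suc k)" "mor A = U"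
    and AA: "A\<^sup>\<star> \<bullet> A = Id (src A)" "A \<bullet> A\<^sup>\<star> = Id (tgt A)"
    using U unfolding unitary_iso_def words n(1)
    by (simp_all add: A_def valid_def cmp_def adj_def Id_def)
  have niso': "\<not> iso_words (word_power [R, T] (Suc m)) (word_power [T, R] (Suc m))" if "m < k" for m
  proof
    assume "iso_words (word_power [R, T] (Suc m)) (word_power [T, R] (Suc m))"
    then have "iso_objects D (obj (word_power [R, T] (Suc m))) (obj (word_power [T, R] (Suc m)))"
      unfolding iso_words_def iso_objects_def
      by (auto simp: valid_def cmp_def Id_def intro!: bexI)
    then show False
      using niso[of "Suc m"] that n(1) unfolding words by simp
  qed
  note [simp] = A(1,4)
  let ?z = "eta k @ [T]" and ?x = "R # eta k"
  have b: "src A = R # ?z" "tgt A = ?z @ [R]" "src A = ?x @ [T]" "tgt A = T # ?x"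
    by (simp_all add: A word_power_eta eta_Suc_right)
  have objs: "F0 \<rho> = obj [R]" "F0 \<theta> = obj [T]" "F0 (\<rho> @ word_power (\<theta> @ \<rho>) (n - 1)) = obj ?x"
    "F0 (word_power (\<theta> @ \<rho>) (n - 1) @ \<theta>) = obj ?z"
    unfolding obj_def rho_theta n(1) by (simp_all add: eta_def map_word_power)
  \<comment> \<open>The inverse Fourier transform bends the last source letter \<open>T\<close> up
    on the right and the first target letter \<open>T\<close> down on the left. Undoing the second
    bend will give \<open>rotate_T\<close>.\<close>
  have "A\<^sup>\<star> = Ldn T (Rup T A)"
  proof -
    have "Ldn T (Rup T A) = (cap T \<boxtimes> Id (?x @ [T])) \<bullet> (Id [T] \<boxtimes> A \<boxtimes> Id [T]) \<bullet> (Id (T # ?x) \<boxtimes> (cap T)\<^sup>\<star>)"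
    proof -
      have "Ldn T (Rup T A) = whisk [] (cap T) (?x @ [T]) \<bullet> whisk [T] A [T] \<bullet> whisk (T # ?x) ((cap T)\<^sup>\<star>) []"
        by (simp add: Ldn_def Rup_def whisk_cmp b(3,4) butlast_append)
      then show ?thesis
        by (simp add: whisk_def)
    qed
    then have "mor (Ldn T (Rup T A)) = inverse_fourier D (obj [T]) (obj ?x) U"
      by (simp add: inverse_fourier_def cmp_def tns_def Id_def mor_cap coev_obj flip: obj_append)
    then have "mor (Ldn T (Rup T A)) = mor (A\<^sup>\<star>)"
      using inv unfolding objs by (simp add: adj_def)
    moreover have "src (Ldn T (Rup T A)) = src (A\<^sup>\<star>)" "tgt (Ldn T (Rup T A)) = tgt (A\<^sup>\<star>)"
      by (simp_all add: b(3,4) butlast_append)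
    ultimately show ?thesis
      by (metis arrow.expand)
  qed
  then have rot_T: "Rup T A = Lup T (A\<^sup>\<star>)"
    by (simp add: b(3,4))
  \<comment> \<open>The Fourier transform bends the first source letter \<open>R\<close> up on the
    left and the last target letter \<open>R\<close> down on the right. Undoing the second bend will
    give \<open>rotate_R\<close>.\<close>
  have "A\<^sup>\<star> = inverse \<omega> *\<^sub>a Rdn R (Lup R A)"
  proof -
    have "Rdn R (Lup R A) = (Id (R # ?z) \<boxtimes> cap R) \<bullet> (Id [R] \<boxtimes> A \<boxtimes> Id [R]) \<bullet> ((cap R)\<^sup>\<star> \<boxtimes> Id (?z @ [R]))"
    proof -
      have "Rdn R (Lup R A) = whisk (R # ?z) (cap R) [] \<bullet> whisk [R] A [R] \<bullet> whisk [] ((cap R)\<^sup>\<star>) (?z @ [R])"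
        by (simp add: Rdn_def Lup_def whisk_cmp b(1,2) butlast_append)
      then show ?thesis
        by (simp add: whisk_def)
    qed
    then have "mor (Rdn R (Lup R A)) = fourier D (obj [R]) (obj ?z) U"
      by (simp add: fourier_def cmp_def tns_def Id_def mor_cap coev_obj flip: obj_append)
    then have "mor (inverse \<omega> *\<^sub>a Rdn R (Lup R A)) = mor (A\<^sup>\<star>)"
      using fou unfolding objs by (simp add: adj_def scl_def)
    moreover have "src (inverse \<omega> *\<^sub>a Rdn R (Lup R A)) = src (A\<^sup>\<star>)" "tgt (inverse \<omega> *\<^sub>a Rdn R (Lup R A)) = tgt (A\<^sup>\<star>)"
      by (simp_all add: b(1,2) butlast_append)
    ultimately show ?thesis
      by (metis arrow.expand)
  qed
  then have "\<omega> *\<^sub>a Rup R (A\<^sup>\<star>) = Lup R A"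
    using w0 by (simp add: b(1,2) last_append butlast_append)
  then have rot_R: "Lup R A = \<omega> *\<^sub>a Rup R (A\<^sup>\<star>)" ..
  interpret at_category D obj cap Y k A \<omega>
    by unfold_locales (use A AA niso' rot_T rot_R in auto)
  show ?thesis
    by (rule omega_eq_1_if_small[OF n(2)])
qed

end
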